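(* Let $k\ge3$ be a natural number such that $\mathbb{S}^{k-1}$ is an odd-dimensional Euclidean unit sphere, and let $\mu$ denote the Haar measure on $\mathbb{S}^{k-1}$ (the rotation-invariant Borel probability measure). Let $B$ be a simple, separable, unital, nuclear, $\mathcal{Z}$-stable $\mathrm{C}^*$-algebra that has a unique trace $\tau_B$, real rank zero and trivial $K_1$. Then the tracial variance of $\mu$-random extremal embeddings $\varphi_x\colon\mathcal{Z}_{\mathbb{S}^{k-1}}\to B$ relative to the core $\mathcal{L}(\mathcal{Z}_{\mathbb{S}^{k-1}})$ is bounded by \[ \sup_{f\in\mathcal{L}(\mathcal{Z}_{\mathbb{S}^{k-1}})}\operatorname{Var}\bigl(\tau_B\circ\varphi_x(f)\bigr)\le\frac{1}{k-2}, \] where $x\in\mathbb{S}^{k-1}$ is random with law $\mu$. Moreover, for empirical embeddings $\varphi_{\mu_n}\colon\mathcal{Z}_{\mathbb{S}^{k-1}}\to B$ and every $\varepsilon>0$, for all sufficiently large $n\in\mathbb{N}$, \[ \mathbb{P}_\mu\left(\sup_{f\in\mathcal{L}(\mathcal{Z}_{\mathbb{S}^{k-1}})}|\tau_B\circ\varphi_{\mu_n}(f)-\tau_B\circ\varphi_\mu(f)|\le\varepsilon\right)\ge1-\exp\left(-\frac{n\varepsilon^2}{\pi^2}\right). \]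
   Context: $\mathcal{Z}$ is the Jiang–Su algebra; $T(A)$ is the space of tracial states of $A$; $T(\varphi)$ is $\tau\mapsto\tau\circ\varphi$. $\mathcal{M}(X)$ is the set of Borel probability measures on $X$. $X=\mathbb{S}^{k-1}$ carries its round (geodesic) metric $\rho$, of diameter $\pi$. **The model $\mathcal{Z}_X$ and its core.** For $p,q\in\mathbb{N}$ and distinct $x_0,x_1\in X$, let $X_{p,q}=\{f\in C(X,M_p\otimes M_q)\mid f(x_0)\in M_p\otimes1_q,\ f(x_1)\in1_p\otimes M_q\}$ (prime if $p,q$ are coprime). $T(X_{p,q})\cong\mathcal{M}(X)$ via $\nu\mapsto(f\mapsto\int\mathrm{tr}_{pq}(f(x))\,d\nu(x))$. Write $L_\rho(a)$ for the Lipschitz constant of $x\mapsto\mathrm{tr}_{pq}(a(x))$. $\mathcal{Z}_X$ is a fixed projectionless, unital, simple, separable, nuclear, $\mathcal{Z}$-stable $\mathrm{C}^*$-algebra satisfying the UCT, constructed as $\varinjlim(X_{p_n,q_n},\varphi_n)$, a limit of prime algebras $X_{p_n,q_n}$ with unital injective connecting maps such that, for some summable sequence $\varepsilon_n>0$, $T(\varphi_n)\colon\mathcal{M}(X)\to\mathcal{M}(X)$ is within $\varepsilon_n$ of the identity relative to both the uniform metric and the Lipschitz seminorm associated with the $1$-Wasserstein metric $W_{1,\rho}$ (so $L_\rho(\varphi_n(a))\le(1+\varepsilon_n)L_\rho(a)$); $\partial_eT(\mathcal{Z}_X)$ is identified with $X$ and $T(\mathcal{Z}_X)$ with $\mathcal{M}(X)$,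 so that the limits of the metrics obtained from $L_\rho^{(n)}:=\sup_{m\ge n}L_\rho\circ\varphi_{n,m}$ recover $\rho$ on $X$. With $\varphi_{n,\infty}\colon X_{p_n,q_n}\to\mathcal{Z}_X$ the canonical maps, for $r\ge\frac12\operatorname{diam}(X,\rho)$ put $\mathcal{D}_r(X_{p,q})=\{f\in(X_{p,q})_{sa}\mid\|f\|\le r,\ \|f(x)-f(y)\|\le\rho(x,y)\ \forall x,y\in X\}$, $\mathcal{D}^{(n)}_r(X_{p_n,q_n})=\{a\in\mathcal{D}_r(X_{p_n,q_n})\mid L_\rho^{(n)}(a)\le1\}$ and $\mathcal{L}_r(\mathcal{Z}_X)=\bigcup_n\varphi_{n,\infty}(\mathcal{D}^{(n)}_r(X_{p_n,q_n}))$. Write $\mathcal{L}(\mathcal{Z}_X)=\mathcal{L}_{r}(\mathcal{Z}_X)$ for $r=\frac12\operatorname{diam}(X,\rho)$. Elements $f$ of this core are tracially $1$-Lipschitz: $x\mapsto\tau_x(f)$ is a $1$-Lipschitz function on $(X,\rho)$, where $\tau_x$ is the extremal trace at $x$. **Random embeddings.** For $\nu\in\mathcal{M}(X)\cong T(\mathcal{Z}_X)$, $\varphi_\nu\colon\mathcal{Z}_X\to B$ denotes a unital embedding such that $\tau_B\circ\varphi_\nu$ is the trace corresponding to $\nu$ (it exists and is unique up to approximate unitary equivalence); $\varphi_x=\varphi_{\delta_x}$ for $x\in X$. $\mathbb{P}_\mu$ is the law of an infinite sequence $(x_n)_{n\in\mathbb{N}}$ of independent $X$-valued random variables each with distribution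 $\mu$, and $\mu_n=\frac1n\sum_{i=1}^n\delta_{x_i}$ is the empirical measure. *)

theory Defs
  imports "HOL-Probability.Probability" "HOL-Algebra.Module" "HOL-Algebra.Ideal"
    "Jordan_Normal_Form.Schur_Decomposition"
begin

section \<open>Unital C*-algebras\<close>

definition complex_ring :: "complex ring" where
  "complex_ring = \<lparr>carrier = UNIV, mult = (*), one = 1, zero = 0, add = (+)\<rparr>"

record 'a cstar = "(complex, 'a) module" +
  star :: "'a \<Rightarrow> 'a"
  nrm :: "'a \<Rightarrow> real"

locale cstar_algebra = module complex_ring A + ring A for A :: "('a, 'm) cstar_scheme" (structure) +
  assumes smult_mult_left:
      "\<lbrakk>x \<in> carrier A; y \<in> carrier A\<rbrakk> \<Longrightarrow> (c \<odot> x) \<otimes> y = c \<odot> (x \<otimes> y)"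
    and smult_mult_right:
      "\<lbrakk>x \<in> carrier A; y \<in> carrier A\<rbrakk> \<Longrightarrow> x \<otimes> (c \<odot> y) = c \<odot> (x \<otimes> y)"
    and star_closed: "x \<in> carrier A \<Longrightarrow> star A x \<in> carrier A"
    and star_star: "x \<in> carrier A \<Longrightarrow> star A (star A x) = x"
    and star_add:
      "\<lbrakk>x \<in> carrier A; y \<in> carrier A\<rbrakk> \<Longrightarrow> star A (x \<oplus> y) = star A x \<oplus> star A y"
    and star_smult: "x \<in> carrier A \<Longrightarrow> star A (c \<odot> x) = cnj c \<odot> star A x"
    and star_mult:
      "\<lbrakk>x \<in> carrier A; y \<in> carrier A\<rbrakk> \<Longrightarrow> star A (x \<otimes> y) = star A y \<otimes> star A x"
    and nrm_nonneg: "x \<in> carrier A \<Longrightarrow> 0 \<le> nrm A x"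
    and nrm_eq_0: "x \<in> carrier A \<Longrightarrow> nrm A x = 0 \<longleftrightarrow> x = \<zero>"
    and nrm_triangle:
      "\<lbrakk>x \<in> carrier A; y \<in> carrier A\<rbrakk> \<Longrightarrow> nrm A (x \<oplus> y) \<le> nrm A x + nrm A y"
    and nrm_smult: "x \<in> carrier A \<Longrightarrow> nrm A (c \<odot> x) = cmod c * nrm A x"
    and nrm_mult:
      "\<lbrakk>x \<in> carrier A; y \<in> carrier A\<rbrakk> \<Longrightarrow> nrm A (x \<otimes> y) \<le> nrm A x * nrm A y"
    and cstar_identity: "x \<in> carrier A \<Longrightarrow> nrm A (star A x \<otimes> x) = (nrm A x)\<^sup>2"
    and complete:
      "\<lbrakk>\<And>n. s n \<in> carrier A;
        \<And>e. e > 0 \<Longrightarrow> \<exists>N. \<forall>m\<ge>N. \<forall>n\<ge>N. nrm A (s m \<ominus> s n) < e\<rbrakk>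
       \<Longrightarrow> \<exists>x\<in>carrier A. (\<lambda>n. nrm A (s n \<ominus> x)) \<longlonglongrightarrow> 0"

definition self_adjoint :: "('a, 'm) cstar_scheme \<Rightarrow> 'a set" where
  "self_adjoint A = {a \<in> carrier A. star A a = a}"

text \<open>Unital *-homomorphisms; preservation of the unit is part of \<open>Ring.ring_hom\<close>.\<close>

definition star_hom :: "('a, 'm) cstar_scheme \<Rightarrow> ('c, 'n) cstar_scheme \<Rightarrow> ('a \<Rightarrow> 'c) set" where
  "star_hom A C = {h \<in> Ring.ring_hom A C.
     (\<forall>c. \<forall>a\<in>carrier A. h (c \<odot>\<^bsub>A\<^esub> a) = c \<odot>\<^bsub>C\<^esub> h a) \<and>
     (\<forall>a\<in>carrier A. h (star A a) = star C (h a))}"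

definition star_embedding :: "('a, 'm) cstar_scheme \<Rightarrow> ('c, 'n) cstar_scheme \<Rightarrow> ('a \<Rightarrow> 'c) set" where
  "star_embedding A C = {h \<in> star_hom A C. inj_on h (carrier A)}"

definition simple_cstar :: "('a, 'm) cstar_scheme \<Rightarrow> bool" where
  "simple_cstar A \<longleftrightarrow> carrier A \<noteq> {\<zero>\<^bsub>A\<^esub>} \<and>
     (\<forall>I. ideal I A \<and>
        (\<forall>s. \<forall>a\<in>carrier A. (\<forall>n. s n \<in> I) \<and> (\<lambda>n. nrm A (s n \<ominus>\<^bsub>A\<^esub> a)) \<longlonglongrightarrow> 0 \<longrightarrow> a \<in> I) \<longrightarrow>
        I = {\<zero>\<^bsub>A\<^esub>} \<or> I = carrier A)"

definition separable_cstar :: "('a, 'm) cstar_scheme \<Rightarrow> bool" where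
  "separable_cstar A \<longleftrightarrow> (\<exists>D\<subseteq>carrier A. countable D \<and>
     (\<forall>a\<in>carrier A. \<forall>e>0. \<exists>d\<in>D. nrm A (a \<ominus>\<^bsub>A\<^esub> d) < e))"

definition projectionless :: "('a, 'm) cstar_scheme \<Rightarrow> bool" where
  "projectionless A \<longleftrightarrow>
     (\<forall>a\<in>self_adjoint A. a \<otimes>\<^bsub>A\<^esub> a = a \<longrightarrow> a = \<zero>\<^bsub>A\<^esub> \<or> a = \<one>\<^bsub>A\<^esub>)"

definition real_rank_zero :: "('a, 'm) cstar_scheme \<Rightarrow> bool" where
  "real_rank_zero A \<longleftrightarrow> (\<forall>a\<in>self_adjoint A. \<forall>e>0.
     \<exists>b\<in>self_adjoint A \<inter> Units A. nrm A (a \<ominus>\<^bsub>A\<^esub> b) < e)"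

text \<open>Traces are extensional functions, so that equality of traces is equality on the algebra.\<close>

definition tracial_states :: "('a, 'm) cstar_scheme \<Rightarrow> ('a \<Rightarrow> complex) set" where
  "tracial_states A = {\<tau> \<in> extensional (carrier A).
     (\<forall>a\<in>carrier A. \<forall>b\<in>carrier A. \<tau> (a \<oplus>\<^bsub>A\<^esub> b) = \<tau> a + \<tau> b) \<and>
     (\<forall>c. \<forall>a\<in>carrier A. \<tau> (c \<odot>\<^bsub>A\<^esub> a) = c * \<tau> a) \<and>
     (\<forall>a\<in>carrier A. \<tau> (star A a \<otimes>\<^bsub>A\<^esub> a) \<in> \<real> \<and> 0 \<le> Re (\<tau> (star A a \<otimes>\<^bsub>A\<^esub> a))) \<and>
     \<tau> \<one>\<^bsub>A\<^esub> = 1 \<and>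
     (\<forall>a\<in>carrier A. \<forall>b\<in>carrier A. \<tau> (a \<otimes>\<^bsub>A\<^esub> b) = \<tau> (b \<otimes>\<^bsub>A\<^esub> a))}"

definition extreme_traces :: "('a, 'm) cstar_scheme \<Rightarrow> ('a \<Rightarrow> complex) set" where
  "extreme_traces A = {\<tau> \<in> tracial_states A.
     \<forall>\<sigma>\<in>tracial_states A. \<forall>\<sigma>'\<in>tracial_states A. \<forall>t::real. 0 < t \<and> t < 1 \<and>
       (\<forall>a\<in>carrier A. \<tau> a = complex_of_real t * \<sigma> a + complex_of_real (1 - t) * \<sigma>' a) \<longrightarrow>
       \<sigma> = \<tau> \<and> \<sigma>' = \<tau>}"

text \<open>Square matrices over an algebra are functions of two indices, of which only the values
  at indices below the size matter. The group \<open>K\<^sub>1\<close> of a unital algebra is the direct limit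
  of the groups of path components of the unitary groups of the matrix algebras, along
  \<open>u \<mapsto> u \<oplus> 1\<close>. The norm topology on matrices is that of entrywise convergence.\<close>

definition delta :: "('a, 'm) cstar_scheme \<Rightarrow> nat \<Rightarrow> nat \<Rightarrow> 'a" where
  "delta A i j = (if i = j then \<one>\<^bsub>A\<^esub> else \<zero>\<^bsub>A\<^esub>)"

definition unitary_matrix :: "('a, 'm) cstar_scheme \<Rightarrow> nat \<Rightarrow> (nat \<Rightarrow> nat \<Rightarrow> 'a) \<Rightarrow> bool" where
  "unitary_matrix A n u \<longleftrightarrow> (\<forall>i<n. \<forall>j<n. u i j \<in> carrier A \<and>
     (\<Oplus>\<^bsub>A\<^esub>l\<in>{..<n}. star A (u l i) \<otimes>\<^bsub>A\<^esub> u l j) = delta A i j \<and>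
     (\<Oplus>\<^bsub>A\<^esub>l\<in>{..<n}. u i l \<otimes>\<^bsub>A\<^esub> star A (u j l)) = delta A i j)"

definition trivial_K1 :: "('a, 'm) cstar_scheme \<Rightarrow> bool" where
  "trivial_K1 A \<longleftrightarrow> (\<forall>n u. unitary_matrix A n u \<longrightarrow>
     (\<exists>m\<ge>n. \<exists>w :: real \<Rightarrow> nat \<Rightarrow> nat \<Rightarrow> 'a.
        (\<forall>t\<in>{0..1}. unitary_matrix A m (w t)) \<and>
        (\<forall>i<m. \<forall>j<m. \<forall>t\<in>{0..1}.
           ((\<lambda>s. nrm A (w s i j \<ominus>\<^bsub>A\<^esub> w t i j)) \<longlongrightarrow> 0) (at t within {0..1})) \<and>
        (\<forall>i<m. \<forall>j<m. w 0 i j = (if i < n \<and> j < n then u i j else delta A i j)) \<and>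
        (\<forall>i<m. \<forall>j<m. w 1 i j = delta A i j)))"


section \<open>Matrix algebras and dimension drop algebras\<close>

text \<open>The C*-norm of a matrix: its operator norm with respect to the Euclidean norms.\<close>

definition vec_norm :: "complex Matrix.vec \<Rightarrow> real" where
  "vec_norm v = sqrt (Re (scalar_prod v (conjugate v)))"

definition op_norm :: "complex mat \<Rightarrow> real" where
  "op_norm a = Sup {vec_norm (a *\<^sub>v v) | v. v \<in> carrier_vec (dim_col a) \<and> vec_norm v \<le> 1}"

definition norm_trace :: "complex mat \<Rightarrow> complex" where
  "norm_trace a = (\<Sum>i<dim_row a. a $$ (i, i)) / of_nat (dim_row a)"

definition mat_cstar :: "nat \<Rightarrow> complex mat cstar" where
  "mat_cstar n = \<lparr>carrier = carrier_mat n n, mult = (*), one = 1\<^sub>m n, zero = 0\<^sub>m n n,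
     add = (+), smult = (\<cdot>\<^sub>m), star = mat_adjoint, nrm = op_norm\<rparr>"

text \<open>The Kronecker product identifies \<open>M\<^sub>p \<otimes> M\<^sub>q\<close> with the matrices of size \<open>p * q\<close>.\<close>

definition kronecker :: "complex mat \<Rightarrow> complex mat \<Rightarrow> complex mat" where
  "kronecker a b = mat (dim_row a * dim_row b) (dim_col a * dim_col b)
     (\<lambda>(i, j). a $$ (i div dim_row b, j div dim_col b) * b $$ (i mod dim_row b, j mod dim_col b))"

definition dim_drop ::
  "'x::topological_space set \<Rightarrow> 'x \<Rightarrow> 'x \<Rightarrow> nat \<Rightarrow> nat \<Rightarrow> ('x \<Rightarrow> complex mat) cstar" where
  "dim_drop X x0 x1 p q = \<lparr>
     carrier = {f \<in> X \<rightarrow>\<^sub>E carrier_mat (p * q) (p * q).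
       (\<forall>i<p * q. \<forall>j<p * q. continuous_on X (\<lambda>x. f x $$ (i, j))) \<and>
       (\<exists>a\<in>carrier_mat p p. f x0 = kronecker a (1\<^sub>m q)) \<and>
       (\<exists>b\<in>carrier_mat q q. f x1 = kronecker (1\<^sub>m p) b)},
     mult = (\<lambda>f g. \<lambda>x\<in>X. f x * g x),
     one = (\<lambda>x\<in>X. 1\<^sub>m (p * q)),
     zero = (\<lambda>x\<in>X. 0\<^sub>m (p * q) (p * q)),
     add = (\<lambda>f g. \<lambda>x\<in>X. f x + g x),
     smult = (\<lambda>c f. \<lambda>x\<in>X. c \<cdot>\<^sub>m f x),
     star = (\<lambda>f. \<lambda>x\<in>X. mat_adjoint (f x)),
     nrm = (\<lambda>f. SUP x\<in>X. op_norm (f x))\<rparr>"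


section \<open>Inductive limits, nuclearity and Jiang--Su stability\<close>

text \<open>\<open>conn \<phi> n m\<close> is the composition \<open>\<phi> (m - 1) \<circ> \<dots> \<circ> \<phi> n\<close>, where \<open>\<phi> i\<close> maps
  the \<open>i\<close>-th algebra to the next one; it is only used for \<open>n \<le> m\<close>.\<close>

primrec conn :: "(nat \<Rightarrow> 'a \<Rightarrow> 'a) \<Rightarrow> nat \<Rightarrow> nat \<Rightarrow> 'a \<Rightarrow> 'a" where
  "conn \<phi> n 0 = id"
| "conn \<phi> n (Suc m) = (if n \<le> m then \<phi> m \<circ> conn \<phi> n m else id)"

text \<open>The third clause makes the norm on the union of the images the limit seminorm, so
  together with density \<open>Z\<close> is the completed algebraic direct limit and \<open>\<psi> n\<close> are the
  canonical maps.\<close>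

definition inductive_limit ::
  "(nat \<Rightarrow> 'a cstar) \<Rightarrow> (nat \<Rightarrow> 'a \<Rightarrow> 'a) \<Rightarrow> ('z, 'm) cstar_scheme \<Rightarrow> (nat \<Rightarrow> 'a \<Rightarrow> 'z) \<Rightarrow> bool" where
  "inductive_limit A \<phi> Z \<psi> \<longleftrightarrow>
     (\<forall>n. \<psi> n \<in> star_hom (A n) Z) \<and>
     (\<forall>n. \<forall>a\<in>carrier (A n). \<psi> (Suc n) (\<phi> n a) = \<psi> n a) \<and>
     (\<forall>n. \<forall>a\<in>carrier (A n). (\<lambda>m. nrm (A m) (conn \<phi> n m a)) \<longlonglongrightarrow> nrm Z (\<psi> n a)) \<and>
     (\<forall>z\<in>carrier Z. \<forall>e>0. \<exists>n. \<exists>a\<in>carrier (A n). nrm Z (z \<ominus>\<^bsub>Z\<^esub> \<psi> n a) < e)"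

text \<open>Positive elements of the matrix algebra over \<open>A\<close> are the products \<open>X\<^sup>* X\<close>.\<close>

definition completely_positive ::
  "('a, 'm) cstar_scheme \<Rightarrow> ('c, 'n) cstar_scheme \<Rightarrow> ('a \<Rightarrow> 'c) \<Rightarrow> bool" where
  "completely_positive A C \<alpha> \<longleftrightarrow>
     \<alpha> \<in> carrier A \<rightarrow> carrier C \<and>
     (\<forall>a\<in>carrier A. \<forall>b\<in>carrier A. \<alpha> (a \<oplus>\<^bsub>A\<^esub> b) = \<alpha> a \<oplus>\<^bsub>C\<^esub> \<alpha> b) \<and>
     (\<forall>c. \<forall>a\<in>carrier A. \<alpha> (c \<odot>\<^bsub>A\<^esub> a) = c \<odot>\<^bsub>C\<^esub> \<alpha> a) \<and>
     (\<forall>(N::nat) X. (\<forall>i<N. \<forall>j<N. X i j \<in> carrier A) \<longrightarrow>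
        (\<exists>Y. (\<forall>i<N. \<forall>j<N. Y i j \<in> carrier C) \<and>
          (\<forall>i<N. \<forall>j<N. \<alpha> (\<Oplus>\<^bsub>A\<^esub>l\<in>{..<N}. star A (X l i) \<otimes>\<^bsub>A\<^esub> X l j) =
             (\<Oplus>\<^bsub>C\<^esub>l\<in>{..<N}. star C (Y l i) \<otimes>\<^bsub>C\<^esub> Y l j))))"

text \<open>Nuclearity in the form of the completely positive approximation property.\<close>

definition nuclear_cstar :: "('a, 'm) cstar_scheme \<Rightarrow> bool" where
  "nuclear_cstar A \<longleftrightarrow> (\<forall>F e. finite F \<and> F \<subseteq> carrier A \<and> 0 < e \<longrightarrow>
     (\<exists>n \<alpha> \<beta>. completely_positive A (mat_cstar n) \<alpha> \<and> completely_positive (mat_cstar n) A \<beta> \<and>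
        (\<forall>a\<in>carrier A. nrm (mat_cstar n) (\<alpha> a) \<le> nrm A a) \<and>
        (\<forall>b\<in>carrier (mat_cstar n). nrm A (\<beta> b) \<le> nrm (mat_cstar n) b) \<and>
        (\<forall>a\<in>F. nrm A (\<beta> (\<alpha> a) \<ominus>\<^bsub>A\<^esub> a) < e)))"

text \<open>The Jiang--Su algebra, as the unique simple, monotracial inductive limit of prime
  dimension drop algebras over the unit interval.\<close>

definition jiang_su :: "('a, 'm) cstar_scheme \<Rightarrow> bool" where
  "jiang_su Z \<longleftrightarrow> cstar_algebra Z \<and> simple_cstar Z \<and> (\<exists>\<tau>. tracial_states Z = {\<tau>}) \<and>
     (\<exists>p q \<phi> \<psi>.
        (\<forall>n. 0 < p n \<and> 0 < q n \<and> coprime (p n) (q n) \<and>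
           \<phi> n \<in> star_embedding (dim_drop {0..1::real} 0 1 (p n) (q n))
                    (dim_drop {0..1} 0 1 (p (Suc n)) (q (Suc n)))) \<and>
        inductive_limit (\<lambda>n. dim_drop {0..1} 0 1 (p n) (q n)) \<phi> Z \<psi>)"

definition lin_independent :: "('a, 'm) cstar_scheme \<Rightarrow> nat \<Rightarrow> (nat \<Rightarrow> 'a) \<Rightarrow> bool" where
  "lin_independent A n d \<longleftrightarrow>
     (\<forall>c :: nat \<Rightarrow> complex. (\<Oplus>\<^bsub>A\<^esub>l\<in>{..<n}. c l \<odot>\<^bsub>A\<^esub> d l) = \<zero>\<^bsub>A\<^esub> \<longrightarrow> (\<forall>l<n. c l = 0))"

text \<open>\<open>C\<close> is a C*-tensor product of \<open>A\<close> and \<open>D\<close> via \<open>\<iota>\<close> and \<open>\<kappa>\<close>: the induced map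
  from the algebraic tensor product to \<open>C\<close> is injective and has dense range. If \<open>D\<close> is
  nuclear, the C*-norm on the algebraic tensor product is unique, so this determines \<open>C\<close>.\<close>

definition is_tensor_product ::
  "('c, 'l) cstar_scheme \<Rightarrow> ('a, 'm) cstar_scheme \<Rightarrow> ('d, 'n) cstar_scheme \<Rightarrow>
   ('a \<Rightarrow> 'c) \<Rightarrow> ('d \<Rightarrow> 'c) \<Rightarrow> bool" where
  "is_tensor_product C A D \<iota> \<kappa> \<longleftrightarrow> \<iota> \<in> star_hom A C \<and> \<kappa> \<in> star_hom D C \<and>
     (\<forall>a\<in>carrier A. \<forall>d\<in>carrier D. \<iota> a \<otimes>\<^bsub>C\<^esub> \<kappa> d = \<kappa> d \<otimes>\<^bsub>C\<^esub> \<iota> a) \<and>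
     (\<forall>n a d. (\<forall>l<n. a l \<in> carrier A \<and> d l \<in> carrier D) \<and> lin_independent D n d \<and>
        (\<Oplus>\<^bsub>C\<^esub>l\<in>{..<n}. \<iota> (a l) \<otimes>\<^bsub>C\<^esub> \<kappa> (d l)) = \<zero>\<^bsub>C\<^esub> \<longrightarrow> (\<forall>l<n. a l = \<zero>\<^bsub>A\<^esub>)) \<and>
     (\<forall>c\<in>carrier C. \<forall>e>0. \<exists>n::nat. \<exists>a d. (\<forall>l<n. a l \<in> carrier A \<and> d l \<in> carrier D) \<and>
        nrm C (c \<ominus>\<^bsub>C\<^esub> (\<Oplus>\<^bsub>C\<^esub>l\<in>{..<n}. \<iota> (a l) \<otimes>\<^bsub>C\<^esub> \<kappa> (d l))) < e)"

text \<open>\<open>A \<cong> A \<otimes> Z\<close>. Such an \<open>A\<close> contains a copy of the Jiang--Su algebra \<open>Z\<close>, so nothing is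
  lost by taking the elements of \<open>Z\<close> from the type of the elements of \<open>A\<close>.\<close>

definition Z_stable :: "('a, 'm) cstar_scheme \<Rightarrow> bool" where
  "Z_stable A \<longleftrightarrow> (\<exists>(Z :: 'a cstar) \<iota> \<kappa>. jiang_su Z \<and> is_tensor_product A A Z \<iota> \<kappa>)"


section \<open>Measures and the Wasserstein metric\<close>

abbreviation borel_on :: "'x::topological_space set \<Rightarrow> 'x measure" where
  "borel_on X \<equiv> restrict_space borel X"

abbreviation dirac :: "'x::topological_space set \<Rightarrow> 'x \<Rightarrow> 'x measure" where
  "dirac X x \<equiv> return (borel_on X) x"

definition borel_probs :: "'x::topological_space set \<Rightarrow> 'x measure set" where
  "borel_probs X = {\<nu>. prob_space \<nu> \<and> sets \<nu> = sets (borel_on X)}"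

definition diam :: "'x set \<Rightarrow> ('x \<Rightarrow> 'x \<Rightarrow> real) \<Rightarrow> real" where
  "diam X \<rho> = (SUP (x, y)\<in>X \<times> X. \<rho> x y)"

definition wasserstein1 ::
  "'x::topological_space set \<Rightarrow> ('x \<Rightarrow> 'x \<Rightarrow> real) \<Rightarrow> 'x measure \<Rightarrow> 'x measure \<Rightarrow> real" where
  "wasserstein1 X \<rho> \<nu> \<nu>' = Inf {\<integral>(x, y). \<rho> x y \<partial>\<pi> | \<pi>.
     sets \<pi> = sets (borel_on X \<Otimes>\<^sub>M borel_on X) \<and>
     distr \<pi> (borel_on X) fst = \<nu> \<and> distr \<pi> (borel_on X) snd = \<nu>'}"

definition one_lipschitz :: "'x set \<Rightarrow> ('x \<Rightarrow> 'x \<Rightarrow> real) \<Rightarrow> ('x \<Rightarrow> real) \<Rightarrow> bool" where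
  "one_lipschitz X \<rho> g \<longleftrightarrow> (\<forall>x\<in>X. \<forall>y\<in>X. \<bar>g x - g y\<bar> \<le> \<rho> x y)"

text \<open>Deviation of \<open>S\<close>, a self-map of the space of Borel probability measures, from the identity:
  uniformly, and in the Lipschitz seminorm. The latter is the Lipschitz constant of \<open>S - id\<close>
  for the norm on signed measures of total mass 0 that extends the metric
  (Kantorovich--Rubinstein duality).\<close>

definition near_identity ::
  "'x::topological_space set \<Rightarrow> ('x \<Rightarrow> 'x \<Rightarrow> real) \<Rightarrow> ('x measure \<Rightarrow> 'x measure) \<Rightarrow> real \<Rightarrow> bool" where
  "near_identity X \<rho> S e \<longleftrightarrow>
     (\<forall>\<nu>\<in>borel_probs X. wasserstein1 X \<rho> (S \<nu>) \<nu> \<le> e) \<and>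
     (\<forall>\<nu>\<in>borel_probs X. \<forall>\<nu>'\<in>borel_probs X. \<forall>g. one_lipschitz X \<rho> g \<longrightarrow>
        \<bar>((\<integral>x. g x \<partial>S \<nu>) - (\<integral>x. g x \<partial>\<nu>)) - ((\<integral>x. g x \<partial>S \<nu>') - (\<integral>x. g x \<partial>\<nu>'))\<bar>
        \<le> e * wasserstein1 X \<rho> \<nu> \<nu>')"

text \<open>The measure representing the trace \<open>\<tau> \<circ> h\<close>, where \<open>h\<close> is a *-homomorphism from the
  dimension drop algebra \<open>A\<close> to another one and \<open>\<nu>\<close> is the measure representing \<open>\<tau>\<close>.\<close>

definition trace_map ::
  "'x::topological_space set \<Rightarrow> ('x \<Rightarrow> complex mat) cstar \<Rightarrow>
   (('x \<Rightarrow> complex mat) \<Rightarrow> ('x \<Rightarrow> complex mat)) \<Rightarrow> 'x measure \<Rightarrow> 'x measure" where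
  "trace_map X A h \<nu> = (THE \<nu>'. \<nu>' \<in> borel_probs X \<and>
     (\<forall>a\<in>carrier A. (\<integral>x. norm_trace (h a x) \<partial>\<nu>) = (\<integral>x. norm_trace (a x) \<partial>\<nu>')))"


section \<open>The model algebra and its core\<close>

definition lip_const ::
  "'x set \<Rightarrow> ('x \<Rightarrow> 'x \<Rightarrow> real) \<Rightarrow> ('x \<Rightarrow> complex mat) \<Rightarrow> ereal" where
  "lip_const X \<rho> a = (SUP (x, y)\<in>{(x, y). x \<in> X \<and> y \<in> X \<and> x \<noteq> y}.
     ereal (cmod (norm_trace (a x) - norm_trace (a y)) / \<rho> x y))"

definition lip_const_n ::
  "'x set \<Rightarrow> ('x \<Rightarrow> 'x \<Rightarrow> real) \<Rightarrow> (nat \<Rightarrow> ('x \<Rightarrow> complex mat) \<Rightarrow> ('x \<Rightarrow> complex mat)) \<Rightarrow>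
   nat \<Rightarrow> ('x \<Rightarrow> complex mat) \<Rightarrow> ereal" where
  "lip_const_n X \<rho> \<phi> n a = (SUP m\<in>{n..}. lip_const X \<rho> (conn \<phi> n m a))"

definition lip_ball ::
  "'x set \<Rightarrow> ('x \<Rightarrow> 'x \<Rightarrow> real) \<Rightarrow> ('x \<Rightarrow> complex mat) cstar \<Rightarrow> real \<Rightarrow> ('x \<Rightarrow> complex mat) set" where
  "lip_ball X \<rho> A r = {f \<in> self_adjoint A. nrm A f \<le> r \<and>
     (\<forall>x\<in>X. \<forall>y\<in>X. op_norm (f x - f y) \<le> \<rho> x y)}"

definition core_r ::
  "'x set \<Rightarrow> ('x \<Rightarrow> 'x \<Rightarrow> real) \<Rightarrow> (nat \<Rightarrow> ('x \<Rightarrow> complex mat) cstar) \<Rightarrow>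
   (nat \<Rightarrow> ('x \<Rightarrow> complex mat) \<Rightarrow> ('x \<Rightarrow> complex mat)) \<Rightarrow>
   (nat \<Rightarrow> ('x \<Rightarrow> complex mat) \<Rightarrow> 'z) \<Rightarrow> real \<Rightarrow> 'z set" where
  "core_r X \<rho> A \<phi> \<psi> r =
     (\<Union>n. \<psi> n ` {a \<in> lip_ball X \<rho> (A n) r. lip_const_n X \<rho> \<phi> n a \<le> 1})"

definition core ::
  "'x set \<Rightarrow> ('x \<Rightarrow> 'x \<Rightarrow> real) \<Rightarrow> (nat \<Rightarrow> ('x \<Rightarrow> complex mat) cstar) \<Rightarrow>
   (nat \<Rightarrow> ('x \<Rightarrow> complex mat) \<Rightarrow> ('x \<Rightarrow> complex mat)) \<Rightarrow>
   (nat \<Rightarrow> ('x \<Rightarrow> complex mat) \<Rightarrow> 'z) \<Rightarrow> 'z set" where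
  "core X \<rho> A \<phi> \<psi> = core_r X \<rho> A \<phi> \<psi> (diam X \<rho> / 2)"

text \<open>\<open>trc \<nu>\<close> is the trace on \<open>Z\<close> corresponding to the measure \<open>\<nu>\<close>. A trace on the limit is a
  sequence of measures, the \<open>n\<close>-th being the image of the next one under \<open>T(\<phi> n)\<close>; as these maps
  are summably close to the identity, \<open>\<nu>\<close> corresponds to the sequence whose \<open>n\<close>-th
  member is the limit over \<open>m\<close> of the images of \<open>\<nu>\<close> under \<open>T(conn \<phi> n m)\<close>. This is the
  content of \<open>trc_limit\<close>, which determines \<open>trc\<close> on \<open>borel_probs X\<close> and makes it affine
  there. The UCT is automatic for inductive limits of this form.\<close>

locale model_algebra =
  fixes X :: "'x::topological_space set" and \<rho> :: "'x \<Rightarrow> 'x \<Rightarrow> real"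
    and x0 x1 :: 'x
    and p q :: "nat \<Rightarrow> nat"
    and A :: "nat \<Rightarrow> ('x \<Rightarrow> complex mat) cstar"
    and \<phi> :: "nat \<Rightarrow> ('x \<Rightarrow> complex mat) \<Rightarrow> ('x \<Rightarrow> complex mat)"
    and Z :: "('z, 'm) cstar_scheme"
    and \<psi> :: "nat \<Rightarrow> ('x \<Rightarrow> complex mat) \<Rightarrow> 'z"
    and trc :: "'x measure \<Rightarrow> 'z \<Rightarrow> complex"
  assumes base_points: "x0 \<in> X" "x1 \<in> X" "x0 \<noteq> x1"
    and prime_dims: "\<And>n. 0 < p n" "\<And>n. 0 < q n" "\<And>n. coprime (p n) (q n)"
    and A_eq: "\<And>n. A n = dim_drop X x0 x1 (p n) (q n)"
    and connecting: "\<And>n. \<phi> n \<in> star_embedding (A n) (A (Suc n))"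
    and trace_near_identity: "\<exists>e. (\<forall>n. 0 < e n) \<and> summable e \<and>
      (\<forall>n. near_identity X \<rho> (trace_map X (A n) (\<phi> n)) (e n))"
    and limit: "inductive_limit A \<phi> Z \<psi>"
    and Z_cstar: "cstar_algebra Z"
    and Z_projectionless: "projectionless Z"
    and Z_simple: "simple_cstar Z"
    and Z_separable: "separable_cstar Z"
    and Z_nuclear: "nuclear_cstar Z"
    and Z_Z_stable: "Z_stable Z"
    and trc_limit: "\<And>\<nu> n a. \<lbrakk>\<nu> \<in> borel_probs X; a \<in> carrier (A n)\<rbrakk> \<Longrightarrow>
      (\<lambda>m. \<integral>x. norm_trace (conn \<phi> n m a x) \<partial>\<nu>) \<longlonglongrightarrow> trc \<nu> (\<psi> n a)"
    and trc_bij: "bij_betw trc (borel_probs X) (tracial_states Z)"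
    and trc_extreme: "bij_betw (\<lambda>x. trc (dirac X x)) X (extreme_traces Z)"
    and metric_limit: "\<And>x y. \<lbrakk>x \<in> X; y \<in> X\<rbrakk> \<Longrightarrow>
      (\<lambda>n. SUP a\<in>{a \<in> self_adjoint (A n). lip_const_n X \<rho> \<phi> n a \<le> 1}.
         ereal (cmod (trc (dirac X x) (\<psi> n a) - trc (dirac X y) (\<psi> n a))))
      \<longlonglongrightarrow> ereal (\<rho> x y)"


section \<open>The sphere\<close>

definition geodesic_dist :: "real ^ 'k \<Rightarrow> real ^ 'k \<Rightarrow> real" where
  "geodesic_dist x y = arccos (inner x y)"

definition sphere_haar :: "(real ^ 'k) measure \<Rightarrow> bool" where
  "sphere_haar \<mu> \<longleftrightarrow> \<mu> \<in> borel_probs (sphere 0 1) \<and>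
     (\<forall>Q. rotation_matrix Q \<longrightarrow> distr \<mu> \<mu> (\<lambda>x. Q *v x) = \<mu>)"

text \<open>The empirical measure \<open>(\<delta>\<^bsub>s 1\<^esub> + \<dots> + \<delta>\<^bsub>s n\<^esub>) / n\<close>.\<close>

definition empirical :: "'x::topological_space set \<Rightarrow> nat \<Rightarrow> (nat \<Rightarrow> 'x) \<Rightarrow> 'x measure" where
  "empirical X n s = distr (uniform_count_measure {1..n}) (borel_on X) s"

lemma emeasure_empirical:
  assumes "0 < n" "\<And>i. s i \<in> X" "U \<in> sets (borel_on X)"
  shows "emeasure (empirical X n s) U =
    (\<Sum>i=1..n. emeasure (dirac X (s i)) U) / of_nat n"
proof -
  have s: "s \<in> measurable (uniform_count_measure {1..n}) (borel_on X)"
    using assms(2) by (auto simp: measurable_def space_restrict_space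
        space_uniform_count_measure sets_uniform_count_measure)
  have "emeasure (empirical X n s) U =
      emeasure (uniform_count_measure {1..n}) {i \<in> {1..n}. s i \<in> U}"
    unfolding empirical_def emeasure_distr[OF s assms(3)]
    by (rule arg_cong[where f = "emeasure _"]) (auto simp: space_uniform_count_measure)
  also have "\<dots> = of_nat (card {i \<in> {1..n}. s i \<in> U}) / of_nat n"
    using assms(1) by (subst emeasure_uniform_count_measure)
      (auto simp: divide_ennreal[symmetric] ennreal_of_nat_eq_real_of_nat)
  also have "of_nat (card {i \<in> {1..n}. s i \<in> U}) = (\<Sum>i=1..n. emeasure (dirac X (s i)) U)"
    using assms(3) by (simp add: indicator_def sum.If_cases Int_def)
  finally show ?thesis .
qed

end

theory Submission
  imports Defs
begin

text \<open>An element \<open>f\<close> of the core defines a function \<open>g x = trc (dirac x) f\<close> on the sphere, a pointwise limit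
  of uniformly bounded functions with Lipschitz constant at most 1, so \<open>g\<close> is 1-Lipschitz for the
  angular distance and \<open>trc \<nu> f\<close> is the integral of \<open>g\<close> against \<open>\<nu>\<close>.

  The Haar measure is the law of \<open>Y / norm Y\<close> for a standard Gaussian vector \<open>Y\<close> in dimension \<open>k\<close>. The
  function \<open>y \<mapsto> g (y / norm y)\<close> has gradient of norm at most \<open>1 / norm y\<close>, so by the Gaussian Poincare
  inequality its variance is at most the expectation of \<open>1 / (norm Y)\<^sup>2\<close>, which is \<open>1 / (k - 2)\<close>.

  The supremum of \<open>\<bar>\<integral>g d\<mu>\<^sub>n - \<integral>g d\<mu>\<bar>\<close> over 1-Lipschitz \<open>g\<close> changes by at most \<open>pi / n\<close> with each sample
  point, and its expectation tends to 0 as these functions are totally bounded modulo constants.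
  The bounded differences inequality gives the exponent \<open>2 * t\<^sup>2 * n / pi\<^sup>2\<close> for deviations \<open>t\<close> from the
  expectation, which leaves room for replacing \<open>t\<close> by \<open>\<epsilon>\<close>.\<close>

text \<open>The constant \<open>1 / (k - 2)\<close> is the price of the Gaussian route: the sphere
  itself has spectral gap \<open>k - 1\<close>, but the inequality there asks for analysis on a
  manifold, whereas in Gaussian space it tensorizes from the line, where it is a kernel computation.
  The mean of \<open>1 / (norm Y)\<^sup>2\<close> is finite exactly from dimension 3 on.

  Two obstacles shape this route. A 1-Lipschitz \<open>g\<close> need not be differentiable, so it
  is replaced by a uniformly close soft minimum of cones that obeys the same gradient bound; this
  avoids almost everywhere differentiability. And the Haar measure is given by its invariance alone,
  so its integrals have to be matched with those of the Gaussian direction by an averaging argument.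

  In the tail bound, \<open>pi\<close> is the angular diameter of the sphere, hence the largest
  oscillation of a 1-Lipschitz function. The bounded differences exponent is twice the one claimed;
  this slack absorbs the expected supremum, however slowly it tends to 0.\<close>

no_notation scalar_prod (infix \<open>\<bullet>\<close> 70)

section \<open>Product measures: Efron--Stein and bounded differences\<close>

abbreviation (input) vari :: "'a measure \<Rightarrow> ('a \<Rightarrow> real) \<Rightarrow> real" where
  "vari M f \<equiv> (\<integral>x. (f x - (\<integral>x. f x \<partial>M))\<^sup>2 \<partial>M)"

lemma (in prob_space) integrable_bounded:
  fixes f :: "'a \<Rightarrow> real"
  assumes "f \<in> borel_measurable M" "\<And>x. x \<in> space M \<Longrightarrow> \<bar>f x\<bar> \<le> B"
  shows "integrable M f"
  using assms by (intro integrable_const_bound[where B = B]) (auto intro!: AE_I2)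

lemma (in prob_space) abs_expectation_le:
  fixes f :: "'a \<Rightarrow> real"
  assumes "f \<in> borel_measurable M" "\<And>x. x \<in> space M \<Longrightarrow> \<bar>f x\<bar> \<le> B"
  shows "\<bar>expectation f\<bar> \<le> B"
proof -
  have i: "integrable M f" by (rule integrable_bounded[OF assms])
  have "expectation f \<le> B"
    by (rule integral_le_const[OF i]) (use assms(2) abs_le_D1 in \<open>auto intro!: AE_I2\<close>)
  moreover have "- B \<le> expectation f"
    by (rule integral_ge_const[OF i]) (use assms(2) abs_le_D2 in \<open>fastforce intro!: AE_I2\<close>)
  ultimately show ?thesis by auto
qed

lemma (in prob_space) vari_bounded_eq:
  fixes f :: "'a \<Rightarrow> real"
  assumes "f \<in> borel_measurable M" "\<And>x. x \<in> space M \<Longrightarrow> \<bar>f x\<bar> \<le> B"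
  shows "vari M f = expectation (\<lambda>x. (f x)\<^sup>2) - (expectation f)\<^sup>2"
proof (rule variance_eq)
  show "integrable M f" by (rule integrable_bounded[OF assms])
  show "integrable M (\<lambda>x. (f x)\<^sup>2)"
    using assms by (intro integrable_bounded[where B = "B\<^sup>2"]) 
       (use power_mono[OF assms(2) abs_ge_zero, of _ 2] in auto)
qed

lemma (in prob_space) square_expectation_le:
  fixes f :: "'a \<Rightarrow> real"
  assumes "f \<in> borel_measurable M" "\<And>x. x \<in> space M \<Longrightarrow> \<bar>f x\<bar> \<le> B"
  shows "(expectation f)\<^sup>2 \<le> expectation (\<lambda>x. (f x)\<^sup>2)"
proof -
  have "0 \<le> vari M f" by (rule integral_nonneg_AE) simp
  then show ?thesis using vari_bounded_eq[OF assms] by simp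
qed

text \<open>Once each slice is centred at its own mean \<open>c y\<close>, the left side is the
  second moment of an average of centred slices, and Jensen's inequality moves the square inside the
  average. In the induction that follows, this compares a function averaged over one coordinate with
  the function itself.\<close>

lemma vari_average_le:
  fixes f :: "'a \<times> 'b \<Rightarrow> real"
  assumes M: "prob_space M" and N: "prob_space N"
    and f: "f \<in> borel_measurable (M \<Otimes>\<^sub>M N)"
    and B: "\<And>x y. x \<in> space M \<Longrightarrow> y \<in> space N \<Longrightarrow> \<bar>f (x, y)\<bar> \<le> B"
  shows "vari M (\<lambda>x. \<integral>y. f (x, y) \<partial>N) \<le> (\<integral>y. vari M (\<lambda>x. f (x, y)) \<partial>N)"
proof -
  interpret M: prob_space M by fact
  interpret N: prob_space N by fact
  interpret P: pair_prob_space M N ..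
  note [measurable] = f
  define c where "c y = (\<integral>x. f (x, y) \<partial>M)" for y
  have c[measurable]: "c \<in> borel_measurable N" unfolding c_def by measurable
  have cB: "\<bar>c y\<bar> \<le> B" if "y \<in> space N" for y
    unfolding c_def by (rule M.abs_expectation_le) (use that B in auto)
  have fi: "integrable (M \<Otimes>\<^sub>M N) f"
    using B by (intro P.P.integrable_bounded[where B = B]) (auto simp: space_pair_measure)
  have E: "(\<integral>x. \<integral>y. f (x, y) \<partial>N \<partial>M) = (\<integral>y. c y \<partial>N)"
    unfolding c_def using fi by (subst P.Fubini_integral) (auto simp: case_prod_beta')
  have sq: "integrable (M \<Otimes>\<^sub>M N) (\<lambda>(x, y). (f (x, y) - c y)\<^sup>2)"
  proof (intro P.P.integrable_bounded[where B = "(2 * B)\<^sup>2"])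
    fix z assume z: "z \<in> space (M \<Otimes>\<^sub>M N)"
    have "\<bar>f z - c (snd z)\<bar> \<le> 2 * B"
      using z B[of "fst z" "snd z"] cB[of "snd z"] by (auto simp: space_pair_measure)
    then show "\<bar>case z of (x, y) \<Rightarrow> (f (x, y) - c y)\<^sup>2\<bar> \<le> (2 * B)\<^sup>2"
      using power_mono[of "\<bar>f z - c (snd z)\<bar>" "2 * B" 2] by (simp add: case_prod_beta)
  qed measurable
  have "vari M (\<lambda>x. \<integral>y. f (x, y) \<partial>N) = (\<integral>x. (\<integral>y. (f (x, y) - c y) \<partial>N)\<^sup>2 \<partial>M)"
  proof (rule Bochner_Integration.integral_cong[OF refl])
    fix x assume x: "x \<in> space M"
    have "integrable N (\<lambda>y. f (x, y))" "integrable N c"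
      using x B cB by (auto intro!: N.integrable_bounded[where B = B])
    then show "((\<integral>y. f (x, y) \<partial>N) - (\<integral>x. \<integral>y. f (x, y) \<partial>N \<partial>M))\<^sup>2 = (\<integral>y. (f (x, y) - c y) \<partial>N)\<^sup>2"
      unfolding E by simp
  qed
  also have "\<dots> \<le> (\<integral>x. \<integral>y. (f (x, y) - c y)\<^sup>2 \<partial>N \<partial>M)"
  proof (rule integral_mono)
    have *: "\<bar>f (x, y) - c y\<bar> \<le> 2 * B" if "x \<in> space M" "y \<in> space N" for x y
      using B[OF that] cB[OF that(2)] by auto
    show "(\<integral>y. (f (x, y) - c y) \<partial>N)\<^sup>2 \<le> (\<integral>y. (f (x, y) - c y)\<^sup>2 \<partial>N)" if "x \<in> space M" for x
      by (rule N.square_expectation_le[where B = "2 * B"]) (use that * in auto)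
    show "integrable M (\<lambda>x. (\<integral>y. (f (x, y) - c y) \<partial>N)\<^sup>2)"
    proof (rule M.integrable_bounded[where B = "(2 * B)\<^sup>2"])
      fix x assume x: "x \<in> space M"
      have "\<bar>\<integral>y. (f (x, y) - c y) \<partial>N\<bar> \<le> 2 * B"
        by (rule N.abs_expectation_le) (use x * in auto)
      then show "\<bar>(\<integral>y. (f (x, y) - c y) \<partial>N)\<^sup>2\<bar> \<le> (2 * B)\<^sup>2"
        using power_mono[of "\<bar>\<integral>y. (f (x, y) - c y) \<partial>N\<bar>" "2 * B" 2] by simp
    qed measurable
    show "integrable M (\<lambda>x. \<integral>y. (f (x, y) - c y)\<^sup>2 \<partial>N)"
      using P.integrable_fst[OF sq] .
  qed
  also have "\<dots> = (\<integral>y. \<integral>x. (f (x, y) - c y)\<^sup>2 \<partial>M \<partial>N)"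
    using sq by (rule P.Fubini_integral[symmetric])
  finally show ?thesis by (simp add: c_def)
qed

text \<open>The Efron--Stein inequality, by induction on the law of total variance. Integrating out
  the coordinate \<open>i\<close> gives \<open>h\<close>; the variance of \<open>f\<close> is the
  mean of its variance in the direction \<open>i\<close> plus the variance of \<open>h\<close>, and
  the coordinate variances of \<open>h\<close> are dominated by those of \<open>f\<close> because
  averaging contracts variance.\<close>

lemma vari_le_sum_coordinate_vari:
  fixes f :: "('i \<Rightarrow> 'a) \<Rightarrow> real"
  assumes M: "prob_space M" and I: "finite I"
    and f: "f \<in> borel_measurable (Pi\<^sub>M I (\<lambda>_. M))"
    and B: "\<And>x. x \<in> space (Pi\<^sub>M I (\<lambda>_. M)) \<Longrightarrow> \<bar>f x\<bar> \<le> B"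
  shows "vari (Pi\<^sub>M I (\<lambda>_. M)) f
    \<le> (\<Sum>i\<in>I. \<integral>x. vari M (\<lambda>y. f (x(i := y))) \<partial>Pi\<^sub>M I (\<lambda>_. M))"
  using I f B
proof (induction I arbitrary: f rule: finite_induct)
  case empty
  interpret P: prob_space "Pi\<^sub>M {} (\<lambda>_::'i. M)" using M by (intro prob_space_PiM)
  have "vari (Pi\<^sub>M {} (\<lambda>_. M)) f = 0"
    by (subst PiM_empty)+ (simp add: lebesgue_integral_count_space_finite)
  then show ?case by simp
next
  case (insert i I)
  interpret M: prob_space M by fact
  interpret product_sigma_finite "\<lambda>_::'i. M" by standard
  let ?P = "Pi\<^sub>M I (\<lambda>_. M)" and ?Q = "Pi\<^sub>M (insert i I) (\<lambda>_. M)"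
  interpret P: prob_space ?P by (intro prob_space_PiM M)
  interpret Q: prob_space ?Q by (intro prob_space_PiM M)
  interpret PM: pair_prob_space ?P M ..
  note [measurable] = insert.prems(1)
  note fin = insert.hyps(1) note ni = insert.hyps(2)
  have upd: "x(i := y) \<in> space ?Q" if "x \<in> space ?P" "y \<in> space M" for x y
    using that by (auto simp: space_PiM PiE_iff extensional_def)
  define h where "h u = (\<integral>y. f (u(i := y)) \<partial>M)" for u
  have fu[measurable]: "(\<lambda>(u, y). f (u(i := y))) \<in> borel_measurable (?P \<Otimes>\<^sub>M M)"
    using measurable_compose[OF measurable_add_dim[of i I "\<lambda>_. M"] insert.prems(1)]
    by (simp add: case_prod_beta')
  have fuy: "(\<lambda>y. f (u(i := y))) \<in> borel_measurable M" if "u \<in> space ?P" for u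
    using measurable_compose[OF measurable_Pair1'[OF that] fu] by simp
  have fB: "\<bar>f (u(i := y))\<bar> \<le> B" if "u \<in> space ?P" "y \<in> space M" for u y
    using insert.prems(2) upd that by blast
  have h[measurable]: "h \<in> borel_measurable ?P" unfolding h_def using fu by measurable
  have hB: "\<bar>h u\<bar> \<le> B" if "u \<in> space ?P" for u
    unfolding h_def by (rule M.abs_expectation_le) (use that fuy fB in auto)
  have ins: "(\<integral>x. g x \<partial>?Q) = (\<integral>u. \<integral>y. g (u(i := y)) \<partial>M \<partial>?P)"
    if "g \<in> borel_measurable ?Q" "\<And>x. x \<in> space ?Q \<Longrightarrow> \<bar>g x\<bar> \<le> C" for g :: "_ \<Rightarrow> real" and C
    by (rule product_integral_insert[OF fin ni Q.integrable_bounded[OF that]])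
  have f2B: "\<bar>(f x)\<^sup>2\<bar> \<le> B\<^sup>2" if "x \<in> space ?Q" for x
    using power_mono[OF insert.prems(2)[OF that], of 2] by simp
  have h2B: "\<bar>(h x)\<^sup>2\<bar> \<le> B\<^sup>2" if "x \<in> space ?P" for x
    using power_mono[OF hB[OF that], of 2] by simp
  have varI: "vari ?P h \<le> (\<Sum>j\<in>I. \<integral>x. vari M (\<lambda>y. h (x(j := y))) \<partial>?P)"
    by (rule insert.IH[OF h hB])
  have Ef: "(\<integral>x. f x \<partial>?Q) = (\<integral>u. h u \<partial>?P)"
    unfolding h_def by (rule ins) (use insert.prems in auto)
  have "vari ?Q f = (\<integral>x. (f x)\<^sup>2 \<partial>?Q) - (\<integral>x. f x \<partial>?Q)\<^sup>2"
    by (rule Q.vari_bounded_eq) (use insert.prems in auto)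
  also have "(\<integral>x. (f x)\<^sup>2 \<partial>?Q) = (\<integral>u. \<integral>y. (f (u(i := y)))\<^sup>2 \<partial>M \<partial>?P)"
    by (rule ins[of _ "B\<^sup>2"]) (use f2B in auto)
  also have "\<dots> = (\<integral>u. vari M (\<lambda>y. f (u(i := y))) + (h u)\<^sup>2 \<partial>?P)"
    by (rule Bochner_Integration.integral_cong[OF refl])
       (use M.vari_bounded_eq[OF fuy fB] in \<open>simp add: h_def\<close>)
  also have "\<dots> = (\<integral>u. vari M (\<lambda>y. f (u(i := y))) \<partial>?P) + (\<integral>u. (h u)\<^sup>2 \<partial>?P)"
  proof (rule Bochner_Integration.integral_add)
    have "(\<lambda>u. vari M (\<lambda>y. f (u(i := y)))) \<in> borel_measurable ?P"
      using fu by measurable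
    then show "integrable ?P (\<lambda>u. vari M (\<lambda>y. f (u(i := y))))"
    proof (rule P.integrable_bounded[where B = "B\<^sup>2"])
      fix u assume u: "u \<in> space ?P"
      have "0 \<le> vari M (\<lambda>y. f (u(i := y)))" by (rule integral_nonneg_AE) simp
      moreover have "vari M (\<lambda>y. f (u(i := y))) \<le> (\<integral>y. (f (u(i := y)))\<^sup>2 \<partial>M)"
        using M.vari_bounded_eq[OF fuy[OF u] fB[OF u]] by simp
      moreover have "\<bar>\<integral>y. (f (u(i := y)))\<^sup>2 \<partial>M\<bar> \<le> B\<^sup>2"
        by (rule M.abs_expectation_le) (use f2B upd u fuy[OF u] in auto)
      ultimately show "\<bar>vari M (\<lambda>y. f (u(i := y)))\<bar> \<le> B\<^sup>2" by linarith
    qed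
    show "integrable ?P (\<lambda>u. (h u)\<^sup>2)"
      by (rule P.integrable_bounded[OF _ h2B]) auto
  qed
  finally have tot: "vari ?Q f = (\<integral>u. vari M (\<lambda>y. f (u(i := y))) \<partial>?P) + vari ?P h"
    using P.vari_bounded_eq[OF h hB] unfolding Ef by simp
  have vB: "\<bar>vari M (\<lambda>y. f (x(j := y)))\<bar> \<le> B\<^sup>2" 
    and vm: "(\<lambda>x. vari M (\<lambda>y. f (x(j := y)))) \<in> borel_measurable ?Q"
    if "x \<in> space ?Q" "j \<in> insert i I" for x j
  proof -
    have fx: "(\<lambda>(x, y). f (x(j := y))) \<in> borel_measurable (?Q \<Otimes>\<^sub>M M)"
    proof -
      have "(\<lambda>(x, y). x(j := y)) \<in> measurable (?Q \<Otimes>\<^sub>M M) ?Q"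
        unfolding case_prod_beta'
        by (rule measurable_fun_upd[where J = "insert i I"]) (use that(2) in auto)
      from measurable_compose[OF this insert.prems(1)] show ?thesis
        by (simp add: case_prod_beta' fun_upd_def)
    qed
    then show "(\<lambda>x. vari M (\<lambda>y. f (x(j := y)))) \<in> borel_measurable ?Q"
      by measurable
    have m: "(\<lambda>y. f (x(j := y))) \<in> borel_measurable M"
      using measurable_compose[OF measurable_Pair1'[OF that(1)] fx] by simp
    have sp: "x(j := y) \<in> space ?Q" if "y \<in> space M" for y
      using that \<open>x \<in> space ?Q\<close> \<open>j \<in> insert i I\<close>
      by (auto simp: space_PiM PiE_iff extensional_def)
    have "0 \<le> vari M (\<lambda>y. f (x(j := y)))" by (rule integral_nonneg_AE) simp
    moreover have "vari M (\<lambda>y. f (x(j := y)))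
        = (\<integral>y. (f (x(j := y)))\<^sup>2 \<partial>M) - (\<integral>y. f (x(j := y)) \<partial>M)\<^sup>2"
      by (rule M.vari_bounded_eq[OF m, of B]) (rule insert.prems(2)[OF sp])
    moreover have "0 \<le> (\<integral>y. f (x(j := y)) \<partial>M)\<^sup>2" by simp
    moreover have "\<bar>\<integral>y. (f (x(j := y)))\<^sup>2 \<partial>M\<bar> \<le> B\<^sup>2"
      by (rule M.abs_expectation_le) (use f2B sp m in auto)
    ultimately show "\<bar>vari M (\<lambda>y. f (x(j := y)))\<bar> \<le> B\<^sup>2" by linarith
  qed
  obtain q where q: "q \<in> space ?Q" using Q.not_empty by blast
  \<comment> \<open>\<open>x(i := y)\<close> overwrites the value at \<open>i\<close>, so
    integrating over that coordinate as well changes nothing.\<close>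
  have 1: "(\<integral>u. vari M (\<lambda>y. f (u(i := y))) \<partial>?P) = (\<integral>x. vari M (\<lambda>y. f (x(i := y))) \<partial>?Q)"
    by (subst ins[of _ "B\<^sup>2"]) (use vB vm q in \<open>auto simp: M.prob_space\<close>)
  have 2: "(\<integral>x. vari M (\<lambda>y. h (x(j := y))) \<partial>?P) \<le> (\<integral>x. vari M (\<lambda>y. f (x(j := y))) \<partial>?Q)"
    if j: "j \<in> I" for j
  proof -
    have ji: "j \<noteq> i" using j ni by auto
    have sp: "x(j := y) \<in> space ?P" if "y \<in> space M" "x \<in> space ?P" for x y
      using that j by (auto simp: space_PiM PiE_iff extensional_def)
    \<comment> \<open>The updates at \<open>i\<close> and \<open>j\<close> commute, so resampling
      \<open>j\<close> in \<open>h\<close> is the average over \<open>z\<close> of resampling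
      \<open>j\<close> in \<open>f\<close>.\<close>
    have pw: "vari M (\<lambda>y. h (x(j := y))) \<le> (\<integral>z. vari M (\<lambda>y. f (x(i := z, j := y))) \<partial>M)"
      if x: "x \<in> space ?P" for x
    proof -
      have "(\<lambda>p. f (x(i := snd p, j := fst p))) \<in> borel_measurable (M \<Otimes>\<^sub>M M)"
      proof (rule measurable_compose[OF _ insert.prems(1)])
        have "(\<lambda>p. (x(j := fst p))(i := snd p)) \<in> measurable (M \<Otimes>\<^sub>M M) ?Q"
          by (rule measurable_fun_upd[where J = I])
             (use x j in \<open>auto intro!: measurable_fun_upd[where J = I]\<close>)
        then show "(\<lambda>p. x(i := snd p, j := fst p)) \<in> measurable (M \<Otimes>\<^sub>M M) ?Q"
          using ji by (simp add: fun_upd_twist)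
      qed
      moreover have "\<bar>f (x(i := snd (y, z), j := fst (y, z)))\<bar> \<le> B" if "y \<in> space M" "z \<in> space M" for y z
        using fB[OF sp[OF that(1) x] that(2)] ji by (simp add: fun_upd_twist)
      ultimately have "vari M (\<lambda>y. \<integral>z. f (x(i := snd (y, z), j := fst (y, z))) \<partial>M)
        \<le> (\<integral>z. vari M (\<lambda>y. f (x(i := snd (y, z), j := fst (y, z)))) \<partial>M)"
        by (rule vari_average_le[OF M M])
      then show ?thesis using ji by (simp add: h_def fun_upd_twist)
    qed
    have mQ: "(\<lambda>x. vari M (\<lambda>y. f (x(j := y)))) \<in> borel_measurable ?Q"
      and bQ: "\<And>x. x \<in> space ?Q \<Longrightarrow> \<bar>vari M (\<lambda>y. f (x(j := y)))\<bar> \<le> B\<^sup>2"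
      using vm[of q j] vB[of _ j] q j by auto
    have "(\<integral>x. vari M (\<lambda>y. f (x(j := y))) \<partial>?Q) = (\<integral>x. \<integral>z. vari M (\<lambda>y. f (x(i := z, j := y))) \<partial>M \<partial>?P)"
      by (rule ins[OF mQ bQ])
    moreover have "(\<integral>x. vari M (\<lambda>y. h (x(j := y))) \<partial>?P) \<le> \<dots>"
    proof (rule Bochner_Integration.integral_mono'[OF _ pw])
      have "(\<lambda>(x, z). vari M (\<lambda>y. f (x(i := z, j := y)))) \<in> borel_measurable (?P \<Otimes>\<^sub>M M)"
        using measurable_compose[OF measurable_add_dim[of i I "\<lambda>_. M"] mQ]
        by (simp add: case_prod_beta')
      then have mm: "(\<lambda>p. vari M (\<lambda>y. f ((fst p)(i := snd p, j := y)))) \<in> borel_measurable (?P \<Otimes>\<^sub>M M)"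
        by (simp add: case_prod_beta')
      have "integrable (?P \<Otimes>\<^sub>M M) (\<lambda>p. vari M (\<lambda>y. f ((fst p)(i := snd p, j := y))))"
        by (rule PM.P.integrable_bounded[OF mm, of "B\<^sup>2"])
           (use bQ upd in \<open>auto simp: space_pair_measure\<close>)
      from PM.integrable_fst'[OF this] show "integrable ?P (\<lambda>x. \<integral>z. vari M (\<lambda>y. f (x(i := z, j := y))) \<partial>M)"
        by simp
    qed (auto intro!: integral_nonneg_AE)
    ultimately show ?thesis by simp
  qed
  have "vari ?Q f \<le> (\<integral>x. vari M (\<lambda>y. f (x(i := y))) \<partial>?Q)
      + (\<Sum>j\<in>I. \<integral>x. vari M (\<lambda>y. f (x(j := y))) \<partial>?Q)"
    unfolding tot 1 by (intro add_left_mono order_trans[OF varI] sum_mono 2)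
  then show ?case by (simp only: sum.insert[OF fin ni])
qed


section \<open>Exponential moments and McDiarmid's inequality\<close>

text \<open>Given the other coordinates, \<open>f\<close> ranges over an interval of length
  \<open>c\<close>, so Hoeffding's lemma bounds the exponential moment of its fluctuation around
  \<open>h\<close> by \<open>exp (l\<^sup>2 * c\<^sup>2 / 8)\<close>. The average \<open>h\<close>
  again changes by at most \<open>c\<close> per coordinate, so that each coordinate contributes one
  such factor.\<close>

lemma bounded_differences_exp_moment:
  fixes f :: "('i \<Rightarrow> 'a) \<Rightarrow> real"
  assumes M: "prob_space M" and I: "finite I" and l: "l > 0" and c: "c \<ge> 0"
    and f: "f \<in> borel_measurable (Pi\<^sub>M I (\<lambda>_. M))"
    and B: "\<And>x. x \<in> space (Pi\<^sub>M I (\<lambda>_. M)) \<Longrightarrow> \<bar>f x\<bar> \<le> B"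
    and diff: "\<And>x i y. x \<in> space (Pi\<^sub>M I (\<lambda>_. M)) \<Longrightarrow> i \<in> I \<Longrightarrow> y \<in> space M \<Longrightarrow>
      f (x(i := y)) \<le> f x + c"
  shows "(\<integral>\<^sup>+x. ennreal (exp (l * (f x - (\<integral>x. f x \<partial>Pi\<^sub>M I (\<lambda>_. M))))) \<partial>Pi\<^sub>M I (\<lambda>_. M))
    \<le> ennreal (exp (l\<^sup>2 * real (card I) * c\<^sup>2 / 8))"
  using I f B diff
proof (induction I arbitrary: f rule: finite_induct)
  case empty
  then show ?case
    by (subst PiM_empty)+ (simp add: lebesgue_integral_count_space_finite nn_integral_count_space_finite PiM_empty)
next
  case (insert i I)
  interpret M: prob_space M by fact
  interpret product_sigma_finite "\<lambda>_::'i. M" by standard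
  let ?P = "Pi\<^sub>M I (\<lambda>_. M)" and ?Q = "Pi\<^sub>M (insert i I) (\<lambda>_. M)"
  interpret P: prob_space ?P by (intro prob_space_PiM M)
  interpret Q: prob_space ?Q by (intro prob_space_PiM M)
  interpret PM: pair_prob_space ?P M ..
  note [measurable] = insert.prems(1)
  note fin = insert.hyps(1) note ni = insert.hyps(2)
  have upd: "x(i := y) \<in> space ?Q" if "x \<in> space ?P" "y \<in> space M" for x y
    using that by (auto simp: space_PiM PiE_iff extensional_def)
  define h where "h u = (\<integral>y. f (u(i := y)) \<partial>M)" for u
  have fu[measurable]: "(\<lambda>(u, y). f (u(i := y))) \<in> borel_measurable (?P \<Otimes>\<^sub>M M)"
    using measurable_compose[OF measurable_add_dim[of i I "\<lambda>_. M"] insert.prems(1)]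
    by (simp add: case_prod_beta')
  have fuy: "(\<lambda>y. f (u(i := y))) \<in> borel_measurable M" if "u \<in> space ?P" for u
    using measurable_compose[OF measurable_Pair1'[OF that] fu] by simp
  have fB: "\<bar>f (u(i := y))\<bar> \<le> B" if "u \<in> space ?P" "y \<in> space M" for u y
    using insert.prems(2) upd that by blast
  have h[measurable]: "h \<in> borel_measurable ?P" unfolding h_def using fu by measurable
  have hB: "\<bar>h u\<bar> \<le> B" if "u \<in> space ?P" for u
    unfolding h_def by (rule M.abs_expectation_le) (use that fuy fB in auto)
  have Ef: "(\<integral>x. f x \<partial>?Q) = (\<integral>u. h u \<partial>?P)"
    unfolding h_def
    by (rule product_integral_insert[OF fin ni Q.integrable_bounded[OF insert.prems(1,2)]])
  have IH: "(\<integral>\<^sup>+u. ennreal (exp (l * (h u - (\<integral>x. h x \<partial>?P)))) \<partial>?P)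
    \<le> ennreal (exp (l\<^sup>2 * real (card I) * c\<^sup>2 / 8))"
  proof (rule insert.IH[OF h hB])
    fix x j y assume *: "x \<in> space ?P" "j \<in> I" "y \<in> space M"
    have xj: "x(j := y) \<in> space ?P" using * by (auto simp: space_PiM PiE_iff extensional_def)
    have "h (x(j := y)) \<le> (\<integral>z. f (x(i := z)) + c \<partial>M)"
      unfolding h_def
    proof (rule integral_mono)
      show "integrable M (\<lambda>z. f (x(j := y, i := z)))"
        by (rule M.integrable_bounded[OF fuy fB]) (use xj in auto)
      show "integrable M (\<lambda>z. f (x(i := z)) + c)"
      proof (rule M.integrable_bounded[where B = "B + c"])
        show "\<bar>f (x(i := z)) + c\<bar> \<le> B + c" if "z \<in> space M" for z
          using fB[OF *(1) that] c by linarith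
      qed (use fuy[OF *(1)] in measurable)
      show "f (x(j := y, i := z)) \<le> f (x(i := z)) + c" if "z \<in> space M" for z
      proof -
        have "j \<noteq> i" using * ni by auto
        then have "x(j := y, i := z) = x(i := z, j := y)" by (rule fun_upd_twist)
        moreover have "f (x(i := z, j := y)) \<le> f (x(i := z)) + c"
          by (rule insert.prems(3)[OF upd[OF *(1) that] _ *(3)]) (use * in simp)
        ultimately show ?thesis by (simp only:)
      qed
    qed
    also have "\<dots> = h x + c"
      using M.integrable_bounded[OF fuy fB] * by (simp add: h_def M.prob_space)
    finally show "h (x(j := y)) \<le> h x + c" .
  qed
  have step: "(\<integral>\<^sup>+y. ennreal (exp (l * (f (u(i := y)) - h u))) \<partial>M) \<le> ennreal (exp (l\<^sup>2 * c\<^sup>2 / 8))"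
    if u: "u \<in> space ?P" for u
  proof -
    \<comment> \<open>The one-sided hypothesis suffices: comparing \<open>y\<close> with every
      \<open>z\<close> puts all values between the infimum \<open>a\<close> and
      \<open>a + c\<close>.\<close>
    define a where "a = (INF y\<in>space M. f (u(i := y)))"
    have bd: "bdd_below ((\<lambda>y. f (u(i := y))) ` space M)"
      using fB[OF u] by (intro bdd_belowI2[where m = "-B"]) (auto simp: abs_le_iff minus_le_iff)
    have lo: "a \<le> f (u(i := y))" if "y \<in> space M" for y
      unfolding a_def by (rule cINF_lower[OF bd that])
    have hi: "f (u(i := y)) \<le> a + c" if y: "y \<in> space M" for y
    proof -
      have "f (u(i := y)) - c \<le> a"
        unfolding a_def
      proof (rule cINF_greatest[OF M.not_empty])
        fix z assume z: "z \<in> space M"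
        show "f (u(i := y)) - c \<le> f (u(i := z))"
        proof -
          have "f (u(i := z, i := y)) \<le> f (u(i := z)) + c"
            by (rule insert.prems(3)[OF upd[OF u z] _ y]) simp
          then have "f (u(i := y)) \<le> f (u(i := z)) + c" by (simp only: fun_upd_upd)
          then show ?thesis by linarith
        qed
      qed
      then show ?thesis by simp
    qed
    interpret iv: interval_bounded_random_variable M "\<lambda>y. f (u(i := y))" a "a + c"
      by unfold_locales (use fuy[OF u] lo hi in \<open>auto intro!: AE_I2\<close>)
    show ?thesis using iv.Hoeffdings_lemma_nn_integral[OF l] by (simp add: h_def)
  qed
  let ?m = "\<integral>x. h x \<partial>?P"
  have "(\<integral>\<^sup>+x. ennreal (exp (l * (f x - (\<integral>x. f x \<partial>?Q)))) \<partial>?Q)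
      = (\<integral>\<^sup>+u. \<integral>\<^sup>+y. ennreal (exp (l * (f (u(i := y)) - ?m))) \<partial>M \<partial>?P)"
    unfolding Ef by (rule product_nn_integral_insert[OF fin ni]) measurable
  also have "\<dots> = (\<integral>\<^sup>+u. ennreal (exp (l * (h u - ?m))) * (\<integral>\<^sup>+y. ennreal (exp (l * (f (u(i := y)) - h u))) \<partial>M) \<partial>?P)"
  proof (rule nn_integral_cong)
    fix u assume u: "u \<in> space ?P"
    have "ennreal (exp (l * (f (u(i := y)) - ?m)))
      = ennreal (exp (l * (h u - ?m))) * ennreal (exp (l * (f (u(i := y)) - h u)))" for y
      by (simp flip: ennreal_mult exp_add add: algebra_simps)
    then show "(\<integral>\<^sup>+y. ennreal (exp (l * (f (u(i := y)) - ?m))) \<partial>M)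
      = ennreal (exp (l * (h u - ?m))) * (\<integral>\<^sup>+y. ennreal (exp (l * (f (u(i := y)) - h u))) \<partial>M)"
      using fuy[OF u] by (simp add: nn_integral_cmult)
  qed
  also have "\<dots> \<le> (\<integral>\<^sup>+u. ennreal (exp (l * (h u - ?m))) * ennreal (exp (l\<^sup>2 * c\<^sup>2 / 8)) \<partial>?P)"
    by (intro nn_integral_mono mult_left_mono step) auto
  also have "\<dots> = (\<integral>\<^sup>+u. ennreal (exp (l * (h u - ?m))) \<partial>?P) * ennreal (exp (l\<^sup>2 * c\<^sup>2 / 8))"
    by (rule nn_integral_multc) measurable
  also have "\<dots> \<le> ennreal (exp (l\<^sup>2 * real (card I) * c\<^sup>2 / 8)) * ennreal (exp (l\<^sup>2 * c\<^sup>2 / 8))"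
    by (rule mult_right_mono[OF IH]) simp
  also have "\<dots> = ennreal (exp (l\<^sup>2 * real (card (insert i I)) * c\<^sup>2 / 8))"
    using fin ni by (simp flip: ennreal_mult exp_add add: field_simps)
  finally show ?case .
qed

text \<open>McDiarmid's inequality, from Markov's inequality for the exponential of \<open>l\<close>
  times the fluctuation.\<close>

lemma bounded_differences_inequality:
  fixes f :: "('i \<Rightarrow> 'a) \<Rightarrow> real"
  assumes M: "prob_space M" and I: "finite I" "I \<noteq> {}" and t: "t > 0" and c: "c > 0"
    and f: "f \<in> borel_measurable (Pi\<^sub>M I (\<lambda>_. M))"
    and B: "\<And>x. x \<in> space (Pi\<^sub>M I (\<lambda>_. M)) \<Longrightarrow> \<bar>f x\<bar> \<le> B"
    and diff: "\<And>x i y. x \<in> space (Pi\<^sub>M I (\<lambda>_. M)) \<Longrightarrow> i \<in> I \<Longrightarrow> y \<in> space M \<Longrightarrow>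
      f (x(i := y)) \<le> f x + c"
  shows "measure (Pi\<^sub>M I (\<lambda>_. M)) {x \<in> space (Pi\<^sub>M I (\<lambda>_. M)). (\<integral>x. f x \<partial>Pi\<^sub>M I (\<lambda>_. M)) + t \<le> f x}
    \<le> exp (- 2 * t\<^sup>2 / (real (card I) * c\<^sup>2))"
proof -
  let ?P = "Pi\<^sub>M I (\<lambda>_. M)"
  interpret M: prob_space M by fact
  interpret P: prob_space ?P by (intro prob_space_PiM M)
  note [measurable] = f
  define K where "K = real (card I) * c\<^sup>2"
  have K: "K > 0" using I c by (simp add: K_def card_gt_0_iff)
  \<comment> \<open>The minimiser of \<open>- (l * t) + l\<^sup>2 * K / 8\<close>, where the minimum
    is \<open>- 2 * t\<^sup>2 / K\<close>.\<close>
  define l where "l = 4 * t / K"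
  have l: "l > 0" using t K by (simp add: l_def)
  let ?m = "\<integral>x. f x \<partial>?P"
  have "emeasure ?P {x \<in> space ?P. ?m + t \<le> f x} = (\<integral>\<^sup>+x. indicator {x \<in> space ?P. ?m + t \<le> f x} x \<partial>?P)"
    by simp
  also have "\<dots> \<le> (\<integral>\<^sup>+x. ennreal (exp (- (l * t))) * ennreal (exp (l * (f x - ?m))) \<partial>?P)"
  proof (rule nn_integral_mono)
    fix x
    show "indicator {x \<in> space ?P. ?m + t \<le> f x} x
      \<le> ennreal (exp (- (l * t))) * ennreal (exp (l * (f x - ?m)))"
    proof (cases "?m + t \<le> f x")
      case True
      then have "0 \<le> l * ((f x - ?m) - t)" using l by (intro mult_nonneg_nonneg) auto
      then have "1 \<le> ennreal (exp (- (l * t)) * exp (l * (f x - ?m)))"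
        by (simp flip: exp_add add: algebra_simps)
      then show ?thesis by (auto simp: indicator_def ennreal_mult split: if_splits)
    qed simp
  qed
  also have "\<dots> = ennreal (exp (- (l * t))) * (\<integral>\<^sup>+x. ennreal (exp (l * (f x - ?m))) \<partial>?P)"
    by (rule nn_integral_cmult) measurable
  also have "\<dots> \<le> ennreal (exp (- (l * t))) * ennreal (exp (l\<^sup>2 * real (card I) * c\<^sup>2 / 8))"
    by (intro mult_left_mono bounded_differences_exp_moment[OF M I(1) l _ f B diff]) (use c in auto)
  also have "\<dots> = ennreal (exp (- 2 * t\<^sup>2 / K))"
  proof -
    have "- (l * t) + l\<^sup>2 * K / 8 = - 2 * t\<^sup>2 / K"
      using K by (simp add: l_def power2_eq_square field_simps)
    then show ?thesis by (simp flip: ennreal_mult exp_add add: K_def mult.assoc)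
  qed
  finally show ?thesis
    by (simp add: P.emeasure_eq_measure K_def)
qed

section \<open>The Gaussian Poincare inequality\<close>

abbreviation gauss :: "real measure" where
  "gauss \<equiv> density lborel std_normal_density"

lemma prob_space_gauss: "prob_space gauss"
  by (rule prob_space_normal_density) simp

lemma integral_gauss:
  assumes "f \<in> borel_measurable borel"
  shows "(\<integral>x. f x \<partial>gauss) = (\<integral>x. std_normal_density x * f x \<partial>lborel)"
  by (subst integral_density) (use assms in auto)

lemma std_normal_density_deriv:
  "(std_normal_density has_real_derivative - (x * std_normal_density x)) (at x)"
  unfolding std_normal_density_def[abs_def]
  by (auto intro!: derivative_eq_intros simp: field_simps)

lemma integrable_gauss_id: "integrable gauss (\<lambda>x. x)"
  using integrable_std_normal_moment[of 1] by (subst integrable_density) auto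

lemma std_normal_density_tendsto_0:
  "(std_normal_density \<longlongrightarrow> 0) at_top" "(std_normal_density \<longlongrightarrow> 0) at_bot"
  unfolding std_normal_density_def[abs_def] by real_asymp+

text \<open>Since \<open>- std_normal_density\<close> is an antiderivative of
  \<open>y * std_normal_density y\<close> and vanishes at infinity, only the boundary value at
  \<open>t\<close> remains.\<close>

lemma gauss_upper_first_moment:
  "(\<integral>y. y * indicator {t<..} y \<partial>gauss) = std_normal_density t"
proof -
  have si: "set_integrable lborel (einterval (ereal t) \<infinity>) (\<lambda>y. y * std_normal_density y)"
    using integrable_std_normal_moment[of 1]
    unfolding set_integrable_def by (intro integrable_mult_indicator) (auto simp: mult.commute)
  have "(LBINT y=ereal t..\<infinity>. y * std_normal_density y) = 0 - (- std_normal_density t)"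
  proof (rule interval_integral_FTC_integrable[OF _ _ _ si])
    show "((\<lambda>y. - std_normal_density y) has_vector_derivative y * std_normal_density y) (at y)" for y
      unfolding has_real_derivative_iff_has_vector_derivative[symmetric]
      by (rule derivative_eq_intros std_normal_density_deriv refl | simp)+
    show "isCont (\<lambda>y. y * std_normal_density y) y" for y
      using DERIV_isCont[OF std_normal_density_deriv] by (intro continuous_intros)
    show "(((\<lambda>y. - std_normal_density y) \<circ> real_of_ereal) \<longlongrightarrow> - std_normal_density t) (at_right (ereal t))"
      using isCont_tendsto_compose[OF DERIV_isCont[OF std_normal_density_deriv]]
      unfolding ereal_tendsto_simps
      by (intro tendsto_minus) (auto intro!: tendsto_within_subset[OF isContD[OF DERIV_isCont[OF std_normal_density_deriv]]])
    show "(((\<lambda>y. - std_normal_density y) \<circ> real_of_ereal) \<longlongrightarrow> 0) (at_left \<infinity>)"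
      unfolding ereal_tendsto_simps using tendsto_minus[OF std_normal_density_tendsto_0(1)] by simp
  qed simp
  then show ?thesis
    by (subst integral_gauss)
       (auto simp: interval_lebesgue_integral_def set_lebesgue_integral_def einterval_def greaterThan_def
          intro!: Bochner_Integration.integral_cong simp: mult_ac)
qed

lemma gauss_lower_first_moment:
  "(\<integral>y. y * indicator {..<t} y \<partial>gauss) = - std_normal_density t"
proof -
  have "(\<integral>y. y * indicator {..<t} y \<partial>gauss) = (\<integral>y. - (y * indicator {-t<..} y) \<partial>gauss)"
    apply (subst (1 2) integral_gauss)
    apply simp apply simp
    \<comment> \<open>Reflection in the origin, under which the density is even.\<close>
    apply (subst lborel_integral_real_affine[where c = "-1" and t = 0])
    apply (auto intro!: Bochner_Integration.integral_cong simp: indicator_def std_normal_density_def)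
    done
  also have "\<dots> = - std_normal_density (- t)"
    by (simp only: Bochner_Integration.integral_minus gauss_upper_first_moment)
  finally show ?thesis by (simp add: std_normal_density_def)
qed

lemma AE_gauss_neq: "AE x in gauss. x \<noteq> t"
  by (subst AE_density) (auto intro: AE_mp[OF AE_lborel_singleton[of t]])

text \<open>Cauchy--Schwarz for \<open>f y - f z\<close> leaves this kernel on \<open>(f' t)\<^sup>2\<close>; that it is the density itself (equality
  holds) gives the Poincare constant 1.\<close>

lemma gauss_kernel:
  "(\<integral>\<^sup>+z. \<integral>\<^sup>+y. ennreal (y - z) * indicator {z..y} t \<partial>gauss \<partial>gauss) \<le> ennreal (std_normal_density t)"
proof -
  interpret prob_space gauss by (rule prob_space_gauss)
  define p where "p = measure gauss {t<..}"
  define q where "q = measure gauss {..<t}"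
  \<comment> \<open>The kernel involves closed half-lines, the moment lemmas open ones; the endpoint
    is null.\<close>
  have P: "(\<integral>\<^sup>+y. indicator {t..} y \<partial>gauss) = ennreal p"
  proof -
    have "(\<integral>\<^sup>+y. indicator {t..} y \<partial>gauss) = (\<integral>\<^sup>+y. indicator {t<..} y \<partial>gauss)"
      by (rule nn_integral_cong_AE, rule AE_mp[OF AE_gauss_neq[of t]]) (auto simp: indicator_def)
    then show ?thesis by (simp add: p_def emeasure_eq_measure)
  qed
  have Q: "(\<integral>\<^sup>+y. indicator {..t} y \<partial>gauss) = ennreal q"
  proof -
    have "(\<integral>\<^sup>+y. indicator {..t} y \<partial>gauss) = (\<integral>\<^sup>+y. indicator {..<t} y \<partial>gauss)"
      by (rule nn_integral_cong_AE, rule AE_mp[OF AE_gauss_neq[of t]]) (auto simp: indicator_def)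
    then show ?thesis by (simp add: q_def emeasure_eq_measure)
  qed
  have pq: "p + q \<le> 1"
    unfolding p_def q_def by (subst finite_measure_Union[symmetric]) auto
  have i1: "integrable gauss (\<lambda>y. y * indicator {t<..} y)" "integrable gauss (\<lambda>y. y * indicator {..<t} y)"
    using integrable_mult_indicator[OF _ integrable_gauss_id, of "{t<..}"]
      integrable_mult_indicator[OF _ integrable_gauss_id, of "{..<t}"] by (auto simp: mult.commute)
  have i2: "integrable gauss (\<lambda>y. t * indicator {t<..} y :: real)" "integrable gauss (\<lambda>y. t * indicator {..<t} y :: real)"
    by (intro integrable_mult_right integrable_real_indicator; simp add: emeasure_eq_measure)+
  have i3: "(\<integral>y. t * indicator {t<..} y \<partial>gauss) = t * p" "(\<integral>y. t * indicator {..<t} y \<partial>gauss) = t * q"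
    unfolding p_def q_def by simp_all
  have eA: "(\<integral>y. y * indicator {t<..} y - t * indicator {t<..} y \<partial>gauss) = std_normal_density t - t * p"
    by (subst Bochner_Integration.integral_diff[OF i1(1) i2(1)]) (simp only: i3 gauss_upper_first_moment)
  have eC: "(\<integral>y. t * indicator {..<t} y - y * indicator {..<t} y \<partial>gauss) = t * q + std_normal_density t"
    by (subst Bochner_Integration.integral_diff[OF i2(2) i1(2)]) (simp only: i3 gauss_lower_first_moment diff_minus_eq_add)
  have A: "(\<integral>\<^sup>+y. ennreal (y - t) * indicator {t..} y \<partial>gauss) = ennreal (std_normal_density t - t * p)"
  proof -
    have "(\<integral>\<^sup>+y. ennreal (y - t) * indicator {t..} y \<partial>gauss)
      = (\<integral>\<^sup>+y. ennreal (y * indicator {t<..} y - t * indicator {t<..} y) \<partial>gauss)"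
      by (intro nn_integral_cong) (auto simp: indicator_def ennreal_neg)
    also have "\<dots> = ennreal (\<integral>y. y * indicator {t<..} y - t * indicator {t<..} y \<partial>gauss)"
      by (rule nn_integral_eq_integral[OF Bochner_Integration.integrable_diff[OF i1(1) i2(1)]])
         (auto simp: indicator_def)
    finally show ?thesis by (simp only: eA)
  qed
  have C: "(\<integral>\<^sup>+y. ennreal (t - y) * indicator {..t} y \<partial>gauss) = ennreal (t * q + std_normal_density t)"
  proof -
    have "(\<integral>\<^sup>+y. ennreal (t - y) * indicator {..t} y \<partial>gauss)
      = (\<integral>\<^sup>+y. ennreal (t * indicator {..<t} y - y * indicator {..<t} y) \<partial>gauss)"
      by (intro nn_integral_cong) (auto simp: indicator_def ennreal_neg)
    also have "\<dots> = ennreal (\<integral>y. t * indicator {..<t} y - y * indicator {..<t} y \<partial>gauss)"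
      by (rule nn_integral_eq_integral[OF Bochner_Integration.integrable_diff[OF i2(2) i1(2)]])
         (auto simp: indicator_def)
    finally show ?thesis by (simp only: eC)
  qed
  have A0: "0 \<le> std_normal_density t - t * p"
    unfolding eA[symmetric] by (rule integral_nonneg_AE) (auto simp: indicator_def)
  have C0: "0 \<le> t * q + std_normal_density t"
    unfolding eC[symmetric] by (rule integral_nonneg_AE) (auto simp: indicator_def)
  \<comment> \<open>For \<open>z \<le> t\<close> and \<open>t \<le> y\<close> the length
    \<open>y - z\<close> splits into \<open>y - t\<close> and \<open>t - z\<close>, which separates
    the two integrals.\<close>
  have "(\<integral>\<^sup>+z. \<integral>\<^sup>+y. ennreal (y - z) * indicator {z..y} t \<partial>gauss \<partial>gauss)
    = (\<integral>\<^sup>+z. \<integral>\<^sup>+y. indicator {..t} z * (ennreal (y - t) * indicator {t..} y)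
        + (ennreal (t - z) * indicator {..t} z) * indicator {t..} y \<partial>gauss \<partial>gauss)"
    by (intro nn_integral_cong) (auto simp: indicator_def simp flip: ennreal_plus)
  also have "\<dots> = (\<integral>\<^sup>+z. indicator {..t} z * ennreal (std_normal_density t - t * p)
        + (ennreal (t - z) * indicator {..t} z) * ennreal p \<partial>gauss)"
    by (simp add: nn_integral_add nn_integral_cmult A P)
  also have "\<dots> = ennreal q * ennreal (std_normal_density t - t * p) + ennreal (t * q + std_normal_density t) * ennreal p"
    by (simp add: nn_integral_add nn_integral_multc C Q)
  also have "\<dots> = ennreal (q * (std_normal_density t - t * p) + (t * q + std_normal_density t) * p)"
    using A0 C0 by (simp add: p_def q_def ennreal_mult ennreal_plus)
  \<comment> \<open>The terms with \<open>t * p * q\<close> cancel, and \<open>p + q\<close> is a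
    probability.\<close>
  also have "q * (std_normal_density t - t * p) + (t * q + std_normal_density t) * p = std_normal_density t * (p + q)"
    by (simp add: algebra_simps)
  also have "\<dots> \<le> std_normal_density t"
    using mult_left_mono[OF pq, of "std_normal_density t"] by simp
  finally show ?thesis by (simp add: ennreal_leI)
qed

text \<open>Cauchy--Schwarz on \<open>{z..y}\<close>, obtained by expanding the square of
  \<open>f' - m\<close>. Keeping \<open>y - z\<close> under the integral prepares the exchange of
  integrals that produces the kernel of \<open>gauss_kernel\<close>.\<close>

lemma square_diff_le_integral:
  fixes f f' :: "real \<Rightarrow> real"
  assumes f: "\<And>t. (f has_real_derivative f' t) (at t)" and c: "continuous_on UNIV f'" and zy: "z \<le> y"
  shows "ennreal ((f y - f z)\<^sup>2) \<le> (\<integral>\<^sup>+t. ennreal (y - z) * indicator {z..y} t * ennreal ((f' t)\<^sup>2) \<partial>lborel)"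
proof (cases "z = y")
  case False
  then have zy': "z < y" using zy by simp
  have ic: "isCont f' t" for t using c by (simp add: continuous_on_eq_continuous_at)
  have [measurable]: "f' \<in> borel_measurable borel" using c by (rule borel_measurable_continuous_onI)
  \<comment> \<open>The mean slope, at which the integral of \<open>(f' t - m)\<^sup>2\<close> is
    smallest.\<close>
  define m where "m = (f y - f z) / (y - z)"
  have b1: "has_bochner_integral lborel (\<lambda>t. f' t * indicator {z..y} t) (f y - f z)"
    by (rule has_bochner_integral_FTC_Icc_real) (use zy f ic in auto)
  have b0: "has_bochner_integral lborel (\<lambda>t. 1 * indicator {z..y} t) (y - z)"
    by (rule has_bochner_integral_FTC_Icc_real[where F = "\<lambda>t. t"]) (use zy in auto)
  have i2: "integrable lborel (\<lambda>t. (f' t)\<^sup>2 * indicator {z..y} t)"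
    by (rule borel_integrable_atLeastAtMost) (use ic in auto)
  let ?I = "\<integral>t. (f' t)\<^sup>2 * indicator {z..y} t \<partial>lborel"
  have "0 \<le> (\<integral>t. (f' t - m)\<^sup>2 * indicator {z..y} t \<partial>lborel)"
    by (rule integral_nonneg_AE) simp
  also have "\<dots> = (\<integral>t. (f' t)\<^sup>2 * indicator {z..y} t - 2 * m * (f' t * indicator {z..y} t) + m\<^sup>2 * (1 * indicator {z..y} t) \<partial>lborel)"
    by (rule Bochner_Integration.integral_cong) (auto simp: indicator_def power2_eq_square algebra_simps)
  also have "\<dots> = ?I - 2 * m * (f y - f z) + m\<^sup>2 * (y - z)"
    using b1 b0 i2 by (simp add: has_bochner_integral_iff)
  finally have "0 \<le> ?I - 2 * m * (f y - f z) + m\<^sup>2 * (y - z)" .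
  then have "0 \<le> (y - z) * (?I - 2 * m * (f y - f z) + m\<^sup>2 * (y - z))" using zy by simp
  also have "\<dots> = (y - z) * ?I - 2 * ((y - z) * m) * (f y - f z) + ((y - z) * m)\<^sup>2"
    by (simp add: power2_eq_square algebra_simps)
  also have "(y - z) * m = f y - f z" using zy' by (simp add: m_def)
  finally have "(f y - f z)\<^sup>2 \<le> (y - z) * ?I" by (simp add: power2_eq_square algebra_simps)
  then have "ennreal ((f y - f z)\<^sup>2) \<le> ennreal ((y - z) * ?I)" by (rule ennreal_leI)
  also have "\<dots> = ennreal (\<integral>t. (y - z) * ((f' t)\<^sup>2 * indicator {z..y} t) \<partial>lborel)" by simp
  also have "\<dots> = (\<integral>\<^sup>+t. ennreal ((y - z) * ((f' t)\<^sup>2 * indicator {z..y} t)) \<partial>lborel)"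
    by (rule nn_integral_eq_integral[symmetric]) (use i2 zy in auto)
  also have "\<dots> = (\<integral>\<^sup>+t. ennreal (y - z) * indicator {z..y} t * ennreal ((f' t)\<^sup>2) \<partial>lborel)"
    by (rule nn_integral_cong) (use zy in \<open>auto simp: indicator_def ennreal_mult\<close>)
  finally show ?thesis .
qed simp

text \<open>The variance is half the double integral of \<open>(f y - f z)\<^sup>2\<close>, and by
  symmetry it is the integral over the half-plane \<open>z \<le> y\<close>. There Cauchy--Schwarz
  and Fubini leave the weight of \<open>gauss_kernel\<close> on the squared derivative. The right
  side may be infinite, whence the formulation in \<open>ennreal\<close>.\<close>

lemma gaussian_poincare_1d:
  fixes f f' :: "real \<Rightarrow> real"
  assumes f: "\<And>t. (f has_real_derivative f' t) (at t)" and c: "continuous_on UNIV f'"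
    and B: "\<And>t. \<bar>f t\<bar> \<le> B"
  shows "ennreal (vari gauss f) \<le> (\<integral>\<^sup>+t. ennreal ((f' t)\<^sup>2) \<partial>gauss)"
proof -
  interpret G: prob_space gauss by (rule prob_space_gauss)
  interpret GG: pair_prob_space gauss gauss ..
  interpret GL: pair_sigma_finite gauss lborel ..
  have p1: "measure gauss UNIV = 1" using G.prob_space by simp
  have fc: "continuous_on UNIV f" using f by (meson DERIV_isCont continuous_at_imp_continuous_on)
  have [measurable]: "f' \<in> borel_measurable borel" using c by (rule borel_measurable_continuous_onI)
  have [measurable]: "f \<in> borel_measurable borel" using fc by (rule borel_measurable_continuous_onI)
  have f2: "\<bar>(f t)\<^sup>2\<bar> \<le> B\<^sup>2" for t using power_mono[OF B[of t], of 2] by simp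
  have i: "integrable gauss f" "integrable gauss (\<lambda>t. (f t)\<^sup>2)"
    using B f2 by (auto intro!: G.integrable_bounded)
  let ?D = "\<lambda>z y. ennreal ((f y - f z)\<^sup>2)"
  have d2: "\<bar>(f y - f z)\<^sup>2\<bar> \<le> (2 * B)\<^sup>2" for y z
    using power_mono[of "\<bar>f y - f z\<bar>" "2 * B" 2] B[of y] B[of z] by auto
  have "2 * vari gauss f = (\<integral>z. \<integral>y. (f y - f z)\<^sup>2 \<partial>gauss \<partial>gauss)"
  proof -
    have "(\<integral>y. (f y - f z)\<^sup>2 \<partial>gauss) = (\<integral>y. (f y)\<^sup>2 \<partial>gauss) - 2 * f z * (\<integral>y. f y \<partial>gauss) + (f z)\<^sup>2" for z
    proof -
      have "(\<integral>y. (f y - f z)\<^sup>2 \<partial>gauss) = (\<integral>y. (f y)\<^sup>2 - 2 * f z * f y + (f z)\<^sup>2 \<partial>gauss)"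
        by (rule Bochner_Integration.integral_cong) (auto simp: power2_eq_square algebra_simps)
      then show ?thesis using i by (simp add: p1)
    qed
    then have "(\<integral>z. \<integral>y. (f y - f z)\<^sup>2 \<partial>gauss \<partial>gauss)
      = (\<integral>z. (\<integral>y. (f y)\<^sup>2 \<partial>gauss) - 2 * (\<integral>y. f y \<partial>gauss) * f z + (f z)\<^sup>2 \<partial>gauss)"
      by (simp add: mult_ac)
    also have "\<dots> = 2 * ((\<integral>y. (f y)\<^sup>2 \<partial>gauss) - (\<integral>y. f y \<partial>gauss)\<^sup>2)"
      using i by (simp add: p1 power2_eq_square algebra_simps)
    finally show ?thesis using G.vari_bounded_eq[of f B] B by simp
  qed
  then have "2 * ennreal (vari gauss f) = ennreal (\<integral>z. \<integral>y. (f y - f z)\<^sup>2 \<partial>gauss \<partial>gauss)"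
    by (metis ennreal_mult' ennreal_numeral zero_le_numeral)
  also have "\<dots> = (\<integral>\<^sup>+z. ennreal (\<integral>y. (f y - f z)\<^sup>2 \<partial>gauss) \<partial>gauss)"
  proof (rule nn_integral_eq_integral[symmetric])
    show "integrable gauss (\<lambda>z. \<integral>y. (f y - f z)\<^sup>2 \<partial>gauss)"
    proof (rule G.integrable_bounded[where B = "(2 * B)\<^sup>2"])
      show "\<bar>\<integral>y. (f y - f z)\<^sup>2 \<partial>gauss\<bar> \<le> (2 * B)\<^sup>2" for z
        by (rule G.abs_expectation_le) (use d2 in auto)
    qed measurable
  qed (auto intro!: integral_nonneg_AE)
  also have "\<dots> = (\<integral>\<^sup>+z. \<integral>\<^sup>+y. ?D z y \<partial>gauss \<partial>gauss)"
    by (intro nn_integral_cong nn_integral_eq_integral[symmetric] G.integrable_bounded[where B = "(2 * B)\<^sup>2"])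
       (use d2 in auto)
  \<comment> \<open>The two half-planes overlap on the diagonal, where the difference
    vanishes.\<close>
  also have "\<dots> \<le> (\<integral>\<^sup>+z. \<integral>\<^sup>+y. ?D z y * indicator {z..} y + ?D z y * indicator {y..} z \<partial>gauss \<partial>gauss)"
    by (intro nn_integral_mono) (auto simp: indicator_def)
  also have "\<dots> = (\<integral>\<^sup>+z. \<integral>\<^sup>+y. ?D z y * indicator {z..} y \<partial>gauss \<partial>gauss)
      + (\<integral>\<^sup>+z. \<integral>\<^sup>+y. ?D z y * indicator {y..} z \<partial>gauss \<partial>gauss)"
    by (simp add: nn_integral_add indicator_def[of "{_..}"])
  also have "(\<integral>\<^sup>+z. \<integral>\<^sup>+y. ?D z y * indicator {y..} z \<partial>gauss \<partial>gauss)
    = (\<integral>\<^sup>+z. \<integral>\<^sup>+y. ?D z y * indicator {z..} y \<partial>gauss \<partial>gauss)"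
    by (subst GG.Fubini') (auto simp: indicator_def[of "{_..}"] power2_commute)
  finally have two: "2 * ennreal (vari gauss f) \<le> 2 * (\<integral>\<^sup>+z. \<integral>\<^sup>+y. ?D z y * indicator {z..} y \<partial>gauss \<partial>gauss)"
    by (simp add: mult_2)
  have "(\<integral>\<^sup>+z. \<integral>\<^sup>+y. ?D z y * indicator {z..} y \<partial>gauss \<partial>gauss)
    \<le> (\<integral>\<^sup>+z. \<integral>\<^sup>+y. \<integral>\<^sup>+t. ennreal (y - z) * indicator {z..y} t * ennreal ((f' t)\<^sup>2) \<partial>lborel \<partial>gauss \<partial>gauss)"
    using square_diff_le_integral[OF f c] by (intro nn_integral_mono) (auto simp: indicator_def[of "{_..}"])
  also have "\<dots> = (\<integral>\<^sup>+z. \<integral>\<^sup>+t. \<integral>\<^sup>+y. ennreal (y - z) * indicator {z..y} t * ennreal ((f' t)\<^sup>2) \<partial>gauss \<partial>lborel \<partial>gauss)"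
    by (intro nn_integral_cong GL.Fubini'[symmetric]) (simp add: indicator_def)
  also have "\<dots> = (\<integral>\<^sup>+t. \<integral>\<^sup>+z. \<integral>\<^sup>+y. ennreal (y - z) * indicator {z..y} t * ennreal ((f' t)\<^sup>2) \<partial>gauss \<partial>gauss \<partial>lborel)"
    by (rule GL.Fubini'[symmetric]) (simp add: indicator_def)
  also have "\<dots> = (\<integral>\<^sup>+t. (\<integral>\<^sup>+z. \<integral>\<^sup>+y. ennreal (y - z) * indicator {z..y} t \<partial>gauss \<partial>gauss) * ennreal ((f' t)\<^sup>2) \<partial>lborel)"
    by (simp add: nn_integral_multc indicator_def)
  also have "\<dots> \<le> (\<integral>\<^sup>+t. ennreal (std_normal_density t) * ennreal ((f' t)\<^sup>2) \<partial>lborel)"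
    by (intro nn_integral_mono mult_right_mono gauss_kernel) auto
  also have "\<dots> = (\<integral>\<^sup>+t. ennreal ((f' t)\<^sup>2) \<partial>gauss)"
    by (subst nn_integral_density) auto
  finally have "2 * ennreal (vari gauss f) \<le> 2 * (\<integral>\<^sup>+t. ennreal ((f' t)\<^sup>2) \<partial>gauss)"
    by (intro order_trans[OF two] mult_left_mono) auto
  then show ?thesis
    by (subst (asm) ennreal_mult_le_mult_iff) auto
qed

section \<open>Gaussian vectors and their rotation invariance\<close>

lemma PiM_density_lborel:
  fixes f :: "real \<Rightarrow> real"
  assumes I: "finite I" and f[measurable]: "f \<in> borel_measurable borel" and p: "prob_space (density lborel f)"
  shows "Pi\<^sub>M I (\<lambda>_. density lborel f) = density (Pi\<^sub>M I (\<lambda>_. lborel)) (\<lambda>x. \<Prod>i\<in>I. ennreal (f (x i)))"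
proof -
  interpret p: prob_space "density lborel f" by fact
  interpret D: product_sigma_finite "\<lambda>_. density lborel f" by standard
  interpret L: product_sigma_finite "\<lambda>_. lborel :: real measure" by standard
  show ?thesis
  proof (rule D.PiM_eqI[OF I, symmetric])
    show "sets (density (Pi\<^sub>M I (\<lambda>_. lborel)) (\<lambda>x. \<Prod>i\<in>I. ennreal (f (x i)))) = sets (Pi\<^sub>M I (\<lambda>_. density lborel f))"
      by (simp cong: sets_PiM_cong)
    fix A :: "'a \<Rightarrow> real set" assume A: "\<And>i. i \<in> I \<Longrightarrow> A i \<in> sets (density lborel f)"
    then have A': "\<And>i. i \<in> I \<Longrightarrow> A i \<in> sets lborel" by simp
    have "emeasure (density (Pi\<^sub>M I (\<lambda>_. lborel)) (\<lambda>x. \<Prod>i\<in>I. ennreal (f (x i)))) (Pi\<^sub>E I A)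
      = (\<integral>\<^sup>+x. (\<Prod>i\<in>I. ennreal (f (x i))) * indicator (Pi\<^sub>E I A) x \<partial>Pi\<^sub>M I (\<lambda>_. lborel))"
      by (rule emeasure_density) (use A' I in \<open>auto intro!: sets_PiM_I_finite\<close>)
    also have "\<dots> = (\<integral>\<^sup>+x. (\<Prod>i\<in>I. ennreal (f (x i)) * indicator (A i) (x i)) \<partial>Pi\<^sub>M I (\<lambda>_. lborel))"
      using I by (intro nn_integral_cong)
        (auto simp: prod.distrib indicator_def space_PiM PiE_iff prod_zero_iff intro!: arg_cong2[where f = "(*)"])
    also have "\<dots> = (\<Prod>i\<in>I. \<integral>\<^sup>+x. ennreal (f x) * indicator (A i) x \<partial>lborel)"
      by (rule L.product_nn_integral_prod[OF I]) (use A' in measurable)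
    also have "\<dots> = (\<Prod>i\<in>I. emeasure (density lborel f) (A i))"
      by (intro prod.cong refl emeasure_density[symmetric]) (use A' in auto)
    finally show "emeasure (density (Pi\<^sub>M I (\<lambda>_. lborel)) (\<lambda>x. \<Prod>i\<in>I. ennreal (f (x i)))) (Pi\<^sub>E I A)
      = (\<Prod>i\<in>I. emeasure (density lborel f) (A i))" .
  qed
qed

text \<open>\<open>lborel\<close> is itself the image of the product of Lebesgue measures over
  \<open>Basis\<close> under this map, so the product of the Gaussian densities turns into a density
  with respect to \<open>lborel\<close>.\<close>

definition vec_of :: "('a::euclidean_space \<Rightarrow> real) \<Rightarrow> 'a" where
  "vec_of x = (\<Sum>b\<in>Basis. x b *\<^sub>R b)"

abbreviation gauss_PiM :: "('a::euclidean_space \<Rightarrow> real) measure" where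
  "gauss_PiM \<equiv> Pi\<^sub>M Basis (\<lambda>_. gauss)"

definition gauss_vec :: "'a::euclidean_space measure" where
  "gauss_vec = distr gauss_PiM borel vec_of"

lemma measurable_vec_of[measurable]: "vec_of \<in> measurable gauss_PiM borel"
  unfolding vec_of_def[abs_def] by measurable

lemma sets_gauss_vec[simp, measurable_cong]: "sets gauss_vec = sets borel"
  by (simp add: gauss_vec_def)

lemma space_gauss_vec[simp]: "space gauss_vec = UNIV"
  by (simp add: gauss_vec_def)

lemma prob_space_gauss_vec: "prob_space gauss_vec"
  unfolding gauss_vec_def
  by (intro prob_space.prob_space_distr prob_space_PiM prob_space_gauss measurable_vec_of)

lemma inner_vec_of: "b \<in> Basis \<Longrightarrow> vec_of x \<bullet> b = x b"
  by (simp add: vec_of_def)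

lemma norm_squared_Basis: "(norm v)\<^sup>2 = (\<Sum>b\<in>Basis. (v \<bullet> b)\<^sup>2)"
  by (simp only: power2_norm_eq_inner euclidean_inner[of v v]) (simp add: power2_eq_square)

lemma norm_vec_of_squared: "(norm (vec_of x))\<^sup>2 = (\<Sum>b\<in>Basis. (x b)\<^sup>2)"
  by (simp add: norm_squared_Basis inner_vec_of)

text \<open>The product of the coordinate densities is a function of the norm alone; invariance
  under orthogonal maps rests on this radial form.\<close>

lemma gauss_vec_density:
  "gauss_vec = density lborel
    (\<lambda>v :: 'a::euclidean_space. ennreal ((1 / sqrt (2 * pi)) ^ DIM('a) * exp (- (norm v)\<^sup>2 / 2)))"
proof -
  let ?w = "\<lambda>v :: 'a. ennreal ((1 / sqrt (2 * pi)) ^ DIM('a) * exp (- (norm v)\<^sup>2 / 2))"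
  have w: "(\<Prod>b\<in>Basis. ennreal (std_normal_density (x b))) = ?w (vec_of x)" for x :: "'a \<Rightarrow> real"
    by (simp add: prod_ennreal std_normal_density_def prod.distrib norm_vec_of_squared
        sum_divide_distrib prod_dividef power_divide flip: exp_sum sum_negf)
  have v: "vec_of \<in> measurable (Pi\<^sub>M Basis (\<lambda>_. lborel)) (borel :: 'a measure)"
    unfolding vec_of_def[abs_def] by measurable
  have "gauss_vec = distr (density (Pi\<^sub>M Basis (\<lambda>_. lborel)) (\<lambda>x :: 'a \<Rightarrow> real. ?w (vec_of x))) borel vec_of"
    unfolding gauss_vec_def
    by (subst PiM_density_lborel) (auto simp: prob_space_gauss w)
  also have "\<dots> = density (distr (Pi\<^sub>M Basis (\<lambda>_. lborel)) borel vec_of) ?w"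
    by (rule density_distr[symmetric]) (use v in measurable)
  also have "distr (Pi\<^sub>M Basis (\<lambda>_. lborel)) borel vec_of = (lborel :: 'a measure)"
    unfolding vec_of_def[abs_def] by (rule lborel_eq[symmetric])
  finally show ?thesis .
qed

lemma nn_integral_lborel_translate:
  fixes g :: "'a::euclidean_space \<Rightarrow> ennreal"
  assumes [measurable]: "g \<in> borel_measurable borel"
  shows "(\<integral>\<^sup>+x. g (x + a) \<partial>lborel) = (\<integral>\<^sup>+x. g x \<partial>lborel)"
  by (subst (2) lborel_distr_plus[of a, symmetric]) (simp add: nn_integral_distr add.commute)

text \<open>A translation invariant measure is a multiple of \<open>lborel\<close>, by Fubini for
  \<open>(x, y) \<mapsto> g (T x) * f (y - T x)\<close>; a radial \<open>f\<close> then fixes the factor.\<close>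

lemma nn_integral_lborel_orthogonal:
  fixes T :: "'a::euclidean_space \<Rightarrow> 'a"
  assumes T: "orthogonal_transformation T" and g[measurable]: "g \<in> borel_measurable borel"
  shows "(\<integral>\<^sup>+x. g (T x) \<partial>lborel) = (\<integral>\<^sup>+x. g x \<partial>lborel)"
proof -
  have lT: "linear T" using T by (rule orthogonal_transformation_linear)
  then have [measurable]: "T \<in> borel_measurable borel"
    by (simp add: borel_measurable_continuous_onI linear_continuous_on linear_conv_bounded_linear)
  define f where "f x = ennreal (exp (- (norm x)\<^sup>2 / 2))" for x :: 'a
  have f[measurable]: "f \<in> borel_measurable borel" unfolding f_def by measurable
  define J where "J = (\<integral>\<^sup>+x. f x \<partial>lborel)"
  have fm: "f (x - y) = f (y - x)" for x y by (simp add: f_def norm_minus_commute)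
  have fT: "f (- T x) = f x" for x
    using orthogonal_transformation_norm[OF T] by (simp add: f_def)
  let ?c = "(1 / sqrt (2 * pi)) ^ DIM('a)"
  interpret N: prob_space "gauss_vec :: 'a measure" by (rule prob_space_gauss_vec)
  \<comment> \<open>\<open>?c * f\<close> is the Gaussian density, so \<open>J\<close> is neither 0
    nor infinite and can be cancelled at the end.\<close>
  have "1 = emeasure (gauss_vec :: 'a measure) UNIV" using N.emeasure_space_1 by simp
  also have "\<dots> = (\<integral>\<^sup>+x. ennreal ?c * f x \<partial>lborel)"
    unfolding gauss_vec_density by (subst emeasure_density) (auto simp: f_def ennreal_mult intro!: nn_integral_cong)
  also have "\<dots> = ennreal ?c * J" unfolding J_def by (rule nn_integral_cmult) simp
  finally have cJ: "1 = ennreal ?c * J" .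
  have surj: "\<exists>b. T b = y" for y using orthogonal_transformation_surj[OF T] by (metis surjD)
  have J0: "J \<noteq> 0" using cJ by auto
  have J1: "J \<noteq> \<top>"
  proof
    assume "J = \<top>"
    then have "ennreal ?c * J = \<top>" by (simp add: ennreal_mult_top)
    then show False using cJ by simp
  qed
  have "(\<integral>\<^sup>+x. g (T x) \<partial>lborel) * J = (\<integral>\<^sup>+x. \<integral>\<^sup>+y. g (T x) * f (y - T x) \<partial>lborel \<partial>lborel)"
    using nn_integral_lborel_translate[OF f, of "- T x" for x]
    by (simp add: nn_integral_cmult nn_integral_multc J_def)
  also have "\<dots> = (\<integral>\<^sup>+y. \<integral>\<^sup>+x. g (T x) * f (y - T x) \<partial>lborel \<partial>lborel)"
    by (rule lborel_pair.Fubini'[symmetric]) measurable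
  also have "\<dots> = (\<integral>\<^sup>+y. \<integral>\<^sup>+x. g (y + T x) * f x \<partial>lborel \<partial>lborel)"
  proof (rule nn_integral_cong)
    fix y :: 'a
    obtain b where b: "T b = y" using surj by blast
    \<comment> \<open>Translating by the preimage \<open>b\<close> of \<open>y\<close> turns
      \<open>T x\<close> into \<open>y + T x\<close> and \<open>y - T x\<close> into
      \<open>- T x\<close>; the sign and \<open>T\<close> then disappear because \<open>f\<close> is
      radial.\<close>
    have "(\<integral>\<^sup>+x. g (T x) * f (y - T x) \<partial>lborel) = (\<integral>\<^sup>+x. g (T (x + b)) * f (y - T (x + b)) \<partial>lborel)"
      by (rule nn_integral_lborel_translate[symmetric]) measurable
    also have "\<dots> = (\<integral>\<^sup>+x. g (y + T x) * f x \<partial>lborel)"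
      by (simp add: linear_add[OF lT] b fT add.commute diff_diff_eq2[symmetric])
    finally show "(\<integral>\<^sup>+x. g (T x) * f (y - T x) \<partial>lborel) = (\<integral>\<^sup>+x. g (y + T x) * f x \<partial>lborel)" .
  qed
  also have "\<dots> = (\<integral>\<^sup>+x. \<integral>\<^sup>+y. g (y + T x) * f x \<partial>lborel \<partial>lborel)"
    by (rule lborel_pair.Fubini') measurable
  also have "\<dots> = (\<integral>\<^sup>+x. g x \<partial>lborel) * J"
    by (simp add: nn_integral_multc nn_integral_cmult nn_integral_lborel_translate J_def)
  finally show ?thesis using J0 J1 by (simp add: mult.commute[of _ J] ennreal_mult_cancel_left)
qed

lemma lborel_orthogonal_invariant:
  fixes T :: "'a::euclidean_space \<Rightarrow> 'a"
  assumes T: "orthogonal_transformation T"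
  shows "distr lborel lborel T = lborel"
proof (rule measure_eqI)
  have lT: "linear T" using T by (rule orthogonal_transformation_linear)
  then have [measurable]: "T \<in> borel_measurable borel"
    by (simp add: borel_measurable_continuous_onI linear_continuous_on linear_conv_bounded_linear)
  fix A assume "A \<in> sets (distr lborel lborel T)"
  then have [measurable]: "A \<in> sets borel" by simp
  have "emeasure (distr lborel lborel T) A = (\<integral>\<^sup>+x. indicator A x \<partial>distr lborel lborel T)" by simp
  also have "\<dots> = (\<integral>\<^sup>+x. indicator A (T x) \<partial>lborel)" by (rule nn_integral_distr) measurable
  also have "\<dots> = emeasure lborel A" by (subst nn_integral_lborel_orthogonal[OF T]) auto
  finally show "emeasure (distr lborel lborel T) A = emeasure lborel A" .
qed simp

lemma gauss_vec_orthogonal_invariant: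
  fixes f :: "'a::euclidean_space \<Rightarrow> 'a"
  assumes f: "orthogonal_transformation f"
  shows "distr gauss_vec borel f = gauss_vec"
proof -
  have lf: "linear f" using f by (rule orthogonal_transformation_linear)
  then have [measurable]: "f \<in> borel_measurable borel"
    by (simp add: borel_measurable_continuous_onI linear_continuous_on linear_conv_bounded_linear)
  let ?w = "\<lambda>v :: 'a. ennreal ((1 / sqrt (2 * pi)) ^ DIM('a) * exp (- (norm v)\<^sup>2 / 2))"
  have "distr (density lborel ?w) lborel f = distr (density lborel (\<lambda>v. ?w (f v))) lborel f"
    using orthogonal_transformation_norm[OF f] by simp
  also have "\<dots> = density (distr lborel lborel f) ?w"
    by (rule density_distr[symmetric]) measurable
  also have "\<dots> = density lborel ?w" by (simp only: lborel_orthogonal_invariant[OF f])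
  finally have "distr (density lborel ?w) lborel f = density lborel ?w" .
  moreover have "distr (density lborel ?w) borel f = distr (density lborel ?w) lborel f"
    by (rule distr_cong) auto
  ultimately show ?thesis unfolding gauss_vec_density by (simp only:)
qed

section \<open>Tensorization to several dimensions\<close>

text \<open>Redrawing one coordinate independently keeps the product law. This removes the inner
  averages left by the one-dimensional inequality, after which the squared partial derivatives add
  up to the squared gradient.\<close>

lemma nn_integral_PiM_resample:
  assumes M: "prob_space M" and I: "finite I" "i \<in> I"
    and h: "h \<in> borel_measurable (Pi\<^sub>M I (\<lambda>_. M))"
  shows "(\<integral>\<^sup>+x. \<integral>\<^sup>+y. h (x(i := y)) \<partial>M \<partial>Pi\<^sub>M I (\<lambda>_. M)) = (\<integral>\<^sup>+x. h x \<partial>Pi\<^sub>M I (\<lambda>_. M))"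
proof -
  interpret M: prob_space M by fact
  interpret product_sigma_finite "\<lambda>_. M" by standard
  define J where "J = I - {i}"
  have J: "finite J" "i \<notin> J" and IJ: "I = insert i J" using I by (auto simp: J_def)
  have h': "h \<in> borel_measurable (Pi\<^sub>M (insert i J) (\<lambda>_. M))" using h IJ by simp
  note [measurable] = h'
  have "(\<lambda>p. (fst p)(i := snd p)) \<in> measurable (Pi\<^sub>M (insert i J) (\<lambda>_. M) \<Otimes>\<^sub>M M) (Pi\<^sub>M (insert i J) (\<lambda>_. M))"
    by (rule measurable_fun_upd[where J = "insert i J"]) auto
  from measurable_compose[OF this h']
  have [measurable]: "(\<lambda>(x, y). h (x(i := y))) \<in> borel_measurable (Pi\<^sub>M (insert i J) (\<lambda>_. M) \<Otimes>\<^sub>M M)"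
    by (simp add: case_prod_beta' fun_upd_def)
  have "(\<integral>\<^sup>+x. \<integral>\<^sup>+y. h (x(i := y)) \<partial>M \<partial>Pi\<^sub>M (insert i J) (\<lambda>_. M))
    = (\<integral>\<^sup>+x. \<integral>\<^sup>+z. \<integral>\<^sup>+y. h (x(i := z, i := y)) \<partial>M \<partial>M \<partial>Pi\<^sub>M J (\<lambda>_. M))"
    by (rule product_nn_integral_insert[OF J]) measurable
  also have "\<dots> = (\<integral>\<^sup>+x. \<integral>\<^sup>+y. h (x(i := y)) \<partial>M \<partial>Pi\<^sub>M J (\<lambda>_. M))"
    by (simp add: M.emeasure_space_1)
  also have "\<dots> = (\<integral>\<^sup>+x. h x \<partial>Pi\<^sub>M (insert i J) (\<lambda>_. M))"
    by (rule product_nn_integral_insert[OF J h', symmetric])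
  finally show ?thesis by (simp add: IJ)
qed

text \<open>A function that is not integrable has Bochner integral 0, so the bound covers this case
  too, and the coordinate variances can be moved to \<open>ennreal\<close> without a separate
  integrability proof.\<close>

lemma ennreal_integral_le:
  fixes f :: "'a \<Rightarrow> real"
  assumes "\<And>x. 0 \<le> f x"
  shows "ennreal (\<integral>x. f x \<partial>M) \<le> (\<integral>\<^sup>+x. ennreal (f x) \<partial>M)"
proof (cases "integrable M f")
  case True
  then show ?thesis using assms by (simp add: nn_integral_eq_integral)
next
  case False
  then show ?thesis by (simp add: not_integrable_integral_eq)
qed

text \<open>Differentiability may fail at \<open>0\<close>: almost every line parallel to a coordinate axis misses it.\<close>

lemma gaussian_poincare:
  fixes F :: "'a::euclidean_space \<Rightarrow> real" and G :: "'a \<Rightarrow> 'a"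
  assumes dim: "2 \<le> DIM('a)"
    and F: "\<And>x. x \<noteq> 0 \<Longrightarrow> (F has_derivative (\<lambda>h. G x \<bullet> h)) (at x)"
    and G: "continuous_on (- {0}) G"
    and Fm[measurable]: "F \<in> borel_measurable borel" and Gm[measurable]: "G \<in> borel_measurable borel"
    and B: "\<And>x. \<bar>F x\<bar> \<le> B"
  shows "ennreal (vari gauss_vec F) \<le> (\<integral>\<^sup>+x. ennreal ((norm (G x))\<^sup>2) \<partial>gauss_vec)"
proof -
  let ?P = "gauss_PiM :: ('a \<Rightarrow> real) measure"
  have upd: "vec_of (x(b := y)) = vec_of x + (y - x b) *\<^sub>R b" if "b \<in> Basis" for x b y
    unfolding vec_of_def using that
    by (subst (1 2) sum.remove[of _ b]) (auto simp: algebra_simps intro!: sum.cong)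
  have nz: "vec_of x \<noteq> 0" if "b \<in> Basis" "x b \<noteq> 0" for x and b :: 'a
    using that inner_vec_of[of b x] by auto
  have "vari gauss_vec F = vari ?P (\<lambda>x. F (vec_of x))"
    unfolding gauss_vec_def by (simp add: integral_distr)
  also have "\<dots> \<le> (\<Sum>b\<in>Basis. \<integral>x. vari gauss (\<lambda>y. F (vec_of (x(b := y)))) \<partial>?P)"
    by (rule vari_le_sum_coordinate_vari[OF prob_space_gauss _ _ B]) auto
  finally have "ennreal (vari gauss_vec F)
      \<le> ennreal (\<Sum>b\<in>Basis. \<integral>x. vari gauss (\<lambda>y. F (vec_of (x(b := y)))) \<partial>?P)"
    by (rule ennreal_leI)
  also have "\<dots> = (\<Sum>b\<in>Basis. ennreal (\<integral>x. vari gauss (\<lambda>y. F (vec_of (x(b := y)))) \<partial>?P))"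
    by (rule sum_ennreal[symmetric]) (auto intro!: integral_nonneg_AE)
  also have "\<dots> \<le> (\<Sum>b\<in>Basis. \<integral>\<^sup>+x. ennreal (vari gauss (\<lambda>y. F (vec_of (x(b := y))))) \<partial>?P)"
    by (intro sum_mono ennreal_integral_le integral_nonneg_AE) auto
  also have "\<dots> \<le> (\<Sum>b\<in>Basis. \<integral>\<^sup>+x. \<integral>\<^sup>+y. ennreal ((G (vec_of (x(b := y))) \<bullet> b)\<^sup>2) \<partial>gauss \<partial>?P)"
  proof (intro sum_mono nn_integral_mono_AE)
    fix b :: 'a assume b: "b \<in> Basis"
    \<comment> \<open>In dimension at least 2 there is another coordinate \<open>b'\<close>; it is
      constant along the line and almost surely nonzero, which keeps the line off the
      origin.\<close>
    have "card (Basis :: 'a set) \<noteq> card {b}" using dim by simp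
    then have "Basis \<noteq> {b}" by metis
    then obtain b' :: 'a where b': "b' \<in> Basis" "b' \<noteq> b" using b by blast
    have "AE x in ?P. x b' \<noteq> 0"
      by (rule AE_PiM_component[OF prob_space_gauss b'(1) AE_gauss_neq])
    then show "AE x in ?P. ennreal (vari gauss (\<lambda>y. F (vec_of (x(b := y)))))
      \<le> (\<integral>\<^sup>+y. ennreal ((G (vec_of (x(b := y))) \<bullet> b)\<^sup>2) \<partial>gauss)"
    proof eventually_elim
      case (elim x)
      have n0: "vec_of (x(b := y)) \<noteq> 0" for y using nz[OF b'(1), of "x(b := y)"] elim b' by simp
      show ?case
      proof (rule gaussian_poincare_1d[OF _ _ B])
        fix y
        have "((\<lambda>y. vec_of (x(b := y))) has_derivative (\<lambda>h. h *\<^sub>R b)) (at y)"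
          unfolding upd[OF b] by (auto intro!: derivative_eq_intros)
        from has_derivative_compose[OF this F[OF n0]]
        show "((\<lambda>y. F (vec_of (x(b := y)))) has_real_derivative G (vec_of (x(b := y))) \<bullet> b) (at y)"
          by (simp add: has_field_derivative_def fun_upd_def mult_commute_abs)
      next
        have "continuous_on UNIV (\<lambda>y. vec_of (x(b := y)))"
          unfolding upd[OF b] by (intro continuous_intros)
        then have "continuous_on UNIV (\<lambda>y. G (vec_of (x(b := y))))"
          by (rule continuous_on_compose2[OF G]) (use n0 in auto)
        then show "continuous_on UNIV (\<lambda>y. G (vec_of (x(b := y))) \<bullet> b)"
          by (intro continuous_intros)
      qed
    qed
  qed
  also have "\<dots> = (\<Sum>b\<in>Basis. \<integral>\<^sup>+x. ennreal ((G (vec_of x) \<bullet> b)\<^sup>2) \<partial>?P)"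
    by (intro sum.cong refl nn_integral_PiM_resample prob_space_gauss) auto
  also have "\<dots> = (\<integral>\<^sup>+x. (\<Sum>b\<in>Basis. ennreal ((G (vec_of x) \<bullet> b)\<^sup>2)) \<partial>?P)"
    by (rule nn_integral_sum[symmetric]) auto
  also have "\<dots> = (\<integral>\<^sup>+x. ennreal ((norm (G (vec_of x)))\<^sup>2) \<partial>?P)"
    by (simp add: norm_squared_Basis)
  also have "\<dots> = (\<integral>\<^sup>+x. ennreal ((norm (G x))\<^sup>2) \<partial>gauss_vec)"
    unfolding gauss_vec_def by (simp add: nn_integral_distr)
  finally show ?thesis .
qed

section \<open>The mean inverse square of the norm\<close>

text \<open>The exponential factor changes the variance from 1 to \<open>1 / (1 + 2 * t)\<close>,
  and the value is the ratio of the two normalising constants.\<close>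

lemma gauss_exp_square:
  assumes t: "0 \<le> t"
  shows "(\<integral>\<^sup>+x. ennreal (exp (- (t * x\<^sup>2))) \<partial>gauss) = ennreal (1 / sqrt (1 + 2 * t))"
proof -
  let ?s = "1 / sqrt (1 + 2 * t)"
  have s: "?s > 0" using t by simp
  have "std_normal_density x * exp (- (t * x\<^sup>2)) = ?s * normal_density 0 ?s x" for x
    using t by (simp add: normal_density_def real_sqrt_mult real_sqrt_divide field_simps flip: exp_add)
  then have "(\<integral>\<^sup>+x. ennreal (exp (- (t * x\<^sup>2))) \<partial>gauss) = (\<integral>\<^sup>+x. ennreal ?s * ennreal (normal_density 0 ?s x) \<partial>lborel)"
    using s by (subst nn_integral_density) (auto intro!: nn_integral_cong simp flip: ennreal_mult)
  also have "\<dots> = ennreal ?s * (\<integral>\<^sup>+x. ennreal (normal_density 0 ?s x) \<partial>lborel)"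
    by (rule nn_integral_cmult) auto
  also have "(\<integral>\<^sup>+x. ennreal (normal_density 0 ?s x) \<partial>lborel) = 1"
    using s by (subst nn_integral_eq_integral) auto
  finally show ?thesis by simp
qed

text \<open>Write \<open>1 / s\<close> as the integral of \<open>exp (- t * s)\<close> over \<open>t \<ge> 0\<close>.\<close>

lemma gauss_vec_inverse_square:
  assumes dim: "3 \<le> DIM('a::euclidean_space)"
  shows "(\<integral>\<^sup>+x. ennreal (1 / (norm (x::'a))\<^sup>2) \<partial>gauss_vec) \<le> ennreal (1 / (real DIM('a) - 2))"
proof -
  interpret prob_space gauss by (rule prob_space_gauss)
  interpret product_sigma_finite "\<lambda>_::'a. gauss" by standard
  let ?P = "gauss_PiM :: ('a \<Rightarrow> real) measure"
  interpret P: prob_space ?P by (intro prob_space_PiM prob_space_gauss)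
  interpret PL: pair_sigma_finite ?P lborel ..
  let ?d = "real DIM('a)"
  \<comment> \<open>For \<open>s = 0\<close> the quotient is 0 by convention, hence an inequality;
    this case is the origin.\<close>
  have inv: "ennreal (1 / s) \<le> (\<integral>\<^sup>+t. ennreal (exp (- (t * s))) * indicator {0..} t \<partial>lborel)" if "0 \<le> s" for s :: real
  proof (cases "s = 0")
    case False
    then have s: "s > 0" using that by simp
    have "(\<integral>\<^sup>+t. ennreal (exp (- (t * s))) * indicator {0..} t \<partial>lborel) = ennreal (0 - (- (1 / s) * exp (- (0 * s))))"
    proof (rule nn_integral_FTC_atLeast)
      show "((\<lambda>t. - (1 / s) * exp (- (t * s))) has_real_derivative exp (- (t * s))) (at t)" for t
        using s by (auto intro!: derivative_eq_intros)
      show "((\<lambda>t. - (1 / s) * exp (- (t * s))) \<longlongrightarrow> 0) at_top"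
        using s by real_asymp
    qed auto
    then show ?thesis by simp
  qed simp
  have "(\<integral>\<^sup>+x. ennreal (1 / (norm (x::'a))\<^sup>2) \<partial>gauss_vec) = (\<integral>\<^sup>+x. ennreal (1 / (norm (vec_of x :: 'a))\<^sup>2) \<partial>?P)"
    unfolding gauss_vec_def by (simp add: nn_integral_distr)
  also have "\<dots> \<le> (\<integral>\<^sup>+x. \<integral>\<^sup>+t. ennreal (exp (- (t * (norm (vec_of x :: 'a))\<^sup>2))) * indicator {0..} t \<partial>lborel \<partial>?P)"
    by (intro nn_integral_mono inv) simp
  also have "\<dots> = (\<integral>\<^sup>+t. \<integral>\<^sup>+x. ennreal (exp (- (t * (norm (vec_of x :: 'a))\<^sup>2))) * indicator {0..} t \<partial>?P \<partial>lborel)"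
    by (rule PL.Fubini'[symmetric]) measurable
  also have "\<dots> = (\<integral>\<^sup>+t. ennreal ((1 + 2 * t) powr (- ?d / 2)) * indicator {0..} t \<partial>lborel)"
  proof (rule nn_integral_cong)
    fix t :: real
    show "(\<integral>\<^sup>+x. ennreal (exp (- (t * (norm (vec_of x :: 'a))\<^sup>2))) * indicator {0..} t \<partial>?P)
      = ennreal ((1 + 2 * t) powr (- ?d / 2)) * indicator {0..} t"
    proof (cases "0 \<le> t")
      case True
      have "(\<integral>\<^sup>+x. ennreal (exp (- (t * (norm (vec_of x :: 'a))\<^sup>2))) \<partial>?P)
        = (\<integral>\<^sup>+x. (\<Prod>b\<in>Basis. ennreal (exp (- (t * (x b)\<^sup>2)))) \<partial>?P)"
        by (simp add: prod_ennreal norm_vec_of_squared sum_distrib_left flip: exp_sum sum_negf)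
      also have "\<dots> = (\<Prod>b\<in>(Basis::'a set). \<integral>\<^sup>+x. ennreal (exp (- (t * x\<^sup>2))) \<partial>gauss)"
        by (rule product_nn_integral_prod) auto
      also have "\<dots> = ennreal ((1 / sqrt (1 + 2 * t)) ^ DIM('a))"
        using True by (simp add: gauss_exp_square ennreal_power)
      also have "(1 / sqrt (1 + 2 * t)) ^ DIM('a) = (1 + 2 * t) powr (- ?d / 2)"
      proof -
        have p: "0 < 1 + 2 * t" using True by simp
        have "1 / sqrt (1 + 2 * t) = (1 + 2 * t) powr (- (1 / 2))"
          unfolding powr_minus powr_half_sqrt[OF less_imp_le[OF p]] by (rule inverse_eq_divide[symmetric])
        also have "\<dots> ^ DIM('a) = (1 + 2 * t) powr (?d * (- (1 / 2)))"
          by (rule powr_power) (use p in linarith)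
        also have "?d * (- (1 / 2)) = - ?d / 2" by simp
        finally show ?thesis .
      qed
      finally show ?thesis using True by simp
    qed simp
  qed
  \<comment> \<open>The antiderivative vanishes at infinity because its exponent is negative, that
    is, because the dimension exceeds 2; its value at 0 yields the constant.\<close>
  also have "\<dots> = ennreal (0 - (- (1 / (?d - 2)) * (1 + 2 * 0) powr (1 - ?d / 2)))"
  proof (rule nn_integral_FTC_atLeast)
    show "((\<lambda>t. - (1 / (?d - 2)) * (1 + 2 * t) powr (1 - ?d / 2)) has_real_derivative (1 + 2 * t) powr (- ?d / 2)) (at t)"
      if "0 \<le> t" for t
    proof -
      have "((\<lambda>t. (1 + 2 * t) powr (1 - ?d / 2)) has_real_derivative (1 - ?d / 2) * (1 + 2 * t) powr ((1 - ?d / 2) - of_nat 1) * 2) (at t)"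
        by (rule DERIV_fun_powr) (use that in \<open>auto intro!: derivative_eq_intros\<close>)
      from DERIV_cmult[OF this, of "- (1 / (?d - 2))"]
      have D: "((\<lambda>t. - (1 / (?d - 2)) * (1 + 2 * t) powr (1 - ?d / 2)) has_real_derivative
        - (1 / (?d - 2)) * ((1 - ?d / 2) * (1 + 2 * t) powr ((1 - ?d / 2) - of_nat 1) * 2)) (at t)" .
      have "?d - 2 \<noteq> 0" using dim by simp
      then have "- (1 / (?d - 2)) * ((1 - ?d / 2) * X * 2) = X" for X by (simp add: field_simps)
      moreover have "(1 - ?d / 2) - of_nat 1 = - ?d / 2" by simp
      ultimately show ?thesis using D by (simp only:)
    qed
    have "((\<lambda>t::real. (1 + 2 * t) powr (1 - ?d / 2)) \<longlongrightarrow> 0) at_top"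
    proof (rule tendsto_neg_powr)
      show "1 - ?d / 2 < 0" using dim by simp
      show "filterlim (\<lambda>t::real. 1 + 2 * t) at_top at_top" by real_asymp
    qed
    from tendsto_mult_right_zero[OF this]
    show "((\<lambda>t. - (1 / (?d - 2)) * (1 + 2 * t) powr (1 - ?d / 2)) \<longlongrightarrow> 0) at_top" .
  qed auto
  finally show ?thesis by simp
qed

section \<open>Lipschitz functions on the sphere\<close>

text \<open>The property \<open>one_lipschitz\<close> for the geodesic metric, put on an arbitrary
  Euclidean space because the Gaussian estimates live there;
  \<open>one_lipschitz_geodesic_iff\<close> identifies the two.\<close>

definition angle_lipschitz :: "('a::euclidean_space \<Rightarrow> real) \<Rightarrow> bool" where
  "angle_lipschitz g \<longleftrightarrow> (\<forall>x\<in>sphere 0 1. \<forall>y\<in>sphere 0 1. \<bar>g x - g y\<bar> \<le> arccos (x \<bullet> y))"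

lemma inner_sphere_bounds:
  assumes "x \<in> sphere 0 1" "y \<in> sphere 0 1"
  shows "-1 \<le> x \<bullet> y" "x \<bullet> y \<le> 1"
  using Cauchy_Schwarz_ineq2[of x y] assms by (auto simp: abs_le_iff)

lemma arccos_inner_le_pi:
  assumes "x \<in> sphere 0 1" "y \<in> sphere 0 1"
  shows "0 \<le> arccos (x \<bullet> y)" "arccos (x \<bullet> y) \<le> pi"
  using inner_sphere_bounds[OF assms] by (auto simp: arccos_lbound arccos_ubound)

lemma angle_lipschitzD:
  assumes "angle_lipschitz g" "x \<in> sphere 0 1" "y \<in> sphere 0 1"
  shows "\<bar>g x - g y\<bar> \<le> arccos (x \<bullet> y)" "\<bar>g x - g y\<bar> \<le> pi"
  using assms arccos_inner_le_pi[OF assms(2,3)] unfolding angle_lipschitz_def by force+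

text \<open>The squared chord of an angle \<open>e\<close> is \<open>2 * (1 - cos e)\<close>. This
  carries Euclidean closeness, in which continuity and compactness are available, over to angular
  closeness.\<close>

lemma arccos_inner_less:
  fixes x y :: "'a::euclidean_space"
  assumes e: "0 < e" "e \<le> pi" and x: "x \<in> sphere 0 1" and y: "y \<in> sphere 0 1"
    and d: "(dist x y)\<^sup>2 < 2 * (1 - cos e)"
  shows "arccos (x \<bullet> y) < e"
proof -
  have "(dist x y)\<^sup>2 = 2 - 2 * (x \<bullet> y)"
    using x y by (simp add: dist_norm power2_norm_eq_inner inner_diff inner_commute norm_eq_1)
  then have "cos e < x \<bullet> y" using d by simp
  then have "arccos (x \<bullet> y) < arccos (cos e)"
    by (rule arccos_less_arccos[rotated]) (use inner_sphere_bounds[OF x y] in auto)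
  then show ?thesis using e by (simp add: arccos_cos)
qed

lemma one_minus_cos_pos: "0 < e \<Longrightarrow> e \<le> pi \<Longrightarrow> cos e < (1::real)"
  using cos_monotone_0_pi[of 0 e] by simp

lemma continuous_on_angle_lipschitz:
  assumes "angle_lipschitz g"
  shows "continuous_on (sphere 0 1) g"
  unfolding continuous_on_iff
proof (intro ballI allI impI)
  fix x :: 'a and e :: real assume x: "x \<in> sphere 0 1" and "0 < e"
  \<comment> \<open>Capped at \<open>pi\<close>, up to which \<open>cos\<close> is
    decreasing.\<close>
  define e' where "e' = min e pi"
  have e': "0 < e'" "e' \<le> pi" "e' \<le> e" using \<open>0 < e\<close> by (auto simp: e'_def)
  define d where "d = sqrt (2 * (1 - cos e'))"
  have d: "0 < d" using one_minus_cos_pos[OF e'(1,2)] by (simp add: d_def)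
  have "dist (g y) (g x) < e" if y: "y \<in> sphere 0 1" and "dist y x < d" for y
  proof -
    have "(dist y x)\<^sup>2 < d\<^sup>2" using that by (intro power_strict_mono) auto
    also have "d\<^sup>2 = 2 * (1 - cos e')" using one_minus_cos_pos[OF e'(1,2)] by (simp add: d_def)
    finally have "arccos (y \<bullet> x) < e'" by (rule arccos_inner_less[OF e'(1,2) y x])
    then show ?thesis
      using angle_lipschitzD(1)[OF assms y x] e' by (simp add: dist_real_def)
  qed
  then show "\<exists>d>0. \<forall>y\<in>sphere 0 1. dist y x < d \<longrightarrow> dist (g y) (g x) < e" using d by blast
qed

lemma sphere_finite_net:
  assumes e: "0 < e" "e \<le> pi"
  obtains Y :: "'a::euclidean_space set" where "finite Y" "Y \<noteq> {}" "Y \<subseteq> sphere 0 1"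
    "\<And>x. x \<in> sphere 0 1 \<Longrightarrow> \<exists>y\<in>Y. arccos (x \<bullet> y) < e"
proof -
  define d where "d = sqrt (2 * (1 - cos e))"
  have d: "0 < d" using one_minus_cos_pos[OF e] by (simp add: d_def)
  obtain Y where Y: "Y \<subseteq> sphere (0::'a) 1" "finite Y" "sphere 0 1 \<subseteq> (\<Union>y\<in>Y. ball y d)"
  proof (rule compactE_image[of "sphere (0::'a) 1" "sphere 0 1" "\<lambda>y. ball y d"])
    show "sphere (0::'a) 1 \<subseteq> (\<Union>y\<in>sphere 0 1. ball y d)" using d by force
  qed auto
  have near: "\<exists>y\<in>Y. arccos (x \<bullet> y) < e" if x: "x \<in> sphere 0 1" for x :: 'a
  proof -
    obtain y where y: "y \<in> Y" "dist y x < d" using Y(3) x by (auto simp: subset_iff)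
    have "(dist x y)\<^sup>2 < d\<^sup>2" using y by (intro power_strict_mono) (auto simp: dist_commute)
    also have "d\<^sup>2 = 2 * (1 - cos e)" using one_minus_cos_pos[OF e] by (simp add: d_def)
    finally have "arccos (x \<bullet> y) < e" using y(1) Y(1) x by (intro arccos_inner_less[OF e]) auto
    then show ?thesis using y by blast
  qed
  moreover have "sphere (0::'a) 1 \<noteq> {}" by simp
  ultimately have "Y \<noteq> {}" by blast
  then show ?thesis using that[OF Y(2) _ Y(1) near] by blast
qed

section \<open>Smooth approximation of Lipschitz functions\<close>

text \<open>By uniform continuity of \<open>arccos\<close> on \<open>{-1..1}\<close>, as
  \<open>s * c\<close> is within \<open>1 - s\<close> of \<open>c\<close>.\<close>

lemma arccos_scale_approx:
  assumes "0 < e"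
  obtains s where "0 < s" "s < 1" "\<And>c. -1 \<le> c \<Longrightarrow> c \<le> 1 \<Longrightarrow> \<bar>arccos (s * c) - arccos c\<bar> \<le> e"
proof -
  have "uniformly_continuous_on {-1..1} arccos"
    by (intro compact_uniformly_continuous continuous_on_arccos') auto
  then obtain d where d: "d > 0" "\<And>a b. \<lbrakk>a \<in> {-1..1}; b \<in> {-1..1}; dist b a < d\<rbrakk> \<Longrightarrow> dist (arccos b) (arccos a) < e"
    unfolding uniformly_continuous_on_def using assms by meson
  define s where "s = 1 - min (d / 2) (1 / 2)"
  have s: "0 < s" "s < 1" "1 - s < d" using d(1) by (auto simp: s_def)
  have "\<bar>arccos (s * c) - arccos c\<bar> \<le> e" if c: "-1 \<le> c" "c \<le> 1" for c
  proof -
    have ac: "\<bar>c\<bar> \<le> 1" using c by auto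
    have "\<bar>s * c\<bar> \<le> 1 * 1" unfolding abs_mult using s ac by (intro mult_mono) auto
    moreover have "s * c - c = - ((1 - s) * c)" by (simp add: algebra_simps)
    then have "dist (s * c) c = (1 - s) * \<bar>c\<bar>" using s by (simp add: dist_real_def abs_mult)
    then have "dist (s * c) c \<le> (1 - s) * 1" using ac s by (simp add: mult_left_le)
    ultimately have "dist (arccos (s * c)) (arccos c) < e"
      using s c by (intro d(2)) auto
    then show ?thesis by (simp add: dist_real_def)
  qed
  then show ?thesis using that s by blast
qed

text \<open>As \<open>arccos\<close> is not differentiable at \<open>1\<close> and \<open>- 1\<close>, the cosine is scaled by \<open>s < 1\<close>; this does
  not increase the gradient.\<close>

definition soft_angle :: "real \<Rightarrow> 'a::euclidean_space \<Rightarrow> 'a \<Rightarrow> real" where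
  "soft_angle s y x = arccos (s * (x \<bullet> y / norm x))"

text \<open>The vector factor is the part of \<open>y\<close> orthogonal to \<open>x\<close>: the
  angle does not change along a ray from the origin.\<close>

definition soft_angle_grad :: "real \<Rightarrow> 'a::euclidean_space \<Rightarrow> 'a \<Rightarrow> 'a" where
  "soft_angle_grad s y x = - (s / sqrt (1 - (s * (x \<bullet> y / norm x))\<^sup>2) / norm x) *\<^sub>R
     (y - (x \<bullet> y / (norm x)\<^sup>2) *\<^sub>R x)"

lemma scaled_cos_bound:
  fixes x y :: "'a::euclidean_space"
  assumes s: "0 < s" "s < 1" and y: "norm y = 1"
  shows "\<bar>s * (x \<bullet> y / norm x)\<bar> < 1"
proof -
  have "\<bar>x \<bullet> y / norm x\<bar> \<le> 1"
    using Cauchy_Schwarz_ineq2[of x y] y by (cases "x = 0") (auto simp: field_simps)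
  then have "s * \<bar>x \<bullet> y / norm x\<bar> \<le> s * 1" using s by (intro mult_left_mono) auto
  moreover have "\<bar>s * (x \<bullet> y / norm x)\<bar> = s * \<bar>x \<bullet> y / norm x\<bar>"
    unfolding abs_mult[of s] using s by (simp only: abs_of_pos)
  ultimately have "\<bar>s * (x \<bullet> y / norm x)\<bar> \<le> s" by (simp only: mult_1_right)
  then show ?thesis using s(2) by (rule le_less_trans)
qed

lemma soft_angle_has_derivative:
  fixes x y :: "'a::euclidean_space"
  assumes s: "0 < s" "s < 1" and y: "norm y = 1" and x: "x \<noteq> 0"
  shows "(soft_angle s y has_derivative (\<lambda>h. soft_angle_grad s y x \<bullet> h)) (at x)"
proof -
  have b: "-1 < s * (x \<bullet> y / norm x)" "s * (x \<bullet> y / norm x) < 1"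
    using scaled_cos_bound[OF s y, of x] by linarith+
  have nz: "norm x \<noteq> 0" using x by simp
  have c: "((\<lambda>x. s * (x \<bullet> y / norm x)) has_derivative
      (\<lambda>h. s / norm x * ((y - (x \<bullet> y / (norm x)\<^sup>2) *\<^sub>R x) \<bullet> h))) (at x)"
    using nz
    by (auto intro!: derivative_eq_intros GDERIV_norm[OF x, unfolded gderiv_def] simp: fun_eq_iff inner_diff inner_commute sgn_div_norm
        power2_eq_square field_simps)
  from has_derivative_compose[OF c DERIV_arccos[OF b, unfolded has_field_derivative_def]]
  show ?thesis
    unfolding soft_angle_def[abs_def]
    by (rule has_derivative_eq_rhs)
       (simp add: fun_eq_iff soft_angle_grad_def inverse_eq_divide inner_diff_left)
qed

text \<open>With \<open>c\<close> the cosine of the angle, the part of \<open>y\<close> orthogonal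
  to \<open>x\<close> has length \<open>sqrt (1 - c\<^sup>2)\<close>, and
  \<open>s * sqrt (1 - c\<^sup>2)\<close> is at most \<open>sqrt (1 - (s * c)\<^sup>2)\<close> since
  \<open>s < 1\<close>.\<close>

lemma norm_soft_angle_grad:
  fixes x y :: "'a::euclidean_space"
  assumes s: "0 < s" "s < 1" and y: "norm y = 1" and x: "x \<noteq> 0"
  shows "norm (soft_angle_grad s y x) \<le> 1 / norm x"
proof -
  define c where "c = x \<bullet> y / norm x"
  have nz: "norm x > 0" using x by simp
  have sc: "(s * c)\<^sup>2 < 1"
    using scaled_cos_bound[OF s y, of x] by (simp add: c_def abs_square_less_1)
  have "(norm (y - (x \<bullet> y / (norm x)\<^sup>2) *\<^sub>R x))\<^sup>2 = 1 - c\<^sup>2"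
  proof -
    define a where "a = x \<bullet> y / (norm x)\<^sup>2"
    have "(norm (y - a *\<^sub>R x))\<^sup>2 = (norm y)\<^sup>2 - 2 * a * (x \<bullet> y) + a\<^sup>2 * (norm x)\<^sup>2"
      unfolding power2_norm_eq_inner by (simp add: inner_diff inner_commute algebra_simps power2_eq_square)
    also have "\<dots> = 1 - c\<^sup>2" using nz y by (simp add: a_def c_def field_simps power2_eq_square)
    finally show ?thesis by (simp only: a_def)
  qed
  then have n: "norm (y - (x \<bullet> y / (norm x)\<^sup>2) *\<^sub>R x) = sqrt (1 - c\<^sup>2)"
    by (metis norm_ge_zero real_sqrt_unique)
  have c1: "c\<^sup>2 \<le> 1"
    using \<open>(norm _)\<^sup>2 = 1 - c\<^sup>2\<close> by (metis diff_ge_0_iff_ge zero_le_power2)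
  have "s * sqrt (1 - c\<^sup>2) = sqrt (s\<^sup>2 * (1 - c\<^sup>2))" using s by (simp add: real_sqrt_mult)
  also have "\<dots> \<le> sqrt (1 - (s * c)\<^sup>2)"
    using s power_le_one[of s 2] by (simp add: power_mult_distrib algebra_simps)
  finally have "s * sqrt (1 - c\<^sup>2) / sqrt (1 - (s * c)\<^sup>2) \<le> 1" using sc by simp
  then have "s * sqrt (1 - c\<^sup>2) / sqrt (1 - (s * c)\<^sup>2) / norm x \<le> 1 / norm x"
    using nz by (intro divide_right_mono) auto
  moreover have "0 \<le> 1 - (s * c)\<^sup>2" using sc by simp
  ultimately show ?thesis
    unfolding soft_angle_grad_def c_def[symmetric] norm_scaleR n
    using s nz by (simp add: abs_mult mult.commute)
qed

lemma continuous_on_soft_angle: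
  fixes y :: "'a::euclidean_space"
  assumes s: "0 < s" "s < 1" and y: "norm y = 1"
  shows "continuous_on (- {0}) (soft_angle s y)" "continuous_on (- {0}) (soft_angle_grad s y)"
proof -
  have b: "-1 \<le> s * (x \<bullet> y / norm x)" "s * (x \<bullet> y / norm x) \<le> 1" "1 - (s * (x \<bullet> y / norm x))\<^sup>2 \<noteq> 0" for x
  proof -
    have "\<bar>s * (x \<bullet> y / norm x)\<bar> < 1" by (rule scaled_cos_bound[OF s y])
    then show "-1 \<le> s * (x \<bullet> y / norm x)" "s * (x \<bullet> y / norm x) \<le> 1" by linarith+
    show "1 - (s * (x \<bullet> y / norm x))\<^sup>2 \<noteq> 0"
      using \<open>\<bar>s * (x \<bullet> y / norm x)\<bar> < 1\<close>[folded abs_square_less_1] by linarith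
  qed
  show "continuous_on (- {0}) (soft_angle s y)"
    unfolding soft_angle_def[abs_def] using b by (intro continuous_intros) auto
  show "continuous_on (- {0}) (soft_angle_grad s y)"
    unfolding soft_angle_grad_def[abs_def] using b by (intro continuous_intros) auto
qed

text \<open>On a finite net, \<open>g\<close> is close to the minimum of the cones \<open>g y + angle x y\<close>. The gradient of the
  soft minimum \<open>- ln (\<Sum>y. exp (- \<beta> * u y)) / \<beta>\<close> is a convex combination of the gradients of the \<open>u y\<close>,
  so that it obeys the same bound.\<close>

lemma smooth_approx_angle_lipschitz:
  fixes g :: "'a::euclidean_space \<Rightarrow> real"
  assumes g: "angle_lipschitz g" and e: "e > 0"
  obtains F :: "'a \<Rightarrow> real" and G :: "'a \<Rightarrow> 'a" where
    "\<And>x. x \<noteq> 0 \<Longrightarrow> (F has_derivative (\<lambda>h. G x \<bullet> h)) (at x)"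
    "continuous_on (- {0}) G"
    "\<And>x. x \<noteq> 0 \<Longrightarrow> norm (G x) \<le> 1 / norm x"
    "\<And>x. x \<noteq> 0 \<Longrightarrow> \<bar>F x - g (sgn x)\<bar> \<le> e"
proof -
  \<comment> \<open>The upper bound costs \<open>3 * h\<close>: twice the angle to the net point,
    for \<open>g\<close> and for the cone, and once the scaling of the cosine. The lower bound costs
    \<open>2 * h\<close>, for the scaling and for the soft minimum.\<close>
  define h where "h = min (e / 3) pi"
  have h: "0 < h" "h \<le> pi" "3 * h \<le> e" using e by (auto simp: h_def)
  obtain Y :: "'a set" where Y: "finite Y" "Y \<noteq> {}" "Y \<subseteq> sphere 0 1"
    and near: "\<And>x. x \<in> sphere 0 1 \<Longrightarrow> \<exists>y\<in>Y. arccos (x \<bullet> y) < h"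
    using sphere_finite_net[OF h(1,2)] by metis
  obtain s where s: "0 < s" "s < 1" and sa: "\<And>c. -1 \<le> c \<Longrightarrow> c \<le> 1 \<Longrightarrow> \<bar>arccos (s * c) - arccos c\<bar> \<le> h"
    using arccos_scale_approx[OF h(1)] by metis
  define N where "N = real (card Y)"
  have N: "N \<ge> 1" using Y by (simp add: N_def Suc_le_eq card_gt_0_iff)
  \<comment> \<open>A soft minimum of \<open>N\<close> terms lies below the minimum by at most
    \<open>ln N / \<beta>\<close>; adding 1 keeps \<open>\<beta>\<close> positive when
    \<open>N = 1\<close>.\<close>
  define \<beta> where "\<beta> = (ln N + 1) / h"
  have \<beta>: "\<beta> > 0" "ln N / \<beta> \<le> h" 
  proof -
    have L: "0 \<le> ln N" by (rule ln_ge_zero[OF N])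
    then show "\<beta> > 0" using h by (simp add: \<beta>_def add_nonneg_pos)
    have "h * ln N / (ln N + 1) \<le> h"
      using L h by (subst pos_divide_le_eq) (auto simp: algebra_simps)
    then show "ln N / \<beta> \<le> h" by (simp add: \<beta>_def mult.commute)
  qed
  define u where "u y x = g y + soft_angle s y x" for y x
  define E where "E y x = exp (- \<beta> * u y x)" for y x
  define S where "S x = (\<Sum>y\<in>Y. E y x)" for x
  have Epos: "E y x > 0" for y x by (simp add: E_def)
  have Spos: "S x > 0" for x unfolding S_def using Y Epos by (intro sum_pos) auto
  define F where "F x = - (1 / \<beta>) * ln (S x)" for x
  define G where "G x = (\<Sum>y\<in>Y. (E y x / S x) *\<^sub>R soft_angle_grad s y x)" for x
  have ny: "norm y = 1" if "y \<in> Y" for y using Y(3) that by auto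
  have 1: "(F has_derivative (\<lambda>h. G x \<bullet> h)) (at x)" if x: "x \<noteq> 0" for x
  proof -
    have dE: "(E y has_derivative (\<lambda>h. E y x * (- \<beta> * (soft_angle_grad s y x \<bullet> h)))) (at x)" if "y \<in> Y" for y
      unfolding E_def[abs_def] u_def
      by (rule derivative_eq_intros soft_angle_has_derivative[OF s ny[OF that] x] refl | simp add: mult_ac)+
    have dS: "(S has_derivative (\<lambda>h. \<Sum>y\<in>Y. E y x * (- \<beta> * (soft_angle_grad s y x \<bullet> h)))) (at x)"
      unfolding S_def[abs_def] by (rule has_derivative_sum) (rule dE)
    have "(F has_derivative (\<lambda>h. - (1 / \<beta>) * ((\<Sum>y\<in>Y. E y x * (- \<beta> * (soft_angle_grad s y x \<bullet> h))) * inverse (S x)))) (at x)"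
      unfolding F_def[abs_def] using has_derivative_ln[OF Spos[of x] dS] 
      by (rule has_derivative_mult_right)
    then show ?thesis
      by (rule has_derivative_eq_rhs)
         (use \<beta> in \<open>auto simp: fun_eq_iff G_def inner_sum_left sum_distrib_left sum_distrib_right field_simps intro!: sum.cong\<close>)
  qed
  have cE: "continuous_on (- {0}) (E y)" if "y \<in> Y" for y
    unfolding E_def[abs_def] u_def using continuous_on_soft_angle[OF s ny[OF that]] by (intro continuous_intros) auto
  have 2: "continuous_on (- {0}) G"
    unfolding G_def[abs_def] S_def
    using cE continuous_on_soft_angle[OF s ny] Spos[unfolded S_def] less_imp_neq
    by (intro continuous_intros) (auto simp: less_imp_neq[symmetric])
  have 3: "norm (G x) \<le> 1 / norm x" if x: "x \<noteq> 0" for x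
  proof -
    have "norm (G x) \<le> (\<Sum>y\<in>Y. (E y x / S x) * (1 / norm x))"
      unfolding G_def
    proof (rule sum_norm_le)
      fix y assume y: "y \<in> Y"
      show "norm ((E y x / S x) *\<^sub>R soft_angle_grad s y x) \<le> (E y x / S x) * (1 / norm x)"
      proof -
        have "\<bar>E y x / S x\<bar> = E y x / S x" using Epos[of y x] Spos[of x] by simp
        moreover have "E y x / S x * norm (soft_angle_grad s y x) \<le> E y x / S x * (1 / norm x)"
          using Epos[of y x] Spos[of x] by (intro mult_left_mono norm_soft_angle_grad[OF s ny[OF y] x]) simp
        ultimately show ?thesis by (simp only: norm_scaleR)
      qed
    qed
    also have "\<dots> = 1 / norm x"
      using Spos[of x] by (simp add: S_def flip: sum_distrib_right sum_divide_distrib)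
    finally show ?thesis .
  qed
  have 4: "\<bar>F x - g (sgn x)\<bar> \<le> e" if x: "x \<noteq> 0" for x
  proof -
    have sx: "sgn x \<in> sphere 0 1" using x by (simp add: norm_sgn)
    have ip: "x \<bullet> y / norm x = sgn x \<bullet> y" for y by (simp add: sgn_div_norm divide_inverse)
    have su: "\<bar>soft_angle s y x - arccos (sgn x \<bullet> y)\<bar> \<le> h" if "y \<in> Y" for y
      unfolding soft_angle_def ip
      using inner_sphere_bounds[OF sx, of y] Y(3) that by (intro sa) auto
    obtain y where y: "y \<in> Y" "arccos (sgn x \<bullet> y) < h" using near[OF sx] by blast
    have "E y x \<le> S x" unfolding S_def using y Y Epos by (intro member_le_sum) (auto intro: less_imp_le)
    then have "ln (E y x) \<le> ln (S x)" using Epos[of y x] by simp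
    then have "- \<beta> * u y x \<le> ln (S x)" by (simp add: E_def)
    then have "F x \<le> u y x" using \<beta> by (simp add: F_def field_simps)
    also have "\<dots> \<le> g (sgn x) + 3 * h"
      using su[OF y(1)] y angle_lipschitzD(1)[OF g sx, of y] Y(3) unfolding u_def abs_le_iff
      by (smt (verit) subsetD)
    finally have up: "F x \<le> g (sgn x) + 3 * h" .
    \<comment> \<open>The Lipschitz condition puts each exact cone above \<open>g\<close>; only the
      scaling is lost.\<close>
    have "u z x \<ge> g (sgn x) - h" if z: "z \<in> Y" for z
      using su[OF z] angle_lipschitzD(1)[OF g sx, of z] Y(3) z unfolding u_def abs_le_iff
      by (smt (verit) subsetD)
    then have "E z x \<le> exp (- \<beta> * (g (sgn x) - h))" if "z \<in> Y" for z
      using \<beta> that by (simp add: E_def)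
    then have "S x \<le> N * exp (- \<beta> * (g (sgn x) - h))"
      unfolding S_def N_def by (rule sum_bounded_above)
    then have "ln (S x) \<le> ln (N * exp (- \<beta> * (g (sgn x) - h)))"
      using Spos[of x] by (subst ln_le_cancel_iff) (use N in auto)
    also have "\<dots> = ln N - \<beta> * (g (sgn x) - h)" using N by (simp add: ln_mult)
    finally have "ln (S x) / \<beta> \<le> (ln N - \<beta> * (g (sgn x) - h)) / \<beta>"
      using \<beta> by (intro divide_right_mono) auto
    also have "\<dots> = ln N / \<beta> - (g (sgn x) - h)" using \<beta> by (simp add: field_simps)
    also have "\<dots> \<le> - g (sgn x) + 2 * h" using \<beta> by simp
    finally have "F x \<ge> g (sgn x) - 2 * h" by (simp add: F_def)
    then show ?thesis using up h by (simp add: abs_le_iff)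
  qed
  show ?thesis using that 1 2 3 4 by blast
qed

section \<open>The Gaussian variance bound for Lipschitz functions\<close>

lemma AE_gauss_vec_nonzero: "AE x in (gauss_vec :: 'a::euclidean_space measure). x \<noteq> 0"
proof -
  have "emeasure (gauss_vec :: 'a measure) {0} = 0"
    unfolding gauss_vec_density by (subst emeasure_density) (auto simp: nn_integral_0_iff_AE intro!: AE_mp[OF AE_lborel_singleton[of 0]])
  then show ?thesis by (intro AE_I[where N = "{0}"]) auto
qed

text \<open>\<open>sgn 0 = 0\<close> lies off the sphere, where nothing is known about
  \<open>g\<close>; the value at the origin, a null set for \<open>gauss_vec\<close>, is therefore
  fixed to be 0.\<close>

lemma borel_measurable_sphere_extend:
  fixes g :: "'a::euclidean_space \<Rightarrow> real"
  assumes "continuous_on (sphere 0 1) g"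
  shows "(\<lambda>x. if x = 0 then 0 else g (sgn x)) \<in> borel_measurable borel"
proof -
  have "continuous_on (- {0}) (\<lambda>x. g (sgn x))"
    by (rule continuous_on_compose2[OF assms])
       (auto intro!: continuous_intros simp: norm_sgn split: if_splits)
  then have "(\<lambda>x. indicator (- {0}) x *\<^sub>R g (sgn x)) \<in> borel_measurable borel"
    by (intro borel_measurable_continuous_on_indicator) auto
  moreover have "(\<lambda>x. indicator (- {0}) x *\<^sub>R g (sgn x)) = (\<lambda>x. if x = 0 then 0 else g (sgn x))"
    by (auto simp: fun_eq_iff indicator_def)
  ultimately show ?thesis by simp
qed

text \<open>Factoring \<open>a\<^sup>2 - b\<^sup>2\<close> gives an error of
  \<open>2 * B * e\<close> for the second moment and another one for the squared mean.\<close>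

lemma (in prob_space) vari_approx:
  fixes f h :: "'a \<Rightarrow> real"
  assumes f: "f \<in> borel_measurable M" "\<And>x. x \<in> space M \<Longrightarrow> \<bar>f x\<bar> \<le> B"
    and h: "h \<in> borel_measurable M" "\<And>x. x \<in> space M \<Longrightarrow> \<bar>h x\<bar> \<le> B"
    and e: "\<And>x. x \<in> space M \<Longrightarrow> \<bar>f x - h x\<bar> \<le> e"
  shows "\<bar>vari M f - vari M h\<bar> \<le> 4 * B * e"
proof -
  obtain x where x: "x \<in> space M" using not_empty by blast
  have B: "0 \<le> B" using f(2)[OF x] by linarith
  have e0: "0 \<le> e" using e[OF x] by linarith
  note [measurable] = f(1) h(1)
  have sq: "\<bar>a\<^sup>2 - b\<^sup>2\<bar> \<le> 2 * B * e" if "\<bar>a\<bar> \<le> B" "\<bar>b\<bar> \<le> B" "\<bar>a - b\<bar> \<le> e" for a b :: real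
  proof -
    have "\<bar>a\<^sup>2 - b\<^sup>2\<bar> = \<bar>a + b\<bar> * \<bar>a - b\<bar>" by (simp add: power2_eq_square algebra_simps flip: abs_mult)
    also have "\<dots> \<le> (2 * B) * e" using that B by (intro mult_mono) auto
    finally show ?thesis .
  qed
  have i: "integrable M f" "integrable M h"
    using integrable_bounded[OF f] integrable_bounded[OF h] by blast+
  have "\<bar>(f x)\<^sup>2\<bar> \<le> B\<^sup>2" "\<bar>(h x)\<^sup>2\<bar> \<le> B\<^sup>2" if "x \<in> space M" for x
    using power_mono[OF f(2)[OF that], of 2] power_mono[OF h(2)[OF that], of 2] by auto
  then have i2: "integrable M (\<lambda>x. (f x)\<^sup>2)" "integrable M (\<lambda>x. (h x)\<^sup>2)"
    by (auto intro!: integrable_bounded[where B = "B\<^sup>2"])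
  have "\<bar>expectation f - expectation h\<bar> \<le> e"
    unfolding Bochner_Integration.integral_diff[OF i, symmetric] by (rule abs_expectation_le) (use e in auto)
  then have "\<bar>(expectation f)\<^sup>2 - (expectation h)\<^sup>2\<bar> \<le> 2 * B * e"
    by (intro sq abs_expectation_le f h)
  moreover have "\<bar>expectation (\<lambda>x. (f x)\<^sup>2) - expectation (\<lambda>x. (h x)\<^sup>2)\<bar> \<le> 2 * B * e"
    unfolding Bochner_Integration.integral_diff[OF i2, symmetric] by (rule abs_expectation_le) (use f h e in \<open>auto intro!: sq\<close>)
  moreover have "4 * B * e = 2 * (2 * B * e)" by simp
  moreover have "vari M f = expectation (\<lambda>x. (f x)\<^sup>2) - (expectation f)\<^sup>2"
    by (rule vari_bounded_eq[OF f])
  moreover have "vari M h = expectation (\<lambda>x. (h x)\<^sup>2) - (expectation h)\<^sup>2"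
    by (rule vari_bounded_eq[OF h])
  ultimately show ?thesis by (simp only: abs_le_iff) linarith
qed

text \<open>The Poincare inequality is applied to smooth approximants with gradient bound
  \<open>1 / norm x\<close>. Uniform closeness is enough to return to \<open>g\<close>, since the
  inequality has removed the gradients from the final bound.\<close>

lemma gauss_vec_vari_angle_lipschitz:
  fixes g :: "'a::euclidean_space \<Rightarrow> real"
  assumes dim: "3 \<le> DIM('a)" and g: "angle_lipschitz g"
  shows "vari gauss_vec (\<lambda>x. if x = 0 then 0 else g (sgn x)) \<le> 1 / (real DIM('a) - 2)"
proof (rule field_le_epsilon)
  fix r :: real assume r: "r > 0"
  interpret N: prob_space "gauss_vec :: 'a measure" by (rule prob_space_gauss_vec)
  have cg: "continuous_on (sphere 0 1) g" by (rule continuous_on_angle_lipschitz[OF g])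
  then have "bounded (g ` sphere 0 1)" by (intro compact_imp_bounded compact_continuous_image) auto
  then obtain C where "\<forall>x\<in>sphere 0 1. \<bar>g x\<bar> \<le> C" unfolding bounded_iff by auto
  then have C: "\<And>x. x \<in> sphere 0 1 \<Longrightarrow> \<bar>g x\<bar> \<le> C" by blast
  have "sphere (0::'a) 1 \<noteq> {}" by simp
  then obtain x0 :: 'a where "x0 \<in> sphere 0 1" by blast
  then have C0: "0 \<le> C" using C by fastforce
  \<comment> \<open>The cap at 1 keeps the approximant within \<open>C + 1\<close>, and
    \<open>4 * (C + 1) * e\<close> is the resulting error in the variance.\<close>
  define e where "e = min 1 (r / (4 * (C + 1)))"
  have e: "0 < e" "e \<le> 1" "4 * (C + 1) * e \<le> r"
  proof -
    show "0 < e" "e \<le> 1" using r C0 by (auto simp: e_def)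
    have "e \<le> r / (4 * (C + 1))" by (simp add: e_def)
    then show "4 * (C + 1) * e \<le> r" using C0 by (simp add: pos_le_divide_eq mult.commute)
  qed
  define h where "h x = (if x = 0 then 0 else g (sgn x))" for x
  have hm: "h \<in> borel_measurable borel"
    unfolding h_def[abs_def] by (rule borel_measurable_sphere_extend[OF cg])
  have hC: "\<bar>h x\<bar> \<le> C + 1" for x
    using C[of "sgn x"] C0 by (auto simp: h_def norm_sgn)
  obtain F0 :: "'a \<Rightarrow> real" and G0 :: "'a \<Rightarrow> 'a" where
    F0: "\<And>x. x \<noteq> 0 \<Longrightarrow> (F0 has_derivative (\<lambda>h. G0 x \<bullet> h)) (at x)" and
    G0: "continuous_on (- {0}) G0" and
    G0n: "\<And>x. x \<noteq> 0 \<Longrightarrow> norm (G0 x) \<le> 1 / norm x" and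
    F0g: "\<And>x. x \<noteq> 0 \<Longrightarrow> \<bar>F0 x - g (sgn x)\<bar> \<le> e"
    using smooth_approx_angle_lipschitz[OF g e(1)] by metis
  \<comment> \<open>Nothing is known of \<open>F0\<close> and \<open>G0\<close> at the origin; the
    value 0 there makes both Borel measurable on the whole space.\<close>
  define F where "F x = (if x = 0 then 0 else F0 x)" for x
  define G where "G x = (if x = 0 then 0 else G0 x)" for x
  have Fh: "\<bar>F x - h x\<bar> \<le> e" for x using F0g[of x] e by (simp add: F_def h_def)
  have FB: "\<bar>F x\<bar> \<le> C + 1" for x
    using Fh[of x] e C[of "sgn x"] C0 by (cases "x = 0") (auto simp: h_def F_def norm_sgn)
  have dF: "(F has_derivative (\<lambda>h. G x \<bullet> h)) (at x)" if "x \<noteq> 0" for x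
    by (rule has_derivative_transform_within_open[where s = "- {0}" and f = F0])
       (use F0 that in \<open>auto simp: F_def G_def\<close>)
  have cG: "continuous_on (- {0}) G"
    using G0 by (rule continuous_on_cong[THEN iffD1, rotated 2]) (auto simp: G_def)
  have cF: "continuous_on (- {0}) F"
    using dF by (intro has_derivative_continuous_on) (auto intro: has_derivative_at_withinI)
  have Gm: "G \<in> borel_measurable borel"
  proof -
    have "(\<lambda>x. indicator (- {0}) x *\<^sub>R G x) \<in> borel_measurable borel"
      using cG by (intro borel_measurable_continuous_on_indicator) auto
    moreover have "(\<lambda>x. indicator (- {0}) x *\<^sub>R G x) = G" by (auto simp: fun_eq_iff indicator_def G_def)
    ultimately show ?thesis by simp
  qed
  have Fm: "F \<in> borel_measurable borel"
  proof -
    have "(\<lambda>x. indicator (- {0}) x *\<^sub>R F x) \<in> borel_measurable borel"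
      using cF by (intro borel_measurable_continuous_on_indicator) auto
    moreover have "(\<lambda>x. indicator (- {0}) x *\<^sub>R F x) = F" by (auto simp: fun_eq_iff indicator_def F_def)
    ultimately show ?thesis by simp
  qed
  have "ennreal (vari gauss_vec F) \<le> (\<integral>\<^sup>+x. ennreal ((norm (G x))\<^sup>2) \<partial>gauss_vec)"
    by (rule gaussian_poincare[OF _ dF cG Fm Gm FB]) (use dim in auto)
  also have "\<dots> \<le> (\<integral>\<^sup>+x. ennreal (1 / (norm (x::'a))\<^sup>2) \<partial>gauss_vec)"
  proof (intro nn_integral_mono ennreal_leI)
    fix x :: 'a
    show "(norm (G x))\<^sup>2 \<le> 1 / (norm x)\<^sup>2"
      using power_mono[OF G0n, of x 2] by (auto simp: G_def power_divide)
  qed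
  also have "\<dots> \<le> ennreal (1 / (real DIM('a) - 2))" by (rule gauss_vec_inverse_square[OF dim])
  finally have "vari gauss_vec F \<le> 1 / (real DIM('a) - 2)"
    using dim by (subst (asm) ennreal_le_iff) auto
  moreover have "\<bar>vari gauss_vec F - vari gauss_vec h\<bar> \<le> 4 * (C + 1) * e"
    by (rule N.vari_approx) (use Fm hm FB hC Fh in auto)
  ultimately show "vari gauss_vec (\<lambda>x. if x = 0 then 0 else g (sgn x)) \<le> 1 / (real DIM('a) - 2) + r"
    using e(3) unfolding h_def[abs_def] by linarith
qed

section \<open>Invariant measures on the sphere\<close>

text \<open>Both measures give mass \<open>c\<close>, independent of the centre, to caps of radius \<open>d\<close>, and by Fubini it
  is the same \<open>c\<close>. So \<open>c\<close> times each integral of \<open>g\<close> is the integral over the product of \<open>g\<close>, taken in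
  one of the two variables, against the indicator \<open>K\<close> of closeness.\<close>

lemma invariant_integral_eq_gauss:
  fixes \<mu> :: "'a::euclidean_space measure" and g :: "'a \<Rightarrow> real"
  assumes mu: "prob_space \<mu>" "sets \<mu> = sets (restrict_space borel (sphere 0 1))"
    and trans: "\<And>x y. x \<in> sphere 0 1 \<Longrightarrow> y \<in> sphere 0 1 \<Longrightarrow>
      \<exists>T. orthogonal_transformation T \<and> T x = y \<and> distr \<mu> \<mu> T = \<mu>"
    and g: "continuous_on (sphere 0 1) g"
  shows "(\<integral>x. g x \<partial>\<mu>) = (\<integral>x. (if x = 0 then 0 else g (sgn x)) \<partial>gauss_vec)"
proof -
  let ?S = "sphere (0::'a) 1" and ?N = "gauss_vec :: 'a measure"
  interpret M: prob_space \<mu> by fact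
  interpret N: prob_space ?N by (rule prob_space_gauss_vec)
  interpret P: pair_prob_space \<mu> ?N ..
  note [measurable_cong] = mu(2)
  have sp: "space \<mu> = ?S" using sets_eq_imp_space_eq[OF mu(2)] by (simp add: space_restrict_space)
  have idm: "(\<lambda>x. x) \<in> borel_measurable \<mu>"
    by (subst measurable_cong_sets[OF mu(2) refl]) (rule measurable_restrict_space1, simp)
  note [measurable] = idm
  have gm[measurable]: "g \<in> borel_measurable \<mu>"
    by (subst measurable_cong_sets[OF mu(2) refl]) (rule borel_measurable_continuous_on_restrict[OF g])
  define h where "h x = (if x = 0 then 0 else g (sgn x))" for x
  have hm[measurable]: "h \<in> borel_measurable borel"
    unfolding h_def[abs_def] by (rule borel_measurable_sphere_extend[OF g])
  have "bounded (g ` ?S)" using g by (intro compact_imp_bounded compact_continuous_image) auto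
  then obtain C where "\<forall>x\<in>?S. \<bar>g x\<bar> \<le> C" unfolding bounded_iff by auto
  then have C: "\<bar>g x\<bar> \<le> C" if "x \<in> ?S" for x using that by blast
  obtain e0 where e0: "e0 \<in> ?S" using M.not_empty unfolding sp by blast
  have C0: "0 \<le> C" using C[OF e0] by linarith
  have sgS: "sgn x \<in> ?S" if "x \<noteq> 0" for x :: 'a using that by (simp add: norm_sgn)
  have hC: "\<bar>h x\<bar> \<le> C" for x using C[OF sgS] C0 by (simp add: h_def)
  have close: "\<bar>(\<integral>x. g x \<partial>\<mu>) - (\<integral>x. h x \<partial>?N)\<bar> \<le> e" if e: "e > 0" for e
  proof -
    have "uniformly_continuous_on ?S g" using g by (intro compact_uniformly_continuous) auto
    then obtain d0 where d0: "d0 > 0" "\<And>x y. \<lbrakk>x \<in> ?S; y \<in> ?S; dist y x < d0\<rbrakk> \<Longrightarrow> dist (g y) (g x) < e"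
      unfolding uniformly_continuous_on_def using e by meson
    \<comment> \<open>Capped at 1, the distance from the sphere to \<open>sgn 0 = 0\<close>, so that
      \<open>K\<close> vanishes for \<open>y = 0\<close>.\<close>
    define d where "d = min d0 1"
    have d: "0 < d" "d \<le> 1" "d \<le> d0" using d0(1) by (auto simp: d_def)
    define K where "K x y = (if dist x (sgn y) < d then 1 else 0 :: real)" for x y :: 'a
    have sgnm[measurable]: "(sgn :: 'a \<Rightarrow> 'a) \<in> borel_measurable borel"
      unfolding sgn_div_norm[abs_def] by measurable
    have Km[measurable]: "(\<lambda>(x, y). K x y) \<in> borel_measurable (\<mu> \<Otimes>\<^sub>M ?N)"
      unfolding K_def by measurable
    have KN: "K x \<in> borel_measurable ?N" "K x \<in> borel_measurable borel" for x
    proof -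
      show "K x \<in> borel_measurable borel" unfolding K_def[abs_def] by measurable
      then show "K x \<in> borel_measurable ?N" by (simp add: measurable_cong_sets[OF sets_gauss_vec refl])
    qed
    have K01: "0 \<le> K x y" "K x y \<le> 1" for x y by (auto simp: K_def)
    have K0: "K x y = 0" if "x \<in> ?S" "y = 0" for x y using that d(2) by (auto simp: K_def)
    have Ki: "integrable (\<mu> \<Otimes>\<^sub>M ?N) (\<lambda>(x, y). K x y * f x y)"
      if "(\<lambda>(x, y). f x y) \<in> borel_measurable (\<mu> \<Otimes>\<^sub>M ?N)" "\<And>x y. x \<in> ?S \<Longrightarrow> \<bar>f x y\<bar> \<le> D" for f D
    proof (rule P.P.integrable_bounded[where B = D])
      show "(\<lambda>(x, y). K x y * f x y) \<in> borel_measurable (\<mu> \<Otimes>\<^sub>M ?N)"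
        using borel_measurable_times[OF Km that(1)] by (simp add: case_prod_beta')
      fix z assume "z \<in> space (\<mu> \<Otimes>\<^sub>M ?N)"
      then have "fst z \<in> ?S" by (auto simp: space_pair_measure sp)
      then have "\<bar>K (fst z) (snd z)\<bar> * \<bar>f (fst z) (snd z)\<bar> \<le> 1 * D"
        using that(2) K01 by (intro mult_mono) (auto simp: abs_le_iff intro: order_trans[OF _ K01(1)])
      then show "\<bar>case z of (x, y) \<Rightarrow> K x y * f x y\<bar> \<le> D" by (simp add: case_prod_beta abs_mult)
    qed
    define c where "c = (\<integral>y. K e0 y \<partial>?N)"
    have c1: "(\<integral>y. K x y \<partial>?N) = c" if x: "x \<in> ?S" for x
    proof -
      obtain T where T: "orthogonal_transformation T" "T e0 = x" using trans[OF e0 x] by blast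
      have lT: "linear T" using T by (simp add: orthogonal_transformation_linear)
      then have [measurable]: "T \<in> borel_measurable borel"
        by (simp add: borel_measurable_continuous_onI linear_continuous_on linear_conv_bounded_linear)
      have "(\<integral>y. K x y \<partial>?N) = (\<integral>y. K x y \<partial>distr ?N borel T)"
        by (simp only: gauss_vec_orthogonal_invariant[OF T(1)])
      also have "\<dots> = (\<integral>y. K x (T y) \<partial>?N)"
      proof (rule integral_distr)
        show "T \<in> measurable ?N borel" by (simp add: measurable_cong_sets[OF sets_gauss_vec refl])
      qed (rule KN(2))
      also have "\<dots> = (\<integral>y. K e0 y \<partial>?N)"
      proof (rule Bochner_Integration.integral_cong[OF refl])
        fix y
        have "x - sgn (T y) = T (e0 - sgn y)"
          using T(2) orthogonal_transformation_norm[OF T(1), of y]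
          by (simp add: linear_diff[OF lT] sgn_div_norm linear_cmul[OF lT])
        then have "dist x (sgn (T y)) = dist e0 (sgn y)"
          by (simp add: dist_norm orthogonal_transformation_norm[OF T(1)])
        then show "K x (T y) = K e0 y" by (simp add: K_def)
      qed
      finally show ?thesis by (simp add: c_def)
    qed
    define c' where "c' y = (\<integral>x. K x y \<partial>\<mu>)" for y
    have c2: "c' y = c' e0" if y: "y \<noteq> 0" for y
    proof -
      obtain T where T: "orthogonal_transformation T" "T e0 = sgn y" "distr \<mu> \<mu> T = \<mu>"
        using trans[OF e0 sgS[OF y]] by blast
      have lT: "linear T" using T by (simp add: orthogonal_transformation_linear)
      then have Tm[measurable]: "T \<in> borel_measurable borel"
        by (simp add: borel_measurable_continuous_onI linear_continuous_on linear_conv_bounded_linear)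
      have TM: "T \<in> measurable \<mu> \<mu>"
      proof (subst measurable_cong_sets[OF refl mu(2)], rule measurable_restrict_space2)
        show "T \<in> space \<mu> \<rightarrow> ?S" using orthogonal_transformation_norm[OF T(1)] by (auto simp: sp)
        show "T \<in> measurable \<mu> borel" by (rule measurable_compose[OF idm Tm])
      qed
      have "c' y = (\<integral>x. K x y \<partial>distr \<mu> \<mu> T)" by (simp only: c'_def T(3))
      also have "\<dots> = (\<integral>x. K (T x) y \<partial>\<mu>)"
        by (rule integral_distr[OF TM]) (unfold K_def, measurable)
      also have "\<dots> = (\<integral>x. K x e0 \<partial>\<mu>)"
      proof (rule Bochner_Integration.integral_cong[OF refl])
        fix x
        have "sgn e0 = e0" using e0 by (simp add: sgn_div_norm)
        then have "T x - sgn y = T (x - sgn e0)" using T(2) by (simp add: linear_diff[OF lT])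
        then have "dist (T x) (sgn y) = dist x (sgn e0)"
          by (simp add: dist_norm orthogonal_transformation_norm[OF T(1)])
        then show "K (T x) y = K x e0" by (simp add: K_def)
      qed
      finally show ?thesis by (simp add: c'_def)
    qed
    have fub: "(\<integral>x. \<integral>y. K x y * f x y \<partial>?N \<partial>\<mu>) = (\<integral>y. \<integral>x. K x y * f x y \<partial>\<mu> \<partial>?N)"
      if "(\<lambda>(x, y). f x y) \<in> borel_measurable (\<mu> \<Otimes>\<^sub>M ?N)" "\<And>x y. x \<in> ?S \<Longrightarrow> \<bar>f x y\<bar> \<le> D" for f D
      by (rule P.Fubini_integral[symmetric]) (use Ki[OF that] in simp)
    have AEc': "AE y in ?N. c' y = c' e0"
      by (rule AE_mp[OF AE_gauss_vec_nonzero]) (simp add: c2)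
    have c'm[measurable]: "c' \<in> borel_measurable ?N"
      unfolding c'_def[abs_def] using Km by measurable
    have cc: "c' e0 = c"
    proof -
      have "c = (\<integral>x. c \<partial>\<mu>)" by (simp add: M.prob_space)
      also have "\<dots> = (\<integral>x. \<integral>y. K x y * 1 \<partial>?N \<partial>\<mu>)"
        by (rule Bochner_Integration.integral_cong) (auto simp: c1 sp)
      also have "\<dots> = (\<integral>y. \<integral>x. K x y * 1 \<partial>\<mu> \<partial>?N)" by (rule fub[of "\<lambda>_ _. 1" 1]) auto
      also have "\<dots> = (\<integral>y. c' y \<partial>?N)" by (simp add: c'_def)
      also have "\<dots> = (\<integral>y. c' e0 \<partial>?N)" by (rule integral_cong_AE) (use AEc' in auto)
      also have "\<dots> = c' e0" using N.prob_space by simp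
      finally show ?thesis by simp
    qed
    \<comment> \<open>If caps of radius \<open>d\<close> were null, finitely many of them, covering
      the sphere, would make the whole space null.\<close>
    have cpos: "c > 0"
    proof (rule ccontr)
      assume "\<not> c > 0"
      moreover have "c \<ge> 0" unfolding c_def by (rule integral_nonneg_AE) (simp add: K01)
      ultimately have c0: "c = 0" by simp
      have null: "AE y in ?N. \<not> dist x (sgn y) < d" if x: "x \<in> ?S" for x
      proof -
        have "integrable ?N (K x)"
          by (rule N.integrable_bounded[OF KN(1), of _ 1]) (simp add: K01)
        then have "(\<integral>y. K x y \<partial>?N) = 0 \<longleftrightarrow> (AE y in ?N. K x y = 0)"
          by (rule integral_nonneg_eq_0_iff_AE) (simp add: K01)
        then have "AE y in ?N. K x y = 0" using c1[OF x] c0 by simp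
        then show ?thesis by eventually_elim (auto simp: K_def split: if_splits)
      qed
      obtain Y where Y: "Y \<subseteq> ?S" "finite Y" "?S \<subseteq> (\<Union>y\<in>Y. ball y d)"
      proof (rule compactE_image[of ?S ?S "\<lambda>y. ball y d"])
        show "?S \<subseteq> (\<Union>y\<in>?S. ball y d)" using d by force
      qed auto
      have "AE y in ?N. \<forall>x\<in>Y. \<not> dist x (sgn y) < d"
        using Y null by (intro AE_finite_allI) auto
      with AE_gauss_vec_nonzero have "AE y in ?N. False"
      proof eventually_elim
        case (elim y)
        then show ?case using Y(3) sgS[of y] by (auto simp: subset_iff)
      qed
      then show False by simp
    qed
    \<comment> \<open>\<open>K\<close> is nonzero only when \<open>x\<close> and
      \<open>sgn y\<close> are so close that uniform continuity of \<open>g\<close> applies.\<close>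
    have D: "\<bar>K x y * (g x - h y)\<bar> \<le> K x y * e" if x: "x \<in> ?S" for x y
    proof (cases "K x y = 0")
      case False
      then have y: "y \<noteq> 0" "dist x (sgn y) < d"
        using K0[OF x] by (auto simp: K_def split: if_splits)
      then have "dist (g x) (g (sgn y)) < e" using d x sgS[OF y(1)] by (intro d0(2)) auto
      then have "\<bar>g x - h y\<bar> \<le> e" using y by (simp add: h_def dist_real_def)
      then show ?thesis using K01(1)[of x y] by (simp add: abs_mult mult_left_mono)
    qed simp
    have mg: "(\<lambda>(x, y). g x) \<in> borel_measurable (\<mu> \<Otimes>\<^sub>M ?N)"
      and mh: "(\<lambda>(x, y). h y) \<in> borel_measurable (\<mu> \<Otimes>\<^sub>M ?N)" by measurable
    have ig: "integrable (\<mu> \<Otimes>\<^sub>M ?N) (\<lambda>(x, y). K x y * g x)" by (rule Ki[OF mg C])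
    have ih: "integrable (\<mu> \<Otimes>\<^sub>M ?N) (\<lambda>(x, y). K x y * h y)" by (rule Ki[OF mh hC])
    have ie: "integrable (\<mu> \<Otimes>\<^sub>M ?N) (\<lambda>(x, y). K x y * e)" by (rule Ki[of "\<lambda>_ _. e" "\<bar>e\<bar>"]) auto
    have Eg: "(\<integral>z. (case z of (x, y) \<Rightarrow> K x y * g x) \<partial>(\<mu> \<Otimes>\<^sub>M ?N)) = c * (\<integral>x. g x \<partial>\<mu>)"
    proof -
      have "(\<integral>z. (case z of (x, y) \<Rightarrow> K x y * g x) \<partial>(\<mu> \<Otimes>\<^sub>M ?N)) = (\<integral>x. \<integral>y. K x y * g x \<partial>?N \<partial>\<mu>)"
        by (rule P.integral_fst[OF ig, symmetric])
      also have "\<dots> = (\<integral>x. c * g x \<partial>\<mu>)"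
        by (rule Bochner_Integration.integral_cong) (auto simp: c1 sp)
      finally show ?thesis by simp
    qed
    have Ee: "(\<integral>z. (case z of (x, y) \<Rightarrow> K x y * e) \<partial>(\<mu> \<Otimes>\<^sub>M ?N)) = c * e"
    proof -
      have "(\<integral>z. (case z of (x, y) \<Rightarrow> K x y * e) \<partial>(\<mu> \<Otimes>\<^sub>M ?N)) = (\<integral>x. \<integral>y. K x y * e \<partial>?N \<partial>\<mu>)"
        by (rule P.integral_fst[OF ie, symmetric])
      also have "\<dots> = (\<integral>x. c * e \<partial>\<mu>)"
        by (rule Bochner_Integration.integral_cong) (auto simp: c1 sp)
      finally show ?thesis by (simp add: M.prob_space)
    qed
    have Eh: "(\<integral>z. (case z of (x, y) \<Rightarrow> K x y * h y) \<partial>(\<mu> \<Otimes>\<^sub>M ?N)) = c * (\<integral>y. h y \<partial>?N)"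
    proof -
      have "(\<integral>z. (case z of (x, y) \<Rightarrow> K x y * h y) \<partial>(\<mu> \<Otimes>\<^sub>M ?N)) = (\<integral>y. \<integral>x. K x y * h y \<partial>\<mu> \<partial>?N)"
        by (rule P.integral_snd[symmetric]) (use ih in simp)
      also have "\<dots> = (\<integral>y. c' y * h y \<partial>?N)" by (simp add: c'_def)
      also have "\<dots> = (\<integral>y. c * h y \<partial>?N)"
      proof (rule integral_cong_AE)
        have hN: "h \<in> borel_measurable ?N" using hm by (simp add: measurable_cong_sets[OF sets_gauss_vec refl])
        show "(\<lambda>y. c' y * h y) \<in> borel_measurable ?N" "(\<lambda>y. c * h y) \<in> borel_measurable ?N"
          by (rule borel_measurable_times[OF c'm hN], rule borel_measurable_times[OF borel_measurable_const hN])
        show "AE y in ?N. c' y * h y = c * h y" using AEc' by eventually_elim (simp add: cc)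
      qed
      finally show ?thesis by simp
    qed
    have "c * (\<integral>x. g x \<partial>\<mu>) - c * (\<integral>y. h y \<partial>?N)
      = (\<integral>z. (case z of (x, y) \<Rightarrow> K x y * g x) - (case z of (x, y) \<Rightarrow> K x y * h y) \<partial>(\<mu> \<Otimes>\<^sub>M ?N))"
      by (simp only: Bochner_Integration.integral_diff[OF ig ih] Eg Eh)
    also have "\<bar>\<dots>\<bar> \<le> (\<integral>z. (case z of (x, y) \<Rightarrow> K x y * e) \<partial>(\<mu> \<Otimes>\<^sub>M ?N))"
      by (rule order_trans[OF integral_abs_bound integral_mono'[OF ie]])
         (use D K01 e in \<open>auto simp: space_pair_measure sp algebra_simps\<close>)
    also have "\<dots> = c * e" by (rule Ee)
    finally have "\<bar>c * ((\<integral>x. g x \<partial>\<mu>) - (\<integral>y. h y \<partial>?N))\<bar> \<le> c * e" by (simp add: right_diff_distrib)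
    then show ?thesis using cpos by (simp add: abs_mult)
  qed
  have "\<bar>(\<integral>x. g x \<partial>\<mu>) - (\<integral>x. h x \<partial>?N)\<bar> \<le> 0"
    by (rule field_le_epsilon) (use close in simp)
  then show ?thesis by (simp add: h_def[abs_def])
qed

text \<open>A variance is made of the integrals of \<open>g\<close> and of its square; both
  functions are continuous, so both integrals can be computed under the Gaussian law.\<close>

lemma vari_invariant_angle_lipschitz:
  fixes \<mu> :: "'a::euclidean_space measure"
  assumes dim: "3 \<le> DIM('a)"
    and mu: "prob_space \<mu>" "sets \<mu> = sets (restrict_space borel (sphere 0 1))"
    and trans: "\<And>x y. x \<in> sphere 0 1 \<Longrightarrow> y \<in> sphere 0 1 \<Longrightarrow>
      \<exists>T. orthogonal_transformation T \<and> T x = y \<and> distr \<mu> \<mu> T = \<mu>"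
    and g: "angle_lipschitz g"
  shows "vari \<mu> g \<le> 1 / (real DIM('a) - 2)"
proof -
  interpret M: prob_space \<mu> by fact
  interpret N: prob_space "gauss_vec :: 'a measure" by (rule prob_space_gauss_vec)
  have sp: "space \<mu> = sphere 0 1" using sets_eq_imp_space_eq[OF mu(2)] by (simp add: space_restrict_space)
  have cg: "continuous_on (sphere 0 1) g" by (rule continuous_on_angle_lipschitz[OF g])
  have gm: "g \<in> borel_measurable \<mu>"
    by (subst measurable_cong_sets[OF mu(2) refl]) (rule borel_measurable_continuous_on_restrict[OF cg])
  have "bounded (g ` sphere 0 1)" using cg by (intro compact_imp_bounded compact_continuous_image) auto
  then obtain C where "\<forall>x\<in>sphere 0 1. \<bar>g x\<bar> \<le> C" unfolding bounded_iff by auto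
  then have C: "\<bar>g x\<bar> \<le> C" if "x \<in> sphere 0 1" for x using that by blast
  have "0 \<le> C" using M.not_empty C sp by fastforce
  then have hC: "\<bar>if x = 0 then 0 else g (sgn x)\<bar> \<le> C" for x
    using C[of "sgn x"] by (auto simp: norm_sgn)
  have I: "(\<integral>x. f x \<partial>\<mu>) = (\<integral>x. (if x = 0 then 0 else f (sgn x)) \<partial>gauss_vec)"
    if "continuous_on (sphere 0 1) f" for f :: "'a \<Rightarrow> real"
    by (rule invariant_integral_eq_gauss[OF mu trans that])
  have "vari \<mu> g = (\<integral>x. (g x)\<^sup>2 \<partial>\<mu>) - (\<integral>x. g x \<partial>\<mu>)\<^sup>2"
    by (rule M.vari_bounded_eq[OF gm]) (use C sp in auto)
  also have "\<dots> = (\<integral>x. (if x = 0 then 0 else (g (sgn x))\<^sup>2) \<partial>gauss_vec)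
      - (\<integral>x. (if x = 0 then 0 else g (sgn x)) \<partial>gauss_vec)\<^sup>2"
    using cg by (simp only: I[OF cg] I[OF continuous_on_power[OF cg]])
  also have "\<dots> = (\<integral>x. (if x = 0 then 0 else g (sgn x))\<^sup>2 \<partial>gauss_vec)
      - (\<integral>x. (if x = 0 then 0 else g (sgn x)) \<partial>gauss_vec)\<^sup>2"
    by (intro arg_cong2[where f = "(-)"] Bochner_Integration.integral_cong refl) auto
  also have "\<dots> = vari gauss_vec (\<lambda>x. if x = 0 then 0 else g (sgn x))"
    by (rule N.vari_bounded_eq[OF _ hC, symmetric])
       (use borel_measurable_sphere_extend[OF cg] in simp)
  also have "\<dots> \<le> 1 / (real DIM('a) - 2)" by (rule gauss_vec_vari_angle_lipschitz[OF dim g])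
  finally show ?thesis .
qed

section \<open>Empirical measures\<close>

text \<open>Increments from \<open>x0\<close> lie in \<open>[-pi, pi]\<close>, so on a finite net of
  the sphere, rounded down to multiples of \<open>h\<close>, they form finitely many patterns;
  functions with equal patterns are close everywhere by the Lipschitz condition. Normalising at
  \<open>x0\<close> is harmless since deviations ignore constants, and choosing representatives in
  \<open>\<F>\<close> keeps the net inside the family.\<close>

lemma angle_lipschitz_finite_net:
  fixes \<F> :: "('a::euclidean_space \<Rightarrow> real) set"
  assumes F: "\<And>g. g \<in> \<F> \<Longrightarrow> angle_lipschitz g" and e: "e > 0" and x0: "x0 \<in> sphere 0 1"
  obtains N where "finite N" "N \<subseteq> \<F>"
    "\<And>g. g \<in> \<F> \<Longrightarrow> \<exists>g'\<in>N. \<forall>x\<in>sphere 0 1. \<bar>(g x - g x0) - (g' x - g' x0)\<bar> \<le> e"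
proof -
  \<comment> \<open>Moving both functions to the net point and comparing the rounded increments
    there cost at most \<open>3 * h\<close> in all.\<close>
  define h where "h = min (e / 4) pi"
  have h: "0 < h" "h \<le> pi" "4 * h \<le> e" using e by (auto simp: h_def)
  obtain Y :: "'a set" where Y: "finite Y" "Y \<subseteq> sphere 0 1"
    and near: "\<And>x. x \<in> sphere 0 1 \<Longrightarrow> \<exists>y\<in>Y. arccos (x \<bullet> y) < h"
    using sphere_finite_net[OF h(1,2)] by metis
  define r where "r g = (\<lambda>y\<in>Y. \<lfloor>(g y - g x0) / h\<rfloor>)" for g :: "'a \<Rightarrow> real"
  have "r ` \<F> \<subseteq> (\<Pi>\<^sub>E y\<in>Y. {\<lfloor>- pi / h\<rfloor>..\<lfloor>pi / h\<rfloor>})"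
  proof (intro image_subsetI PiE_I)
    fix g y assume g: "g \<in> \<F>" and y: "y \<in> Y"
    have "\<bar>g y - g x0\<bar> \<le> pi" using angle_lipschitzD(2)[OF F[OF g] _ x0] y Y by blast
    then have "- pi \<le> g y - g x0" "g y - g x0 \<le> pi" by linarith+
    then have "- pi / h \<le> (g y - g x0) / h" "(g y - g x0) / h \<le> pi / h"
      using h(1) by (intro divide_right_mono; simp)+
    then show "r g y \<in> {\<lfloor>- pi / h\<rfloor>..\<lfloor>pi / h\<rfloor>}" using y by (auto simp: r_def intro: floor_mono)
  qed (simp add: r_def)
  moreover have "finite (\<Pi>\<^sub>E y\<in>Y. {\<lfloor>- pi / h\<rfloor>..\<lfloor>pi / h\<rfloor>})" using Y by (intro finite_PiE) auto
  ultimately have "finite (r ` \<F>)" by (rule finite_subset)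
  then obtain N where N: "N \<subseteq> \<F>" "finite N" "r ` \<F> = r ` N"
    using finite_subset_image[of "r ` \<F>" r \<F>] by blast
  have "\<exists>g'\<in>N. \<forall>x\<in>sphere 0 1. \<bar>(g x - g x0) - (g' x - g' x0)\<bar> \<le> e" if g: "g \<in> \<F>" for g
  proof -
    obtain g' where g': "g' \<in> N" "r g = r g'" using N(3) g by (metis imageE image_eqI)
    have "\<bar>(g x - g x0) - (g' x - g' x0)\<bar> \<le> e" if x: "x \<in> sphere 0 1" for x
    proof -
      obtain y where y: "y \<in> Y" "arccos (x \<bullet> y) < h" using near[OF x] by blast
      then have yS: "y \<in> sphere 0 1" using Y by blast
      define a where "a = (g y - g x0) / h"
      define b where "b = (g' y - g' x0) / h"
      have "\<lfloor>a\<rfloor> = \<lfloor>b\<rfloor>" using fun_cong[OF g'(2), of y] y by (simp add: r_def a_def b_def)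
      then have "\<bar>a - b\<bar> \<le> 1" by linarith
      then have "h * \<bar>a - b\<bar> \<le> h * 1" using h by (intro mult_left_mono) auto
      moreover have "h * \<bar>a - b\<bar> = \<bar>h * (a - b)\<bar>" using h by (simp add: abs_mult)
      moreover have "h * (a - b) = (g y - g x0) - (g' y - g' x0)"
        using h by (simp add: a_def b_def field_simps)
      ultimately have "\<bar>(g y - g x0) - (g' y - g' x0)\<bar> \<le> h" by simp
      moreover have "\<bar>g x - g y\<bar> \<le> h" "\<bar>g' x - g' y\<bar> \<le> h"
        using angle_lipschitzD(1)[OF F x yS] g g' N(1) y(2) by (smt (verit) subsetD)+
      ultimately show ?thesis using h(3) by linarith
    qed
    then show ?thesis using g' by blast
  qed
  then show ?thesis using that N by blast
qed

section \<open>Deviation of empirical means\<close>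

text \<open>Only the coordinates in \<open>J\<close> enter, so one definition serves both the finite
  product and the infinite sequence.\<close>

definition deviation :: "'a measure \<Rightarrow> 'i set \<Rightarrow> ('a \<Rightarrow> real) \<Rightarrow> ('i \<Rightarrow> 'a) \<Rightarrow> real" where
  "deviation \<mu> J g s = \<bar>(\<Sum>i\<in>J. g (s i)) / real (card J) - (\<integral>x. g x \<partial>\<mu>)\<bar>"

locale sphere_prob = prob_space \<mu> for \<mu> :: "'a::euclidean_space measure" +
  assumes sets_mu: "sets \<mu> = sets (restrict_space borel (sphere 0 1))"
begin

lemma space_mu: "space \<mu> = sphere 0 1"
  using sets_eq_imp_space_eq[OF sets_mu] by (simp add: space_restrict_space)

lemma ex_point: obtains x0 :: 'a where "x0 \<in> sphere 0 1"
  using not_empty unfolding space_mu by blast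

lemma measurable_angle_lipschitz:
  assumes "angle_lipschitz g" shows "g \<in> borel_measurable \<mu>"
  by (subst measurable_cong_sets[OF sets_mu refl])
     (rule borel_measurable_continuous_on_restrict[OF continuous_on_angle_lipschitz[OF assms]])

lemma integrable_angle_lipschitz:
  assumes g: "angle_lipschitz g" shows "integrable \<mu> g"
proof -
  obtain x0 :: 'a where x0: "x0 \<in> sphere 0 1" by (rule ex_point)
  show ?thesis
  proof (rule integrable_bounded[OF measurable_angle_lipschitz[OF g]])
    fix x assume "x \<in> space \<mu>"
    then show "\<bar>g x\<bar> \<le> \<bar>g x0\<bar> + pi"
      using angle_lipschitzD(2)[OF g _ x0, of x] by (simp add: space_mu)
  qed
qed

lemma angle_lipschitz_minus_mean:
  assumes g: "angle_lipschitz g" and x: "x \<in> sphere 0 1"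
  shows "\<bar>g x - (\<integral>y. g y \<partial>\<mu>)\<bar> \<le> pi"
proof -
  have "g x - (\<integral>y. g y \<partial>\<mu>) = (\<integral>y. g x - g y \<partial>\<mu>)"
    using integrable_angle_lipschitz[OF g] by (simp add: prob_space)
  also have "\<bar>\<dots>\<bar> \<le> pi"
    by (rule abs_expectation_le)
       (use measurable_angle_lipschitz[OF g] angle_lipschitzD(2)[OF g x] in \<open>auto simp: space_mu\<close>)
  finally show ?thesis .
qed

lemma deviation_le_pi:
  assumes g: "angle_lipschitz g" and J: "finite J" "J \<noteq> {}" and s: "\<And>i. i \<in> J \<Longrightarrow> s i \<in> sphere 0 1"
  shows "deviation \<mu> J g s \<le> pi"
proof -
  have n: "real (card J) > 0" using J by (simp add: card_gt_0_iff)
  have "(\<Sum>i\<in>J. g (s i)) / real (card J) - (\<integral>x. g x \<partial>\<mu>) = (\<Sum>i\<in>J. g (s i) - (\<integral>x. g x \<partial>\<mu>)) / real (card J)"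
    using n by (simp add: sum_subtractf field_simps)
  moreover have "\<bar>\<Sum>i\<in>J. g (s i) - (\<integral>x. g x \<partial>\<mu>)\<bar> \<le> (\<Sum>i\<in>J. pi)"
    by (rule order_trans[OF sum_abs sum_mono]) (use angle_lipschitz_minus_mean[OF g] s in auto)
  ultimately show ?thesis
    using n by (simp add: deviation_def field_simps)
qed

text \<open>The constant shift \<open>k\<close> cancels between the sample mean and the integral;
  what is left changes each of the two by at most \<open>e\<close>.\<close>

lemma deviation_close:
  assumes g: "angle_lipschitz g" "angle_lipschitz g'" and J: "finite J" "J \<noteq> {}"
    and s: "\<And>i. i \<in> J \<Longrightarrow> s i \<in> sphere 0 1"
    and c: "\<And>x. x \<in> sphere 0 1 \<Longrightarrow> \<bar>(g x - g x0) - (g' x - g' x0)\<bar> \<le> e"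
  shows "deviation \<mu> J g s \<le> deviation \<mu> J g' s + 2 * e"
proof -
  have n: "real (card J) > 0" using J by (simp add: card_gt_0_iff)
  define k where "k = g x0 - g' x0"
  define d where "d x = g x - g' x - k" for x
  have d: "\<bar>d x\<bar> \<le> e" if "x \<in> sphere 0 1" for x
    using c[OF that] by (simp add: d_def k_def algebra_simps)
  have "\<bar>\<Sum>i\<in>J. d (s i)\<bar> \<le> (\<Sum>i\<in>J. e)"
    by (rule order_trans[OF sum_abs sum_mono]) (use d s in auto)
  then have 1: "\<bar>(\<Sum>i\<in>J. d (s i)) / real (card J)\<bar> \<le> e"
    using n by (simp add: field_simps)
  have 2: "\<bar>\<integral>x. d x \<partial>\<mu>\<bar> \<le> e"
    by (rule abs_expectation_le)
       (use d measurable_angle_lipschitz[OF g(1)] measurable_angle_lipschitz[OF g(2)] in \<open>auto simp: d_def[abs_def] space_mu\<close>)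
  have "(\<Sum>i\<in>J. d (s i)) / real (card J) = (\<Sum>i\<in>J. g (s i)) / real (card J) - (\<Sum>i\<in>J. g' (s i)) / real (card J) - k"
  proof -
    have "(\<Sum>i\<in>J. d (s i)) = (\<Sum>i\<in>J. g (s i)) - (\<Sum>i\<in>J. g' (s i)) - real (card J) * k"
      by (simp add: d_def sum_subtractf)
    then show ?thesis using n by (simp add: diff_divide_distrib)
  qed
  moreover have "(\<integral>x. d x \<partial>\<mu>) = (\<integral>x. g x \<partial>\<mu>) - (\<integral>x. g' x \<partial>\<mu>) - k"
    using integrable_angle_lipschitz[OF g(1)] integrable_angle_lipschitz[OF g(2)]
    by (simp add: d_def prob_space)
  ultimately show ?thesis using 1 2 unfolding deviation_def by linarith
qed

lemma deviation_upd:
  assumes g: "angle_lipschitz g" and J: "finite J" and i: "i \<in> J"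
    and s: "s i \<in> sphere 0 1" and y: "y \<in> sphere 0 1"
  shows "deviation \<mu> J g (s(i := y)) \<le> deviation \<mu> J g s + pi / real (card J)"
proof -
  have n: "real (card J) > 0" using J i by (auto simp: card_gt_0_iff)
  have "(\<Sum>j\<in>J. g ((s(i := y)) j)) = (\<Sum>j\<in>J. g (s j)) + (g y - g (s i))"
    using J i by (simp add: sum.remove[of J i] algebra_simps cong: sum.cong_simp)
  then have "(\<Sum>j\<in>J. g ((s(i := y)) j)) / real (card J) = (\<Sum>j\<in>J. g (s j)) / real (card J) + (g y - g (s i)) / real (card J)"
    by (simp add: add_divide_distrib)
  moreover have "\<bar>(g y - g (s i)) / real (card J)\<bar> \<le> pi / real (card J)"
    using angle_lipschitzD(2)[OF g y s] n by (simp add: divide_right_mono)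
  ultimately show ?thesis unfolding deviation_def by linarith
qed

lemma measurable_mean:
  assumes g: "angle_lipschitz g" and J: "J \<subseteq> I"
  shows "(\<lambda>s. (\<Sum>i\<in>J. g (s i)) / real (card J)) \<in> borel_measurable (Pi\<^sub>M I (\<lambda>_. \<mu>))"
proof -
  note [measurable] = measurable_angle_lipschitz[OF g]
  have "(\<lambda>s. g (s i)) \<in> borel_measurable (Pi\<^sub>M I (\<lambda>_. \<mu>))" if "i \<in> J" for i
    by (rule measurable_compose[OF measurable_component_singleton]) (use J that in auto)
  then show ?thesis by (intro borel_measurable_divide borel_measurable_sum) auto
qed

lemma measurable_deviation:
  assumes g: "angle_lipschitz g" and J: "J \<subseteq> I"
  shows "deviation \<mu> J g \<in> borel_measurable (Pi\<^sub>M I (\<lambda>_. \<mu>))"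
  unfolding deviation_def[abs_def] using measurable_mean[OF assms] by measurable

text \<open>Efron--Stein bounds the variance of the mean by \<open>n\<close> terms of size
  \<open>(pi / n)\<^sup>2\<close>, and Jensen's inequality passes to the first absolute
  moment.\<close>

lemma expected_deviation:
  assumes g: "angle_lipschitz g" and J: "finite J" "J \<noteq> {}"
  shows "(\<integral>s. deviation \<mu> J g s \<partial>Pi\<^sub>M J (\<lambda>_. \<mu>)) \<le> pi / sqrt (real (card J))"
proof -
  let ?P = "Pi\<^sub>M J (\<lambda>_. \<mu>)"
  define n where "n = real (card J)"
  have n: "n > 0" using J by (simp add: card_gt_0_iff n_def)
  interpret P: prob_space ?P by (intro prob_space_PiM prob_space_axioms)
  define Z where "Z s = (\<Sum>i\<in>J. g (s i)) / n" for s
  have Zm[measurable]: "Z \<in> borel_measurable ?P"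
    unfolding Z_def[abs_def] n_def by (rule measurable_mean[OF g]) simp
  define m where "m = (\<integral>x. g x \<partial>\<mu>)"
  have sp: "s i \<in> sphere 0 1" if "s \<in> space ?P" "i \<in> J" for s i
    using that by (auto simp: space_PiM PiE_iff space_mu)
  have dZ: "deviation \<mu> J g s = \<bar>Z s - m\<bar>" for s by (simp add: deviation_def Z_def m_def n_def)
  have dp: "\<bar>Z s - m\<bar> \<le> pi" if "s \<in> space ?P" for s
    using deviation_le_pi[OF g J sp[OF that]] dZ by simp
  have ZB: "\<bar>Z s\<bar> \<le> \<bar>m\<bar> + pi" if "s \<in> space ?P" for s
    using dp[OF that] by linarith
  have EZ: "(\<integral>s. Z s \<partial>?P) = m"
  proof -
    have c: "(\<integral>s. g (s i) \<partial>?P) = m" "integrable ?P (\<lambda>s. g (s i))" if i: "i \<in> J" for i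
    proof -
      have d: "distr ?P \<mu> (\<lambda>s. s i) = \<mu>" by (rule distr_PiM_component) (use i prob_space_axioms in auto)
      have ms: "(\<lambda>s. s i) \<in> measurable ?P \<mu>" using i by simp
      show "(\<integral>s. g (s i) \<partial>?P) = m"
        unfolding m_def using integral_distr[OF ms measurable_angle_lipschitz[OF g]] d by simp
      show "integrable ?P (\<lambda>s. g (s i))"
        using integrable_distr_eq[OF ms measurable_angle_lipschitz[OF g]] d integrable_angle_lipschitz[OF g] by simp
    qed
    show ?thesis using n c by (simp add: Z_def n_def)
  qed
  have "(\<integral>s. \<bar>Z s - m\<bar> \<partial>?P)\<^sup>2 \<le> (\<integral>s. \<bar>Z s - m\<bar>\<^sup>2 \<partial>?P)"
    by (rule P.square_expectation_le[where B = pi]) (use dp in auto)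
  also have "\<dots> = vari ?P Z" by (simp add: EZ)
  also have "\<dots> \<le> (\<Sum>i\<in>J. \<integral>x. vari \<mu> (\<lambda>y. Z (x(i := y))) \<partial>?P)"
    by (rule vari_le_sum_coordinate_vari[OF prob_space_axioms J(1) Zm ZB])
  also have "\<dots> \<le> (\<Sum>i\<in>J. (pi / n)\<^sup>2)"
  proof (rule sum_mono)
    fix i assume i: "i \<in> J"
    have v: "vari \<mu> (\<lambda>y. Z (x(i := y))) \<le> (pi / n)\<^sup>2" for x
    proof -
      define r where "r = (\<Sum>j\<in>J - {i}. g (x j)) / n"
      have Zx: "Z (x(i := y)) = r + g y / n" for y
        unfolding Z_def r_def using J i
        by (subst sum.remove[of J i]) (auto simp: add_divide_distrib intro!: sum.cong arg_cong2[where f = "(/)"])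
      have e: "(\<integral>y. Z (x(i := y)) \<partial>\<mu>) = r + m / n"
        unfolding Zx m_def using integrable_angle_lipschitz[OF g] by (simp add: prob_space)
      have "\<bar>vari \<mu> (\<lambda>y. Z (x(i := y)))\<bar> \<le> (pi / n)\<^sup>2"
        unfolding e unfolding Zx
      proof (rule abs_expectation_le)
        fix y assume y: "y \<in> space \<mu>"
        have "\<bar>(g y - m) / n\<bar> \<le> pi / n"
          using angle_lipschitz_minus_mean[OF g, of y] y n by (simp add: m_def space_mu divide_right_mono)
        from power_mono[OF this abs_ge_zero, of 2]
        show "\<bar>(r + g y / n - (r + m / n))\<^sup>2\<bar> \<le> (pi / n)\<^sup>2" by (simp add: diff_divide_distrib)
      qed (use measurable_angle_lipschitz[OF g] in measurable)
      then show ?thesis by simp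
    qed
    show "(\<integral>x. vari \<mu> (\<lambda>y. Z (x(i := y))) \<partial>?P) \<le> (pi / n)\<^sup>2"
    \<comment> \<open>Without integrability the integral is 0 and the bound is trivial.\<close>
    proof (cases "integrable ?P (\<lambda>x. vari \<mu> (\<lambda>y. Z (x(i := y))))")
      case True
      then show ?thesis by (rule P.integral_le_const) (use v in auto)
    next
      case False
      then show ?thesis by (simp add: not_integrable_integral_eq)
    qed
  qed
  also have "\<dots> = pi\<^sup>2 / n" using n by (simp add: n_def[symmetric] power2_eq_square field_simps)
  also have "\<dots> = (pi / sqrt n)\<^sup>2" using n by (simp add: power_divide)
  finally have "(\<integral>s. \<bar>Z s - m\<bar> \<partial>?P) \<le> pi / sqrt n"
    by (rule power2_le_imp_le) (use n in auto)
  then show ?thesis by (simp add: dZ n_def)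
qed

section \<open>Concentration of the largest deviation\<close>

text \<open>The net serves the expectation only: every deviation is within \<open>e / 8\<close>,
  twice \<open>e / 16\<close>, of one on the net, and the largest of those is at most their sum,
  whose mean is at most \<open>e / 8\<close> by \<open>large\<close>. The tail comes from bounded
  differences, which a supremum inherits from its members.\<close>

lemma sup_deviation_concentration:
  fixes \<F> :: "('a \<Rightarrow> real) set"
  assumes F: "\<And>g. g \<in> \<F> \<Longrightarrow> angle_lipschitz g" and F0: "\<F> \<noteq> {}" "countable \<F>"
    and e: "e > 0" and J: "finite J" "J \<noteq> {}"
    and N: "finite N" "N \<subseteq> \<F>"
    and net: "\<And>g. g \<in> \<F> \<Longrightarrow> \<exists>g'\<in>N. \<forall>x\<in>sphere 0 1. \<bar>(g x - g x0) - (g' x - g' x0)\<bar> \<le> e / 16"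
    and large: "real (card N) * (pi / sqrt (real (card J))) \<le> e / 8"
  shows "{s \<in> space (Pi\<^sub>M J (\<lambda>_. \<mu>)). \<forall>g\<in>\<F>. deviation \<mu> J g s \<le> e} \<in> sets (Pi\<^sub>M J (\<lambda>_. \<mu>)) \<and>
    1 - exp (- (real (card J) * e\<^sup>2 / pi\<^sup>2))
    \<le> measure (Pi\<^sub>M J (\<lambda>_. \<mu>)) {s \<in> space (Pi\<^sub>M J (\<lambda>_. \<mu>)). \<forall>g\<in>\<F>. deviation \<mu> J g s \<le> e}"
proof -
  let ?P = "Pi\<^sub>M J (\<lambda>_. \<mu>)"
  interpret P: prob_space ?P by (intro prob_space_PiM prob_space_axioms)
  define n where "n = real (card J)"
  have n: "n > 0" using J by (simp add: card_gt_0_iff n_def)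
  define S where "S s = (SUP g\<in>\<F>. deviation \<mu> J g s)" for s
  have sp: "s i \<in> sphere 0 1" if "s \<in> space ?P" "i \<in> J" for s i
    using that by (auto simp: space_PiM PiE_iff space_mu)
  have dp: "deviation \<mu> J g s \<le> pi" if "s \<in> space ?P" "g \<in> \<F>" for s g
    by (rule deviation_le_pi[OF F[OF that(2)] J]) (use sp that in auto)
  have bdd: "bdd_above ((\<lambda>g. deviation \<mu> J g s) ` \<F>)" if "s \<in> space ?P" for s
    using dp[OF that] by (intro bdd_aboveI2) auto
  have Sm[measurable]: "S \<in> borel_measurable ?P"
    unfolding S_def[abs_def]
    by (rule borel_measurable_cSUP) (use F0 bdd measurable_deviation[OF F] in auto)
  have Sle: "S s \<le> c \<longleftrightarrow> (\<forall>g\<in>\<F>. deviation \<mu> J g s \<le> c)" if "s \<in> space ?P" for s c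
    unfolding S_def using cSUP_le_iff[OF F0(1) bdd[OF that]] by simp
  have d0: "0 \<le> deviation \<mu> J g s" for g s by (simp add: deviation_def)
  obtain g0 where g0: "g0 \<in> \<F>" using F0 by blast
  have S0: "0 \<le> S s" if "s \<in> space ?P" for s
    unfolding S_def by (rule order_trans[OF d0 cSUP_upper[OF g0 bdd[OF that]]])
  have Spi: "S s \<le> pi" if "s \<in> space ?P" for s using Sle[OF that] dp[OF that] by simp
  have SB: "\<bar>S s\<bar> \<le> pi" if "s \<in> space ?P" for s using S0[OF that] Spi[OF that] by simp
  have ES: "(\<integral>s. S s \<partial>?P) \<le> e / 4"
  proof -
    have di: "integrable ?P (deviation \<mu> J g)" if "g \<in> \<F>" for g
      by (rule P.integrable_bounded[where B = pi]) (use measurable_deviation[OF F[OF that]] dp that d0 in auto)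
    have "(\<integral>s. S s \<partial>?P) \<le> (\<integral>s. (\<Sum>g\<in>N. deviation \<mu> J g s) + e / 8 \<partial>?P)"
    proof (rule integral_mono)
      show "integrable ?P S" by (rule P.integrable_bounded[OF Sm SB])
      show "integrable ?P (\<lambda>s. (\<Sum>g\<in>N. deviation \<mu> J g s) + e / 8)"
        using di N by (intro Bochner_Integration.integrable_add Bochner_Integration.integrable_sum) auto
      fix s assume s: "s \<in> space ?P"
      show "S s \<le> (\<Sum>g\<in>N. deviation \<mu> J g s) + e / 8"
        unfolding Sle[OF s]
      proof
        fix g assume g: "g \<in> \<F>"
        obtain g' where g': "g' \<in> N" "\<forall>x\<in>sphere 0 1. \<bar>(g x - g x0) - (g' x - g' x0)\<bar> \<le> e / 16"
          using net[OF g] by blast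
        have "deviation \<mu> J g s \<le> deviation \<mu> J g' s + 2 * (e / 16)"
          by (rule deviation_close[OF F[OF g] F J]) (use g' N(2) sp[OF s] in auto)
        also have "deviation \<mu> J g' s \<le> (\<Sum>g\<in>N. deviation \<mu> J g s)"
          by (rule member_le_sum) (use g' N d0 in auto)
        finally show "deviation \<mu> J g s \<le> (\<Sum>g\<in>N. deviation \<mu> J g s) + e / 8" by simp
      qed
    qed
    also have "\<dots> = (\<Sum>g\<in>N. \<integral>s. deviation \<mu> J g s \<partial>?P) + e / 8"
    proof -
      have "integrable ?P (\<lambda>s. \<Sum>g\<in>N. deviation \<mu> J g s)" using di N by (intro Bochner_Integration.integrable_sum) auto
      moreover have "(\<integral>s. (\<Sum>g\<in>N. deviation \<mu> J g s) \<partial>?P) = (\<Sum>g\<in>N. \<integral>s. deviation \<mu> J g s \<partial>?P)"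
        using di N by (intro Bochner_Integration.integral_sum) auto
      moreover have "measure ?P (space ?P) = 1" by (rule P.prob_space)
      ultimately show ?thesis by simp
    qed
    also have "(\<Sum>g\<in>N. \<integral>s. deviation \<mu> J g s \<partial>?P) \<le> real (card N) * (pi / sqrt (real (card J)))"
      by (rule sum_bounded_above) (use expected_deviation[OF F J] N in auto)
    finally show ?thesis using large by linarith
  qed
  have tail: "measure ?P {s \<in> space ?P. (\<integral>s. S s \<partial>?P) + 3 / 4 * e \<le> S s}
    \<le> exp (- 2 * (3 / 4 * e)\<^sup>2 / (real (card J) * (pi / n)\<^sup>2))"
  proof (rule bounded_differences_inequality[OF prob_space_axioms J _ _ Sm SB])
    show "0 < 3 / 4 * e" "0 < pi / n" using e n by auto
    fix s i y assume *: "s \<in> space ?P" "i \<in> J" "y \<in> space \<mu>"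
    have s': "s(i := y) \<in> space ?P" using * by (auto simp: space_PiM PiE_iff extensional_def)
    show "S (s(i := y)) \<le> S s + pi / n"
      unfolding Sle[OF s']
    proof
      fix g assume g: "g \<in> \<F>"
      have "deviation \<mu> J g (s(i := y)) \<le> deviation \<mu> J g s + pi / n"
        unfolding n_def by (rule deviation_upd[OF F[OF g] J(1)]) (use * sp in \<open>auto simp: space_mu\<close>)
      also have "deviation \<mu> J g s \<le> S s" using Sle[OF *(1), of "S s"] g by simp
      finally show "deviation \<mu> J g (s(i := y)) \<le> S s + pi / n" by simp
    qed
  qed
  have ev: "{s \<in> space ?P. \<forall>g\<in>\<F>. deviation \<mu> J g s \<le> e} = {s \<in> space ?P. S s \<le> e}"
    using Sle by blast
  have m1: "{s \<in> space ?P. S s \<le> e} \<in> sets ?P" by measurable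
  have "1 - measure ?P {s \<in> space ?P. S s \<le> e} = measure ?P (space ?P - {s \<in> space ?P. S s \<le> e})"
    by (rule P.prob_compl[OF m1, symmetric])
  \<comment> \<open>Off the event, \<open>S s\<close> exceeds \<open>e\<close>, hence exceeds its
    mean, at most \<open>e / 4\<close>, by \<open>3 / 4 * e\<close>.\<close>
  also have "\<dots> \<le> measure ?P {s \<in> space ?P. (\<integral>s. S s \<partial>?P) + 3 / 4 * e \<le> S s}"
    by (rule P.finite_measure_mono) (use ES in auto)
  also note tail
  also have "exp (- 2 * (3 / 4 * e)\<^sup>2 / (real (card J) * (pi / n)\<^sup>2)) \<le> exp (- (real (card J) * e\<^sup>2 / pi\<^sup>2))"
  proof -
    have *: "A = - (9 / 8) * a \<Longrightarrow> 0 \<le> a \<Longrightarrow> A \<le> - a" for A a :: real by simp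
    have "- 2 * (3 / 4 * e)\<^sup>2 / (n * (pi / n)\<^sup>2) = - (9 / 8) * (n * e\<^sup>2 / pi\<^sup>2)"
      using n by (simp add: power2_eq_square field_simps)
    moreover have "0 \<le> n * e\<^sup>2 / pi\<^sup>2" using n by simp
    ultimately have "- 2 * (3 / 4 * e)\<^sup>2 / (n * (pi / n)\<^sup>2) \<le> - (n * e\<^sup>2 / pi\<^sup>2)"
      by (rule *)
    then show ?thesis unfolding n_def[symmetric] exp_le_cancel_iff .
  qed
  finally show ?thesis unfolding ev using m1 by simp
qed

text \<open>The net bounds the expected supremum by \<open>e / 4\<close> for large \<open>n\<close>, and the deviation \<open>3 / 4 * e\<close> from
  it has exponent \<open>9 / 8 * n * e\<^sup>2 / pi\<^sup>2\<close>. Passing to a countable dense subfamily \<open>\<G>\<close> makes the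
  supremum measurable.\<close>

lemma empirical_deviation_eventually:
  fixes \<F> :: "('a \<Rightarrow> real) set"
  assumes F: "\<And>g. g \<in> \<F> \<Longrightarrow> angle_lipschitz g" and e: "e > 0"
  shows "\<forall>\<^sub>F n in sequentially. 1 - exp (- (real n * e\<^sup>2 / pi\<^sup>2)) \<le>
    measure (Pi\<^sub>M UNIV (\<lambda>_::nat. \<mu>))
      {s \<in> space (Pi\<^sub>M UNIV (\<lambda>_. \<mu>)). \<forall>g\<in>\<F>. deviation \<mu> {1..n} g s \<le> e}"
proof (cases "\<F> = {}")
  case True
  interpret U: prob_space "Pi\<^sub>M UNIV (\<lambda>_::nat. \<mu>)" by (intro prob_space_PiM prob_space_axioms)
  show ?thesis using True by (simp add: U.prob_space)
next
  case False
  interpret product_prob_space "\<lambda>_::nat. \<mu>" UNIV by standard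
  obtain x0 :: 'a where x0: "x0 \<in> sphere 0 1" by (rule ex_point)
  have "\<exists>N. finite N \<and> N \<subseteq> \<F> \<and> (\<forall>g\<in>\<F>. \<exists>g'\<in>N. \<forall>x\<in>sphere 0 1. \<bar>(g x - g x0) - (g' x - g' x0)\<bar> \<le> d)"
    if "d > 0" for d
    using angle_lipschitz_finite_net[OF F that x0] by metis
  then obtain N where N: "\<And>d. d > 0 \<Longrightarrow> finite (N d)" "\<And>d. d > 0 \<Longrightarrow> N d \<subseteq> \<F>"
    "\<And>d g. d > 0 \<Longrightarrow> g \<in> \<F> \<Longrightarrow> \<exists>g'\<in>N d. \<forall>x\<in>sphere 0 1. \<bar>(g x - g x0) - (g' x - g' x0)\<bar> \<le> d"
    by metis
  \<comment> \<open>The nets of scale \<open>1 / Suc m\<close> make \<open>\<G>\<close> dense in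
    \<open>\<F>\<close> modulo constants; \<open>N (e / 16)\<close> is added because the
    concentration lemma takes its net from the family itself.\<close>
  define \<G> where "\<G> = N (e / 16) \<union> (\<Union>m. N (1 / real (Suc m)))"
  have G: "countable \<G>" "\<G> \<subseteq> \<F>" "N (e / 16) \<subseteq> \<G>"
  proof -
    show "countable \<G>"
      unfolding \<G>_def
      by (rule countable_Un[OF countable_finite[OF N(1)] countable_UN[OF _ countable_finite[OF N(1)]]])
         (use e in auto)
    show "\<G> \<subseteq> \<F>" unfolding \<G>_def by (intro Un_least UN_least N(2)) (use e in auto)
  qed (simp add: \<G>_def)
  have G0: "\<G> \<noteq> {}" using N(3)[of "e / 16"] e False G(3) by fastforce
  have dense: "(\<forall>g\<in>\<F>. deviation \<mu> J g s \<le> e) \<longleftrightarrow> (\<forall>g\<in>\<G>. deviation \<mu> J g s \<le> e)"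
    if J: "finite J" "J \<noteq> {}" and s: "\<And>i. i \<in> J \<Longrightarrow> s i \<in> sphere 0 1" for J :: "nat set" and s
  proof
    assume *: "\<forall>g\<in>\<G>. deviation \<mu> J g s \<le> e"
    show "\<forall>g\<in>\<F>. deviation \<mu> J g s \<le> e"
    proof
      fix g assume g: "g \<in> \<F>"
      show "deviation \<mu> J g s \<le> e"
      proof (rule field_le_epsilon)
        fix r :: real assume "r > 0"
        then obtain m where m: "1 / real (Suc m) < r / 2" using nat_approx_posE[of "r / 2"] by auto
        obtain g' where g': "g' \<in> N (1 / real (Suc m))"
          "\<forall>x\<in>sphere 0 1. \<bar>(g x - g x0) - (g' x - g' x0)\<bar> \<le> 1 / real (Suc m)"
          using N(3)[OF _ g, of "1 / real (Suc m)"] by auto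
        then have gG: "g' \<in> \<G>" by (auto simp: \<G>_def)
        have "deviation \<mu> J g s \<le> deviation \<mu> J g' s + 2 * (1 / real (Suc m))"
          by (rule deviation_close[OF F[OF g] F J]) (use g' gG G(2) s in auto)
        then show "deviation \<mu> J g s \<le> e + r" using * gG m by fastforce
      qed
    qed
  qed (use G in blast)
  let ?k = "real (card (N (e / 16)))"
  have "(\<lambda>n. ?k * (pi / sqrt (real n))) \<longlonglongrightarrow> 0" by real_asymp
  then have "\<forall>\<^sub>F n in sequentially. ?k * (pi / sqrt (real n)) < e / 8"
    using e by (intro order_tendstoD) auto
  then show ?thesis using eventually_gt_at_top[of 0]
  proof eventually_elim
    case (elim n)
    let ?J = "{1..n}"
    have J: "finite ?J" "?J \<noteq> {}" using elim by auto
    let ?E = "{s \<in> space (Pi\<^sub>M ?J (\<lambda>_. \<mu>)). \<forall>g\<in>\<G>. deviation \<mu> ?J g s \<le> e}"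
    have E: "?E \<in> sets (Pi\<^sub>M ?J (\<lambda>_. \<mu>))"
      "1 - exp (- (real (card ?J) * e\<^sup>2 / pi\<^sup>2)) \<le> measure (Pi\<^sub>M ?J (\<lambda>_. \<mu>)) ?E"
      using sup_deviation_concentration[of \<G> e ?J "N (e / 16)" x0, OF _ G0 G(1) e J N(1) G(3)] N(3)[of "e / 16"] F G(2) e elim
      by auto
    have d: "deviation \<mu> ?J g (restrict s ?J) = deviation \<mu> ?J g s" for g s
      by (simp add: deviation_def)
    \<comment> \<open>The event depends on finitely many coordinates, so its probability can be
      computed in the finite product.\<close>
    have "measure (Pi\<^sub>M ?J (\<lambda>_. \<mu>)) ?E
      = measure (distr (Pi\<^sub>M UNIV (\<lambda>_. \<mu>)) (Pi\<^sub>M ?J (\<lambda>_. \<mu>)) (\<lambda>x. restrict x ?J)) ?E"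
      by (subst distr_PiM_restrict_finite) auto
    also have "\<dots> = measure (Pi\<^sub>M UNIV (\<lambda>_. \<mu>)) ((\<lambda>x. restrict x ?J) -` ?E \<inter> space (Pi\<^sub>M UNIV (\<lambda>_. \<mu>)))"
      by (rule measure_distr[OF _ E(1)]) (simp add: measurable_restrict_subset)
    also have "(\<lambda>x. restrict x ?J) -` ?E \<inter> space (Pi\<^sub>M UNIV (\<lambda>_. \<mu>))
      = {s \<in> space (Pi\<^sub>M UNIV (\<lambda>_. \<mu>)). \<forall>g\<in>\<F>. deviation \<mu> ?J g s \<le> e}"
    proof -
      have "(\<forall>g\<in>\<F>. deviation \<mu> ?J g s \<le> e) \<longleftrightarrow> (\<forall>g\<in>\<G>. deviation \<mu> ?J g s \<le> e)"
        if "s \<in> space (Pi\<^sub>M UNIV (\<lambda>_. \<mu>))" for s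
        by (rule dense[OF J]) (use that in \<open>auto simp: space_PiM PiE_iff space_mu\<close>)
      then show ?thesis by (auto simp: d space_PiM PiE_iff simp del: One_nat_def)
    qed
    finally show ?case using E(2) by simp
  qed
qed

end

section \<open>The core of the model algebra\<close>

lemma mat_adjoint_diag:
  assumes "M \<in> carrier_mat n n" "i < n"
  shows "mat_adjoint M $$ (i, i) = cnj (M $$ (i, i))"
  using assms unfolding mat_adjoint_def by (simp add: mat_of_rows_index)

lemma norm_trace_real:
  assumes M: "M \<in> carrier_mat n n" "mat_adjoint M = M"
  shows "norm_trace M \<in> \<real>"
proof -
  have "M $$ (i, i) \<in> \<real>" if "i < n" for i
    using mat_adjoint_diag[OF M(1) that] M(2) by (simp add: Reals_cnj_iff)
  then show ?thesis
    using M(1) unfolding norm_trace_def by (intro Reals_divide sum_in_Reals) auto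
qed

section \<open>Trace functions along the inductive system\<close>

context model_algebra
begin

lemma connecting_star_hom: "\<phi> n \<in> star_hom (A n) (A (Suc n))"
  using connecting[of n] by (simp add: star_embedding_def)

lemma conn_closed:
  assumes "n \<le> m" "a \<in> carrier (A n)"
  shows "conn \<phi> n m a \<in> carrier (A m)"
  using assms(1)
proof (induction m rule: dec_induct)
  case base
  \<comment> \<open>\<open>conn \<phi> n n\<close> is \<open>id\<close>, by the first equation for
    \<open>n = 0\<close> and by the \<open>else\<close> branch for a successor.\<close>
  then show ?case using assms(2) by (cases n) auto
next
  case (step m)
  then show ?case
    using connecting_star_hom[of m] by (auto simp: star_hom_def Ring.ring_hom_def)
qed

lemma conn_self_adjoint:
  assumes "n \<le> m" "a \<in> self_adjoint (A n)"
  shows "conn \<phi> n m a \<in> self_adjoint (A m)"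
  using assms(1)
proof (induction m rule: dec_induct)
  case base
  then show ?case using assms(2) by (cases n) auto
next
  case (step m)
  then have "conn \<phi> n m a \<in> carrier (A m)" "star (A m) (conn \<phi> n m a) = conn \<phi> n m a"
    by (auto simp: self_adjoint_def)
  then have "star (A (Suc m)) (\<phi> m (conn \<phi> n m a)) = \<phi> m (conn \<phi> n m a)"
    using connecting_star_hom[of m] unfolding star_hom_def by force
  moreover have "conn \<phi> n (Suc m) a \<in> carrier (A (Suc m))"
    using step.hyps assms(2) by (intro conn_closed) (auto simp: self_adjoint_def)
  ultimately show ?case using step.hyps by (simp add: self_adjoint_def)
qed

lemma A_carrierD:
  assumes "b \<in> carrier (A m)"
  shows "x \<in> X \<Longrightarrow> b x \<in> carrier_mat (p m * q m) (p m * q m)"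
    and "i < p m * q m \<Longrightarrow> j < p m * q m \<Longrightarrow> continuous_on X (\<lambda>x. b x $$ (i, j))"
  using assms by (auto simp: A_eq dim_drop_def)

lemma measurable_norm_trace:
  assumes b: "b \<in> carrier (A m)"
  shows "(\<lambda>x. norm_trace (b x)) \<in> borel_measurable (borel_on X)"
proof -
  let ?n = "p m * q m"
  have "continuous_on X (\<lambda>x. (\<Sum>i<?n. b x $$ (i, i)) / of_nat ?n)"
    using A_carrierD(2)[OF b] prime_dims by (intro continuous_intros) auto
  moreover have "(\<Sum>i<?n. b x $$ (i, i)) / of_nat ?n = norm_trace (b x)" if "x \<in> X" for x
    using A_carrierD(1)[OF b that] by (simp add: norm_trace_def)
  ultimately have "continuous_on X (\<lambda>x. norm_trace (b x))"
    by (simp cong: continuous_on_cong_simp)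
  then show ?thesis by (rule borel_measurable_continuous_on_restrict)
qed

lemma norm_trace_self_adjoint:
  assumes b: "b \<in> self_adjoint (A m)" and x: "x \<in> X"
  shows "norm_trace (b x) \<in> \<real>"
proof (rule norm_trace_real)
  show "b x \<in> carrier_mat (p m * q m) (p m * q m)"
    using b A_carrierD(1)[OF _ x] by (auto simp: self_adjoint_def)
  have "star (A m) b = b" using b by (simp add: self_adjoint_def)
  then have "(\<lambda>x\<in>X. mat_adjoint (b x)) x = b x" by (simp add: A_eq dim_drop_def)
  then show "mat_adjoint (b x) = b x" using x by simp
qed

text \<open>Because \<open>lip_const_n\<close> is a supremum over all later stages, one bound
  controls every image of \<open>a\<close> along the system and so survives in the limit.\<close>

lemma lip_const_nD:
  assumes "lip_const_n X \<rho> \<phi> n a \<le> 1" "n \<le> m" and xy: "x \<in> X" "y \<in> X" "x \<noteq> y" and pos: "0 < \<rho> x y"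
  shows "cmod (norm_trace (conn \<phi> n m a x) - norm_trace (conn \<phi> n m a y)) \<le> \<rho> x y"
proof -
  have "ereal (cmod (norm_trace (conn \<phi> n m a x) - norm_trace (conn \<phi> n m a y)) / \<rho> x y)
    \<le> lip_const X \<rho> (conn \<phi> n m a)"
    unfolding lip_const_def by (rule SUP_upper2[of "(x, y)"]) (use xy in auto)
  also have "\<dots> \<le> lip_const_n X \<rho> \<phi> n a"
    unfolding lip_const_n_def by (rule SUP_upper) (use assms in auto)
  also have "\<dots> \<le> 1" by fact
  finally have "cmod (norm_trace (conn \<phi> n m a x) - norm_trace (conn \<phi> n m a y)) / \<rho> x y \<le> 1"
    by (simp add: one_ereal_def)
  then show ?thesis using pos by simp
qed

lemma dirac_borel_probs:
  assumes "x \<in> X" shows "dirac X x \<in> borel_probs X"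
  using assms by (auto simp: borel_probs_def space_restrict_space intro!: prob_space_return)

text \<open>Along the system, the traces of the images of \<open>a\<close> are continuous functions
  on \<open>X\<close>, real and 1-Lipschitz. For Dirac measures, \<open>trc_limit\<close> gives
  their pointwise limit \<open>g\<close>; for general \<open>\<nu>\<close>, together with dominated
  convergence, it identifies the trace with the integral of \<open>g\<close>.\<close>

lemma core_trace_function:
  assumes f: "f \<in> core X \<rho> A \<phi> \<psi>"
    and pos: "\<And>x y. x \<in> X \<Longrightarrow> y \<in> X \<Longrightarrow> x \<noteq> y \<Longrightarrow> 0 < \<rho> x y"
    and diag: "\<And>x. x \<in> X \<Longrightarrow> 0 \<le> \<rho> x x"
    and bound: "\<And>x y. x \<in> X \<Longrightarrow> y \<in> X \<Longrightarrow> \<rho> x y \<le> D"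
  obtains g where "f \<in> carrier Z" "one_lipschitz X \<rho> g" "g \<in> borel_measurable (borel_on X)"
    "\<And>x. x \<in> X \<Longrightarrow> trc (dirac X x) f = of_real (g x)"
    "\<And>\<nu>. \<nu> \<in> borel_probs X \<Longrightarrow> trc \<nu> f = of_real (\<integral>x. g x \<partial>\<nu>)"
proof -
  obtain n a where a: "f = \<psi> n a" "a \<in> self_adjoint (A n)" "lip_const_n X \<rho> \<phi> n a \<le> 1"
    using f by (auto simp: core_def core_r_def lip_ball_def)
  then have ac: "a \<in> carrier (A n)" by (simp add: self_adjoint_def)
  have "\<psi> n \<in> star_hom (A n) Z" using limit by (simp add: inductive_limit_def)
  then have fZ: "f \<in> carrier Z" using ac a(1) by (auto simp: star_hom_def Ring.ring_hom_def)
  define u where "u m x = norm_trace (conn \<phi> n (m + n) a x)" for m x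
  have um: "u m \<in> borel_measurable (borel_on X)" for m
    unfolding u_def[abs_def] by (rule measurable_norm_trace[OF conn_closed[OF _ ac]]) simp
  have ur: "u m x \<in> \<real>" if "x \<in> X" for m x
    unfolding u_def by (rule norm_trace_self_adjoint[OF conn_self_adjoint[OF _ a(2)] that]) simp
  have ul: "cmod (u m x - u m y) \<le> \<rho> x y" if "x \<in> X" "y \<in> X" for m x y
  proof (cases "x = y")
    case False
    then show ?thesis
      unfolding u_def by (intro lip_const_nD[OF a(3)] pos that) simp
  qed (use diag that in simp)
  have tl: "(\<lambda>m. \<integral>x. u m x \<partial>\<nu>) \<longlonglongrightarrow> trc \<nu> f" if "\<nu> \<in> borel_probs X" for \<nu>
    unfolding u_def a(1) using LIMSEQ_ignore_initial_segment[OF trc_limit[OF that ac], of n] .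
  have td: "(\<lambda>m. u m x) \<longlonglongrightarrow> trc (dirac X x) f" if x: "x \<in> X" for x
  proof -
    have "(\<integral>y. u m y \<partial>dirac X x) = u m x" for m
      by (rule integral_return) (use x um in \<open>auto simp: space_restrict_space\<close>)
    then show ?thesis using tl[OF dirac_borel_probs[OF x]] by simp
  qed
  define g where "g x = Re (trc (dirac X x) f)" for x
  have gt: "trc (dirac X x) f = of_real (g x)" if x: "x \<in> X" for x
  proof -
    have "trc (dirac X x) f \<in> \<real>"
      by (rule Lim_in_closed_set[OF closed_complex_Reals _ _ td[OF x]]) (use ur[OF x] in auto)
    then show ?thesis by (simp add: g_def of_real_Re)
  qed
  have gl: "one_lipschitz X \<rho> g"
    unfolding one_lipschitz_def
  proof (intro ballI)
    fix x y assume xy: "x \<in> X" "y \<in> X"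
    have "(\<lambda>m. cmod (u m x - u m y)) \<longlonglongrightarrow> cmod (trc (dirac X x) f - trc (dirac X y) f)"
      by (intro tendsto_intros td xy)
    then have "cmod (trc (dirac X x) f - trc (dirac X y) f) \<le> \<rho> x y"
      by (rule LIMSEQ_le_const2) (use ul[OF xy] in auto)
    then show "\<bar>g x - g y\<bar> \<le> \<rho> x y"
      unfolding gt[OF xy(1)] gt[OF xy(2)] of_real_diff[symmetric] norm_of_real .
  qed
  have lg: "(\<lambda>m. u m x) \<longlonglongrightarrow> of_real (g x)" if "x \<in> X" for x
    using td[OF that] gt[OF that] by simp
  have gm: "g \<in> borel_measurable (borel_on X)"
  proof (rule borel_measurable_LIMSEQ_metric)
    show "(\<lambda>x. Re (u m x)) \<in> borel_measurable (borel_on X)" for m using um by measurable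
    show "(\<lambda>m. Re (u m x)) \<longlonglongrightarrow> g x" if "x \<in> space (borel_on X)" for x
      using tendsto_Re[OF lg, of x] that by (simp add: space_restrict_space)
  qed
  \<comment> \<open>A convergent sequence is bounded; as the functions oscillate by at most
    \<open>D\<close>, the constant \<open>K + D\<close> dominates them all.\<close>
  obtain K where K: "\<And>m. cmod (u m x0) \<le> K"
    using convergent_imp_Bseq[OF convergentI[OF td[OF base_points(1)]]] by (metis BseqE)
  have "trc \<nu> f = of_real (\<integral>x. g x \<partial>\<nu>)" if nu: "\<nu> \<in> borel_probs X" for \<nu>
  proof -
    interpret nu: prob_space \<nu> using nu by (simp add: borel_probs_def)
    have sets: "sets \<nu> = sets (borel_on X)" using nu by (simp add: borel_probs_def)
    have sp: "space \<nu> = X" using sets_eq_imp_space_eq[OF sets] by (simp add: space_restrict_space)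
    have gm': "g \<in> borel_measurable \<nu>" using gm by (simp add: measurable_cong_sets[OF sets refl])
    have "(\<lambda>m. \<integral>x. u m x \<partial>\<nu>) \<longlonglongrightarrow> (\<integral>x. complex_of_real (g x) \<partial>\<nu>)"
    proof (rule integral_dominated_convergence[where w = "\<lambda>_. K + D"])
      show "(\<lambda>x. complex_of_real (g x)) \<in> borel_measurable \<nu>" using gm' by measurable
      show "u m \<in> borel_measurable \<nu>" for m using um by (simp add: measurable_cong_sets[OF sets refl])
      show "AE x in \<nu>. (\<lambda>m. u m x) \<longlonglongrightarrow> complex_of_real (g x)" using lg sp by auto
      show "AE x in \<nu>. norm (u m x) \<le> K + D" for m
      proof (rule AE_I2)
        fix x assume "x \<in> space \<nu>"
        then have x: "x \<in> X" using sp by simp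
        have "cmod (u m x) \<le> cmod (u m x0) + cmod (u m x - u m x0)" by (rule norm_triangle_sub)
        also have "\<dots> \<le> K + D"
          using K ul[OF x base_points(1)] bound[OF x base_points(1)] by (intro add_mono) (auto intro: order_trans)
        finally show "norm (u m x) \<le> K + D" .
      qed
    qed simp
    then show ?thesis using LIMSEQ_unique[OF tl[OF nu]] by simp
  qed
  then show ?thesis using that fZ gl gm gt by blast
qed

end

section \<open>Specialization to the sphere\<close>

lemma empirical_borel_probs:
  assumes "0 < n" "\<And>i. s i \<in> X"
  shows "empirical X n s \<in> borel_probs X"
proof -
  have "s \<in> measurable (uniform_count_measure {1..n}) (borel_on X)"
    using assms(2) by (auto simp: measurable_def space_restrict_space
        space_uniform_count_measure sets_uniform_count_measure)
  then show ?thesis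
    using assms(1) unfolding empirical_def borel_probs_def
    by (auto intro!: prob_space.prob_space_distr prob_space_uniform_count_measure)
qed

lemma integral_empirical:
  fixes g :: "'x::topological_space \<Rightarrow> real"
  assumes "\<And>i. s i \<in> X" "g \<in> borel_measurable (borel_on X)"
  shows "(\<integral>x. g x \<partial>empirical X n s) = (\<Sum>i=1..n. g (s i)) / real n"
proof -
  have s: "s \<in> measurable (uniform_count_measure {1..n}) (borel_on X)"
    using assms(1) by (auto simp: measurable_def space_restrict_space
        space_uniform_count_measure sets_uniform_count_measure)
  show ?thesis
    unfolding empirical_def integral_distr[OF s assms(2)]
    by (subst integral_uniform_count_measure) auto
qed

lemma one_lipschitz_geodesic_iff:
  "one_lipschitz (sphere 0 1) geodesic_dist g \<longleftrightarrow> angle_lipschitz g"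
  by (simp add: one_lipschitz_def angle_lipschitz_def geodesic_dist_def)

lemma geodesic_dist_pos:
  assumes x: "x \<in> sphere 0 1" and y: "y \<in> sphere 0 1" and "x \<noteq> y"
  shows "0 < geodesic_dist x y"
proof -
  have "x \<bullet> y \<noteq> 1"
  proof
    assume "x \<bullet> y = 1"
    then have "(norm (x - y))\<^sup>2 = 0"
      using x y by (simp add: power2_norm_eq_inner inner_diff inner_commute norm_eq_1)
    then show False using \<open>x \<noteq> y\<close> by simp
  qed
  then have "x \<bullet> y < 1" using inner_sphere_bounds[OF x y] by simp
  then have "arccos 1 < arccos (x \<bullet> y)"
    using inner_sphere_bounds[OF x y] by (intro arccos_less_arccos) auto
  then show ?thesis by (simp add: geodesic_dist_def)
qed

text \<open>\<open>sphere_haar\<close> speaks of rotations, that is, of determinant 1; from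
  dimension 2 on these already act transitively on the sphere.\<close>

lemma sphere_haar_transitive:
  fixes \<mu> :: "(real ^ 'k) measure"
  assumes mu: "sphere_haar \<mu>" and card: "2 \<le> CARD('k)"
    and x: "x \<in> sphere 0 1" and y: "y \<in> sphere 0 1"
  shows "\<exists>T. orthogonal_transformation T \<and> T x = y \<and> distr \<mu> \<mu> T = \<mu>"
proof -
  obtain T where T: "orthogonal_transformation T" "Determinants.det (matrix T) = 1" "T x = y"
    using rotation_exists_1[OF card, of x y] x y by auto
  have "rotation_matrix (matrix T)"
    using T by (simp add: rotation_matrix_def orthogonal_transformation_matrix)
  moreover have "(\<lambda>x. matrix T *v x) = T"
    using orthogonal_transformation_linear[OF T(1)] by (simp add: fun_eq_iff matrix_works)
  ultimately have "distr \<mu> \<mu> T = \<mu>" using mu by (metis sphere_haar_def)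
  then show ?thesis using T by blast
qed


lemma sphere_core_trace_function:
  fixes trc :: "(real ^ 'k) measure \<Rightarrow> 'z \<Rightarrow> complex"
  assumes model: "model_algebra (sphere 0 1) geodesic_dist x0 x1 p q A \<phi> Z \<psi> trc"
    and f: "f \<in> core (sphere 0 1) geodesic_dist A \<phi> \<psi>"
  shows "\<exists>g. f \<in> carrier Z \<and> angle_lipschitz g \<and>
    (\<forall>x\<in>sphere 0 1. trc (dirac (sphere 0 1) x) f = of_real (g x)) \<and>
    (\<forall>\<nu>\<in>borel_probs (sphere 0 1). trc \<nu> f = of_real (\<integral>x. g x \<partial>\<nu>))"
proof -
  interpret model_algebra "sphere 0 1" geodesic_dist x0 x1 p q A \<phi> Z \<psi> trc by (rule model)
  show ?thesis
  proof (rule core_trace_function[OF f, of pi])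
    fix x y :: "real ^ 'k" assume xy: "x \<in> sphere 0 1" "y \<in> sphere 0 1"
    show "0 < geodesic_dist x y" if "x \<noteq> y" by (rule geodesic_dist_pos[OF xy that])
    show "geodesic_dist x y \<le> pi" using arccos_inner_le_pi[OF xy] by (simp add: geodesic_dist_def)
  next
    fix x :: "real ^ 'k" assume "x \<in> sphere 0 1"
    then show "0 \<le> geodesic_dist x x" using arccos_inner_le_pi by (simp add: geodesic_dist_def)
  next
    fix g assume "f \<in> carrier Z" "one_lipschitz (sphere 0 1) geodesic_dist g"
      "\<And>x. x \<in> sphere 0 1 \<Longrightarrow> trc (dirac (sphere 0 1) x) f = of_real (g x)"
      "\<And>\<nu>. \<nu> \<in> borel_probs (sphere 0 1) \<Longrightarrow> trc \<nu> f = of_real (\<integral>x. g x \<partial>\<nu>)"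
    then show ?thesis unfolding one_lipschitz_geodesic_iff by blast
  qed
qed

theorem theorem5:
  fixes k :: nat
    and \<mu> :: "(real ^ 'k) measure"
    and B :: "('b, 'l) cstar_scheme"
    and \<tau>\<^sub>B :: "'b \<Rightarrow> complex"
    and x0 x1 :: "real ^ 'k"
    and p q :: "nat \<Rightarrow> nat"
    and A :: "nat \<Rightarrow> (real ^ 'k \<Rightarrow> complex mat) cstar"
    and \<phi> :: "nat \<Rightarrow> (real ^ 'k \<Rightarrow> complex mat) \<Rightarrow> (real ^ 'k \<Rightarrow> complex mat)"
    and Z :: "('z, 'm) cstar_scheme"
    and \<psi> :: "nat \<Rightarrow> (real ^ 'k \<Rightarrow> complex mat) \<Rightarrow> 'z"
    and trc :: "(real ^ 'k) measure \<Rightarrow> 'z \<Rightarrow> complex"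
    and \<Phi> :: "(real ^ 'k) measure \<Rightarrow> 'z \<Rightarrow> 'b"
  assumes "k = CARD('k)" and "3 \<le> k" and "odd (k - 1)"
    and "sphere_haar \<mu>"
    and "cstar_algebra B" and "simple_cstar B" and "separable_cstar B" and "nuclear_cstar B"
    and "Z_stable B" and "tracial_states B = {\<tau>\<^sub>B}" and "real_rank_zero B" and "trivial_K1 B"
    and "model_algebra (sphere 0 1) geodesic_dist x0 x1 p q A \<phi> Z \<psi> trc"
    and "\<And>\<nu>. \<nu> \<in> borel_probs (sphere 0 1) \<Longrightarrow> \<Phi> \<nu> \<in> star_embedding Z B"
    and "\<And>\<nu> f. \<lbrakk>\<nu> \<in> borel_probs (sphere 0 1); f \<in> carrier Z\<rbrakk> \<Longrightarrow> \<tau>\<^sub>B (\<Phi> \<nu> f) = trc \<nu> f"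
  shows "((SUP f\<in>core (sphere 0 1) geodesic_dist A \<phi> \<psi>.
      ereal (prob_space.variance \<mu> (\<lambda>x. Re (\<tau>\<^sub>B (\<Phi> (dirac (sphere 0 1) x) f)))))
    \<le> ereal (1 / (real k - 2))) \<and>
    (\<forall>\<epsilon>>0. \<forall>\<^sub>F n in sequentially.
      measure (\<Pi>\<^sub>M i\<in>(UNIV :: nat set). \<mu>)
        {s \<in> space (\<Pi>\<^sub>M i\<in>(UNIV :: nat set). \<mu>).
          (SUP f\<in>core (sphere 0 1) geodesic_dist A \<phi> \<psi>.
             ereal (cmod (\<tau>\<^sub>B (\<Phi> (empirical (sphere 0 1) n s) f) - \<tau>\<^sub>B (\<Phi> \<mu> f)))) \<le> ereal \<epsilon>}
      \<ge> 1 - exp (- (real n * \<epsilon>\<^sup>2 / pi\<^sup>2)))"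
proof -
  let ?S = "sphere (0 :: real ^ 'k) 1"
  let ?C = "core ?S geodesic_dist A \<phi> \<psi>"
  note k = assms(1,2) and haar = assms(4) and model = assms(13) and trace = assms(15)
  interpret model_algebra ?S geodesic_dist x0 x1 p q A \<phi> Z \<psi> trc by (rule model)
  have mu: "\<mu> \<in> borel_probs ?S" using haar by (simp add: sphere_haar_def)
  have "sphere_prob \<mu>"
    using mu unfolding borel_probs_def sphere_prob_def sphere_prob_axioms_def by blast
  then interpret sphere_prob \<mu> .
  have "\<forall>f\<in>?C. \<exists>g. f \<in> carrier Z \<and> angle_lipschitz g \<and>
      (\<forall>x\<in>?S. trc (dirac ?S x) f = of_real (g x)) \<and>
      (\<forall>\<nu>\<in>borel_probs ?S. trc \<nu> f = of_real (\<integral>x. g x \<partial>\<nu>))"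
    using sphere_core_trace_function[OF model] by blast
  \<comment> \<open>The choice is made once, so that both claims refer to the same family of trace
    functions \<open>g f\<close>.\<close>
  from bchoice[OF this] obtain g where *: "\<forall>f\<in>?C. f \<in> carrier Z \<and> angle_lipschitz (g f) \<and>
      (\<forall>x\<in>?S. trc (dirac ?S x) f = of_real (g f x)) \<and>
      (\<forall>\<nu>\<in>borel_probs ?S. trc \<nu> f = of_real (\<integral>x. g f x \<partial>\<nu>))" ..
  then have g: "\<And>f. f \<in> ?C \<Longrightarrow> f \<in> carrier Z" "\<And>f. f \<in> ?C \<Longrightarrow> angle_lipschitz (g f)"
    "\<And>f x. f \<in> ?C \<Longrightarrow> x \<in> ?S \<Longrightarrow> trc (dirac ?S x) f = of_real (g f x)"
    "\<And>f \<nu>. f \<in> ?C \<Longrightarrow> \<nu> \<in> borel_probs ?S \<Longrightarrow> trc \<nu> f = of_real (\<integral>x. g f x \<partial>\<nu>)"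
    by blast+
  have var: "prob_space.variance \<mu> (\<lambda>x. Re (\<tau>\<^sub>B (\<Phi> (dirac ?S x) f))) \<le> 1 / (real k - 2)"
    if f: "f \<in> ?C" for f
  proof -
    \<comment> \<open>The trace function of a core element is real, so \<open>Re\<close> loses
      nothing.\<close>
    have r: "Re (\<tau>\<^sub>B (\<Phi> (dirac ?S x) f)) = g f x" if "x \<in> space \<mu>" for x
      using that trace[OF dirac_borel_probs g(1)[OF f], of x] g(3)[OF f, of x] by (simp add: space_mu)
    then have "(\<integral>x. Re (\<tau>\<^sub>B (\<Phi> (dirac ?S x) f)) \<partial>\<mu>) = (\<integral>x. g f x \<partial>\<mu>)"
      by (rule Bochner_Integration.integral_cong[OF refl])
    then have "prob_space.variance \<mu> (\<lambda>x. Re (\<tau>\<^sub>B (\<Phi> (dirac ?S x) f))) = vari \<mu> (g f)"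
      using r by (intro Bochner_Integration.integral_cong refl) simp
    also have "\<dots> \<le> 1 / (real DIM(real ^ 'k) - 2)"
      using k by (intro vari_invariant_angle_lipschitz prob_space_axioms sets_mu
          sphere_haar_transitive[OF haar] g(2)[OF f]) auto
    finally show ?thesis using k by simp
  qed
  have dev: "cmod (\<tau>\<^sub>B (\<Phi> (empirical ?S n s) f) - \<tau>\<^sub>B (\<Phi> \<mu> f)) = deviation \<mu> {1..n} (g f) s"
    if f: "f \<in> ?C" and n: "0 < n" and s: "s \<in> space (\<Pi>\<^sub>M i\<in>(UNIV :: nat set). \<mu>)" for f n s
  proof -
    \<comment> \<open>With all sample points on the sphere and \<open>n\<close> positive, the
      empirical measure is a Borel probability measure there, so its embedding realises the
      corresponding trace.\<close>
    have s': "s i \<in> ?S" for i using s by (auto simp: space_PiM PiE_iff space_mu)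
    have "g f \<in> borel_measurable (borel_on ?S)"
      using measurable_angle_lipschitz[OF g(2)[OF f]] by (simp add: measurable_cong_sets[OF sets_mu refl])
    then have "\<tau>\<^sub>B (\<Phi> (empirical ?S n s) f) = of_real ((\<Sum>i=1..n. g f (s i)) / real n)"
      using trace[OF empirical_borel_probs[OF n s'] g(1)[OF f]] g(4)[OF f empirical_borel_probs[OF n s']]
      by (simp only: integral_empirical[OF s'])
    moreover have "\<tau>\<^sub>B (\<Phi> \<mu> f) = of_real (\<integral>x. g f x \<partial>\<mu>)"
      using trace[OF mu g(1)[OF f]] g(4)[OF f mu] by simp
    ultimately show ?thesis
      by (simp only: deviation_def card_atLeastAtMost diff_Suc_1 of_real_diff[symmetric] norm_of_real)
  qed
  show ?thesis
  proof (intro conjI allI impI)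
    show "(SUP f\<in>?C. ereal (prob_space.variance \<mu> (\<lambda>x. Re (\<tau>\<^sub>B (\<Phi> (dirac ?S x) f))))) \<le> ereal (1 / (real k - 2))"
      using var by (intro SUP_least) simp
  next
    fix \<epsilon> :: real assume e: "\<epsilon> > 0"
    have "\<forall>\<^sub>F n in sequentially. 1 - exp (- (real n * \<epsilon>\<^sup>2 / pi\<^sup>2)) \<le>
      measure (\<Pi>\<^sub>M i\<in>(UNIV :: nat set). \<mu>)
        {s \<in> space (\<Pi>\<^sub>M i\<in>(UNIV :: nat set). \<mu>). \<forall>h\<in>g ` ?C. deviation \<mu> {1..n} h s \<le> \<epsilon>}"
      by (rule empirical_deviation_eventually) (use g(2) e in auto)
    then show "\<forall>\<^sub>F n in sequentially.
      measure (\<Pi>\<^sub>M i\<in>(UNIV :: nat set). \<mu>)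
        {s \<in> space (\<Pi>\<^sub>M i\<in>(UNIV :: nat set). \<mu>).
          (SUP f\<in>?C. ereal (cmod (\<tau>\<^sub>B (\<Phi> (empirical ?S n s) f) - \<tau>\<^sub>B (\<Phi> \<mu> f)))) \<le> ereal \<epsilon>}
      \<ge> 1 - exp (- (real n * \<epsilon>\<^sup>2 / pi\<^sup>2))"
      \<comment> \<open>For \<open>n = 0\<close> the empirical measure is not a probability measure,
        so \<open>dev\<close> starts at \<open>n = 1\<close>.\<close>
      using eventually_gt_at_top[of 0]
    proof eventually_elim
      case (elim n)
      have "{s \<in> space (\<Pi>\<^sub>M i\<in>(UNIV :: nat set). \<mu>).
          (SUP f\<in>?C. ereal (cmod (\<tau>\<^sub>B (\<Phi> (empirical ?S n s) f) - \<tau>\<^sub>B (\<Phi> \<mu> f)))) \<le> ereal \<epsilon>}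
        = {s \<in> space (\<Pi>\<^sub>M i\<in>(UNIV :: nat set). \<mu>). \<forall>h\<in>g ` ?C. deviation \<mu> {1..n} h s \<le> \<epsilon>}"
        using dev[OF _ elim(2)] by (intro Collect_cong conj_cong refl) (auto simp: SUP_le_iff)
      then show ?case using elim(1) by (simp only:)
    qed
  qed
qed

end
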